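(* Let $X$ be a compact complex manifold of complex dimension $n$. Then for all $p,q$, $$g^{p,q}_{\partial}=g^{p+1,q-1}_{\bar\partial}.$$
   Context: On smooth complex-valued $(p,q)$-forms on $X$, define $H^{p,q}_A=\ker(\partial\bar\partial)/(\operatorname{im}(\partial)+\operatorname{im}(\bar\partial))$, $H^{p,q}_{\bar\partial}=\ker(\bar\partial)/\operatorname{im}(\bar\partial)$, $H^{p,q}_{\partial}=\ker(\partial)/\operatorname{im}(\partial)$ (all spaces in bidegree $(p,q)$; spaces outside the range $0\le p,q\le n$ are zero). Consider the maps $\partial:H^{p,q}_A\to H^{p+1,q}_{\bar\partial}$, $[\theta]_A\mapsto[\partial\theta]_{\bar\partial}$, and $\bar\partial:H^{p,q}_A\to H^{p,q+1}_{\partial}$, $[\theta]_A\mapsto[\bar\partial\theta]_{\partial}$, and the natural maps $\pi_A:H^{p,q}_{\partial}\to H^{p,q}_A$ and $\pi_A:H^{p,q}_{\bar\partial}\to H^{p,q}_A$ induced by the identity on forms. Set $$\mathcal G^{p,q}_{\partial}=\ker(\partial:H^{p,q}_A\to H^{p+1,q}_{\bar\partial}),\qquad G^{p,q}_{\partial}=\mathcal G^{p,q}_{\partial}/\operatorname{im}(\pi_A:H^{p,q}_{\partial}\to H^{p,q}_A),$$ $$\mathcal G^{p,q}_{\bar\partial}=\ker(\bar\partial:H^{p,q}_A\to H^{p,q+1}_{\partial}),\qquad G^{p,q}_{\bar\partial}=\mathcal G^{p,q}_{\bar\partial}/\operatorname{im}(\pi_A:H^{p,q}_{\bar\partial}\to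 H^{p,q}_A),$$ and $g^{p,q}_{\partial}=\dim_{\mathbb C}G^{p,q}_{\partial}$, $g^{p,q}_{\bar\partial}=\dim_{\mathbb C}G^{p,q}_{\bar\partial}$. *)

theory Defs
  imports "HOL-Analysis.Analysis" "HOL-Algebra.AbelCoset" "HOL-Algebra.Module"
    "HOL-Library.Extended_Nat"
begin

section \<open>Quotients and dimension of complex vector spaces\<close>

text \<open>
  A complex vector space is given by a HOL-Algebra record whose scalars are the type
  \<^typ>\<open>complex\<close>; the fields \<^const>\<open>mult\<close> and \<^const>\<open>one\<close> of the record are never used.
  A subspace \<open>S\<close> of \<open>M\<close> is the record \<open>M\<lparr>carrier := S\<rparr>\<close>.
\<close>

type_synonym 'v cvs = "(complex, 'v) module"

definition quot_space :: "'v cvs \<Rightarrow> 'v set \<Rightarrow> 'v set cvs" where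
  "quot_space M W =
     \<lparr>carrier = a_rcosets\<^bsub>M\<^esub> W, mult = undefined, one = undefined,
      zero = W, add = set_add M,
      smult = (\<lambda>c C. \<Union>x\<in>C. W +>\<^bsub>M\<^esub> (c \<odot>\<^bsub>M\<^esub> x))\<rparr>"

text \<open>
  The map \<open>[x] \<mapsto> [f x]\<close> into the quotient of \<open>N\<close> by \<open>W\<close>. When it is well defined, all the
  cosets in the union are equal.
\<close>

definition induced_map :: "'w cvs \<Rightarrow> 'w set \<Rightarrow> ('v \<Rightarrow> 'w) \<Rightarrow> 'v set \<Rightarrow> 'w set" where
  "induced_map N W f C = (\<Union>x\<in>C. W +>\<^bsub>N\<^esub> f x)"

definition finite_basis :: "'v cvs \<Rightarrow> 'v set \<Rightarrow> bool" where
  "finite_basis M B \<longleftrightarrow> finite B \<and> B \<subseteq> carrier M \<and>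
     (\<forall>x\<in>carrier M. \<exists>!a. a \<in> B \<rightarrow>\<^sub>E (UNIV :: complex set) \<and> x = (\<Oplus>\<^bsub>M\<^esub>b\<in>B. a b \<odot>\<^bsub>M\<^esub> b))"

text \<open>
  The value \<open>\<infinity>\<close> marks infinite dimension. It is not attained on a compact manifold, but the
  definition of the dimension should not presuppose this.
\<close>

definition cdim :: "'v cvs \<Rightarrow> enat" where
  "cdim M = (if \<exists>B. finite_basis M B then enat (card (SOME B. finite_basis M B)) else \<infinity>)"


section \<open>Complex manifolds\<close>

definition holo_on :: "(complex^'n \<Rightarrow> complex^'m) \<Rightarrow> (complex^'n) set \<Rightarrow> bool" where
  "holo_on F W \<longleftrightarrow>
     (\<forall>x\<in>W. \<exists>F'. (F has_derivative F') (at x) \<and> Vector_Spaces.linear (*s) (*s) F')"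

text \<open>
  A chart is a pair of its domain and a coordinate map, which is only relevant on the domain.
\<close>

type_synonym ('a, 'n) chart = "'a set \<times> ('a \<Rightarrow> complex^'n)"

definition chart_image :: "('a, 'n::finite) chart \<Rightarrow> (complex^'n) set" where
  "chart_image c = snd c ` fst c"

definition transition :: "('a, 'n::finite) chart \<Rightarrow> ('a, 'n) chart \<Rightarrow> complex^'n \<Rightarrow> complex^'n" where
  "transition c d = snd d \<circ> inv_into (fst c) (snd c)"

definition transition_dom :: "('a, 'n::finite) chart \<Rightarrow> ('a, 'n) chart \<Rightarrow> (complex^'n) set" where
  "transition_dom c d = snd c ` (fst c \<inter> fst d)"

text \<open>
  \<open>X\<close> with the holomorphic atlas \<open>A\<close> is a complex manifold, of complex dimension \<open>CARD('n)\<close>.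
  The atlas need not be maximal.
\<close>

definition complex_manifold :: "'a topology \<Rightarrow> ('a, 'n::finite) chart set \<Rightarrow> bool" where
  "complex_manifold X A \<longleftrightarrow>
     Hausdorff_space X \<and> second_countable X \<and>
     (\<forall>c\<in>A. openin X (fst c) \<and> open (chart_image c) \<and>
        homeomorphic_map (subtopology X (fst c)) (top_of_set (chart_image c)) (snd c)) \<and>
     (\<Union>c\<in>A. fst c) = topspace X \<and>
     (\<forall>c\<in>A. \<forall>d\<in>A. holo_on (transition c d) (transition_dom c d))"


section \<open>Smooth forms of type \<open>(p,q)\<close>\<close>

text \<open>\<open>C\<^sup>k\<close> functions on an open set\<close>

primrec Ck_on :: "nat \<Rightarrow> ('e::real_normed_vector \<Rightarrow> 'f::real_normed_vector) \<Rightarrow> 'e set \<Rightarrow> bool" where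
  "Ck_on 0 f U \<longleftrightarrow> continuous_on U f"
| "Ck_on (Suc k) f U \<longleftrightarrow>
     (\<forall>x\<in>U. f differentiable (at x)) \<and> (\<forall>v. Ck_on k (\<lambda>x. frechet_derivative f (at x) v) U)"

definition smooth_on :: "('e::real_normed_vector \<Rightarrow> 'f::real_normed_vector) \<Rightarrow> 'e set \<Rightarrow> bool" where
  "smooth_on f U \<longleftrightarrow> (\<forall>k. Ck_on k f U)"

text \<open>
  A \<open>k\<close>-form at a point takes a sequence of tangent vectors, of which it only uses the first \<open>k\<close>.
  The value of \<open>\<alpha>\<^sub>0 \<and> \<dots> \<and> \<alpha>\<^sub>k\<^sub>-\<^sub>1\<close> is the determinant of the matrix \<open>\<alpha>\<^sub>i (v\<^sub>j)\<close>.
\<close>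

definition wedge :: "nat \<Rightarrow> (nat \<Rightarrow> 'e \<Rightarrow> complex) \<Rightarrow> (nat \<Rightarrow> 'e) \<Rightarrow> complex" where
  "wedge k \<alpha> v = (\<Sum>\<sigma> | \<sigma> permutes {..<k}. of_int (sign \<sigma>) * (\<Prod>i<k. \<alpha> i (v (\<sigma> i))))"

text \<open>
  \<open>\<Lambda>\<^sup>p\<^sup>,\<^sup>q\<close> of the cotangent space: the complex span of the wedge products of \<open>p\<close> complex linear
  and \<open>q\<close> conjugate linear covectors, that is, of the \<open>dz\<^sub>I \<and> d\<bar>z\<^sub>J\<close> with \<open>|I| = p\<close>, \<open>|J| = q\<close>.
  It is zero if \<open>p\<close> or \<open>q\<close> exceeds the dimension.
\<close>

definition covectors :: "nat \<Rightarrow> nat \<Rightarrow> ((nat \<Rightarrow> complex^'n) \<Rightarrow> complex) set" where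
  "covectors p q = {\<eta>. \<exists>m (c :: nat \<Rightarrow> complex) (\<alpha> :: nat \<Rightarrow> nat \<Rightarrow> complex^'n \<Rightarrow> complex).
     (\<forall>j<m. \<forall>i<p. Vector_Spaces.linear (*s) (*) (\<alpha> j i)) \<and>
     (\<forall>j<m. \<forall>i\<in>{p..<p+q}. Vector_Spaces.linear (*s) (*) (\<lambda>v. cnj (\<alpha> j i v))) \<and>
     \<eta> = (\<lambda>v. \<Sum>j<m. c j * wedge (p + q) (\<alpha> j) v)}"

text \<open>
  A form on the manifold is the family of its expressions in the charts of the atlas, compatible
  under pullback by the transition maps. Expressions are zero outside the image of the chart, and
  for charts not in the atlas, so that a form determines the family uniquely.
\<close>

type_synonym ('a, 'n) form =
  "('a, 'n) chart \<Rightarrow> complex^'n \<Rightarrow> (nat \<Rightarrow> complex^'n) \<Rightarrow> complex"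

definition forms :: "('a, 'n::finite) chart set \<Rightarrow> int \<Rightarrow> int \<Rightarrow> ('a, 'n) form set" where
  "forms A p q =
     (if 0 \<le> p \<and> 0 \<le> q then
        {\<omega>. (\<forall>c x. \<not> (c \<in> A \<and> x \<in> chart_image c) \<longrightarrow> \<omega> c x = (\<lambda>v. 0)) \<and>
            (\<forall>c\<in>A. \<forall>v. smooth_on (\<lambda>x. \<omega> c x v) (chart_image c)) \<and>
            (\<forall>c\<in>A. \<forall>x\<in>chart_image c. \<omega> c x \<in> covectors (nat p) (nat q)) \<and>
            (\<forall>c\<in>A. \<forall>d\<in>A. \<forall>x\<in>transition_dom c d. \<forall>v.
               \<omega> c x v =
               \<omega> d (transition c d x) (\<lambda>i. frechet_derivative (transition c d) (at x) (v i)))}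
      else {\<lambda>c x v. 0})"

definition form_space :: "('a, 'n::finite) chart set \<Rightarrow> int \<Rightarrow> int \<Rightarrow> ('a, 'n) form cvs" where
  "form_space A p q =
     \<lparr>carrier = forms A p q, mult = undefined, one = undefined,
      zero = (\<lambda>c x v. 0), add = (\<lambda>\<omega> \<eta> c x v. \<omega> c x v + \<eta> c x v),
      smult = (\<lambda>a \<omega> c x v. a * \<omega> c x v)\<rparr>"


section \<open>The operators \<open>\<partial>\<close> and \<open>\<partial>\<bar>\<close>\<close>

text \<open>
  The complex linear and the conjugate linear part of the derivative:
  \<open>\<Sum>\<^sub>j v\<^sub>j \<partial>f/\<partial>z\<^sub>j\<close> and \<open>\<Sum>\<^sub>j cnj v\<^sub>j \<partial>f/\<partial>\<bar>z\<^sub>j\<close>.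
\<close>

definition wirt :: "complex^'n \<Rightarrow> (complex^'n \<Rightarrow> complex) \<Rightarrow> complex^'n \<Rightarrow> complex" where
  "wirt v f x =
     (frechet_derivative f (at x) v - \<i> * frechet_derivative f (at x) (\<i> *s v)) / 2"

definition wirt_bar :: "complex^'n \<Rightarrow> (complex^'n \<Rightarrow> complex) \<Rightarrow> complex^'n \<Rightarrow> complex" where
  "wirt_bar v f x =
     (frechet_derivative f (at x) v + \<i> * frechet_derivative f (at x) (\<i> *s v)) / 2"

definition omit :: "nat \<Rightarrow> (nat \<Rightarrow> 'e) \<Rightarrow> nat \<Rightarrow> 'e" where
  "omit i v j = (if j < i then v j else v (Suc j))"

text \<open>
  The usual formula \<open>d\<omega> (v\<^sub>0, \<dots>, v\<^sub>k) = \<Sum>\<^sub>i (-1)\<^sup>i D\<^bsub>v\<^sub>i\<^esub> \<omega> (\<dots>, v\<^sub>i omitted, \<dots>)\<close> of the exterior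
  derivative in a chart, with the derivative replaced by its complex linear or conjugate linear
  part. On \<open>f dz\<^sub>I \<and> d\<bar>z\<^sub>J\<close> this is \<open>\<Sum>\<^sub>j \<partial>f/\<partial>z\<^sub>j dz\<^sub>j \<and> dz\<^sub>I \<and> d\<bar>z\<^sub>J\<close>, respectively
  \<open>\<Sum>\<^sub>j \<partial>f/\<partial>\<bar>z\<^sub>j d\<bar>z\<^sub>j \<and> dz\<^sub>I \<and> d\<bar>z\<^sub>J\<close>. The arguments \<open>p\<close> and \<open>q\<close> are the bidegree of \<open>\<omega>\<close>.
\<close>

definition del :: "('a, 'n::finite) chart set \<Rightarrow> int \<Rightarrow> int \<Rightarrow> ('a, 'n) form \<Rightarrow> ('a, 'n) form" where
  "del A p q \<omega> = (\<lambda>c x v.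
     if c \<in> A \<and> x \<in> chart_image c
     then \<Sum>i\<le>nat (p + q). (-1) ^ i * wirt (v i) (\<lambda>y. \<omega> c y (omit i v)) x else 0)"

definition delbar :: "('a, 'n::finite) chart set \<Rightarrow> int \<Rightarrow> int \<Rightarrow> ('a, 'n) form \<Rightarrow> ('a, 'n) form" where
  "delbar A p q \<omega> = (\<lambda>c x v.
     if c \<in> A \<and> x \<in> chart_image c
     then \<Sum>i\<le>nat (p + q). (-1) ^ i * wirt_bar (v i) (\<lambda>y. \<omega> c y (omit i v)) x else 0)"


section \<open>Cohomology\<close>

text \<open>Images, taken in bidegree \<open>(p,q)\<close>\<close>

definition im_del :: "('a, 'n::finite) chart set \<Rightarrow> int \<Rightarrow> int \<Rightarrow> ('a, 'n) form set" where
  "im_del A p q = del A (p - 1) q ` forms A (p - 1) q"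

definition im_delbar :: "('a, 'n::finite) chart set \<Rightarrow> int \<Rightarrow> int \<Rightarrow> ('a, 'n) form set" where
  "im_delbar A p q = delbar A p (q - 1) ` forms A p (q - 1)"

definition im_sum :: "('a, 'n::finite) chart set \<Rightarrow> int \<Rightarrow> int \<Rightarrow> ('a, 'n) form set" where
  "im_sum A p q = im_del A p q <+>\<^bsub>form_space A p q\<^esub> im_delbar A p q"

definition H_del :: "('a, 'n::finite) chart set \<Rightarrow> int \<Rightarrow> int \<Rightarrow> ('a, 'n) form set cvs" where
  "H_del A p q = quot_space
     (form_space A p q \<lparr>carrier := {\<theta> \<in> forms A p q. del A p q \<theta> = (\<lambda>c x v. 0)}\<rparr>)
     (im_del A p q)"

definition H_delbar :: "('a, 'n::finite) chart set \<Rightarrow> int \<Rightarrow> int \<Rightarrow> ('a, 'n) form set cvs" where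
  "H_delbar A p q = quot_space
     (form_space A p q \<lparr>carrier := {\<theta> \<in> forms A p q. delbar A p q \<theta> = (\<lambda>c x v. 0)}\<rparr>)
     (im_delbar A p q)"

definition H_A :: "('a, 'n::finite) chart set \<Rightarrow> int \<Rightarrow> int \<Rightarrow> ('a, 'n) form set cvs" where
  "H_A A p q = quot_space
     (form_space A p q \<lparr>carrier :=
        {\<theta> \<in> forms A p q. del A p (q + 1) (delbar A p q \<theta>) = (\<lambda>c x v. 0)}\<rparr>)
     (im_sum A p q)"

definition del_map :: "('a, 'n::finite) chart set \<Rightarrow> int \<Rightarrow> int \<Rightarrow> ('a, 'n) form set \<Rightarrow> ('a, 'n) form set"
  where "del_map A p q = induced_map (form_space A (p + 1) q) (im_delbar A (p + 1) q) (del A p q)"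

definition delbar_map :: "('a, 'n::finite) chart set \<Rightarrow> int \<Rightarrow> int \<Rightarrow> ('a, 'n) form set \<Rightarrow> ('a, 'n) form set"
  where "delbar_map A p q = induced_map (form_space A p (q + 1)) (im_del A p (q + 1)) (delbar A p q)"

text \<open>This serves for both \<open>H_del \<rightarrow> H_A\<close> and \<open>H_delbar \<rightarrow> H_A\<close>.\<close>

definition pi_A :: "('a, 'n::finite) chart set \<Rightarrow> int \<Rightarrow> int \<Rightarrow> ('a, 'n) form set \<Rightarrow> ('a, 'n) form set"
  where "pi_A A p q = induced_map (form_space A p q) (im_sum A p q) id"

definition calG_del :: "('a, 'n::finite) chart set \<Rightarrow> int \<Rightarrow> int \<Rightarrow> ('a, 'n) form set set" where
  "calG_del A p q = {C \<in> carrier (H_A A p q). del_map A p q C = \<zero>\<^bsub>H_delbar A (p + 1) q\<^esub>}"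

definition calG_delbar :: "('a, 'n::finite) chart set \<Rightarrow> int \<Rightarrow> int \<Rightarrow> ('a, 'n) form set set" where
  "calG_delbar A p q = {C \<in> carrier (H_A A p q). delbar_map A p q C = \<zero>\<^bsub>H_del A p (q + 1)\<^esub>}"

definition G_del :: "('a, 'n::finite) chart set \<Rightarrow> int \<Rightarrow> int \<Rightarrow> ('a, 'n) form set set cvs" where
  "G_del A p q = quot_space (H_A A p q \<lparr>carrier := calG_del A p q\<rparr>)
     (pi_A A p q ` carrier (H_del A p q))"

definition G_delbar :: "('a, 'n::finite) chart set \<Rightarrow> int \<Rightarrow> int \<Rightarrow> ('a, 'n) form set set cvs" where
  "G_delbar A p q = quot_space (H_A A p q \<lparr>carrier := calG_delbar A p q\<rparr>)
     (pi_A A p q ` carrier (H_delbar A p q))"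

definition g_del :: "('a, 'n::finite) chart set \<Rightarrow> int \<Rightarrow> int \<Rightarrow> enat" where
  "g_del A p q = cdim (G_del A p q)"

definition g_delbar :: "('a, 'n::finite) chart set \<Rightarrow> int \<Rightarrow> int \<Rightarrow> enat" where
  "g_delbar A p q = cdim (G_delbar A p q)"

end

(*
  Up to canonical isomorphism both spaces are
    (del A^{p,q} cap delbar A^{p+1,q-1}) / del delbar A^{p,q-1} :
  a class in the first is sent to del of a representative, a class in the second to delbar of a
  representative. Hence "del theta = delbar eta" is a linear relation between representatives that
  descends to an isomorphism. Apart from linear algebra of quotients this needs that del and delbar
  act on forms and anticommute. That the chart expressions of del omega are again of pure type
  follows by expanding omega with constant covectors; that they are compatible with a transition
  map phi follows since phi is smooth (Cauchy's formula) and the second derivatives of phi cancel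
  by symmetry.
*)
theory Submission
  imports Defs "HOL-Library.Function_Algebras" "HOL-Complex_Analysis.Cauchy_Integral_Formula"
begin

section \<open>Vector spaces as records\<close>

definition complex_ring :: "complex ring" where
  "complex_ring = \<lparr>carrier = UNIV, mult = (*), one = 1, zero = 0, add = (+)\<rparr>"

lemma complex_ring_simps [simp]:
  "carrier complex_ring = UNIV" "x \<otimes>\<^bsub>complex_ring\<^esub> y = x * y" "\<one>\<^bsub>complex_ring\<^esub> = 1"
  "\<zero>\<^bsub>complex_ring\<^esub> = 0" "x \<oplus>\<^bsub>complex_ring\<^esub> y = x + y"
  by (simp_all add: complex_ring_def)

lemma cring_complex_ring: "cring complex_ring"
proof (rule cringI)
  show "abelian_group complex_ring"
  proof (rule abelian_groupI)
    show "\<exists>y\<in>carrier complex_ring. y \<oplus>\<^bsub>complex_ring\<^esub> x = \<zero>\<^bsub>complex_ring\<^esub>" for x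
      by (rule bexI[of _ "- x"]) simp_all
  qed simp_all
  show "Group.comm_monoid complex_ring"
    by (rule comm_monoidI) simp_all
qed (simp add: distrib_right)

abbreviation cvec :: "'v cvs \<Rightarrow> bool" where
  "cvec M \<equiv> module complex_ring M"

abbreviation csub :: "'v set \<Rightarrow> 'v cvs \<Rightarrow> bool" where
  "csub W M \<equiv> submodule W complex_ring M"

lemma cvecI:
  fixes M :: "'v cvs" (structure)
  assumes "abelian_group M"
    and "\<And>a x. x \<in> carrier M \<Longrightarrow> a \<odot> x \<in> carrier M"
    and "\<And>a b x. x \<in> carrier M \<Longrightarrow> (a + b) \<odot> x = a \<odot> x \<oplus> b \<odot> x"
    and "\<And>a x y. x \<in> carrier M \<Longrightarrow> y \<in> carrier M \<Longrightarrow> a \<odot> (x \<oplus> y) = a \<odot> x \<oplus> a \<odot> y"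
    and "\<And>a b x. x \<in> carrier M \<Longrightarrow> (a * b) \<odot> x = a \<odot> (b \<odot> x)"
    and "\<And>x. x \<in> carrier M \<Longrightarrow> 1 \<odot> x = x"
  shows "cvec M"
  using assms by (intro moduleI cring_complex_ring) auto

lemma cvec_closed:
  fixes M :: "'v cvs" (structure)
  assumes "cvec M"
  shows "\<zero> \<in> carrier M" "\<And>x y. x \<in> carrier M \<Longrightarrow> y \<in> carrier M \<Longrightarrow> x \<oplus> y \<in> carrier M"
    "\<And>a x. x \<in> carrier M \<Longrightarrow> a \<odot> x \<in> carrier M"
    "\<And>x. x \<in> carrier M \<Longrightarrow> \<ominus> x = (-1) \<odot> x"
proof -
  interpret module complex_ring M by fact
  show "\<zero> \<in> carrier M" "\<And>x y. x \<in> carrier M \<Longrightarrow> y \<in> carrier M \<Longrightarrow> x \<oplus> y \<in> carrier M"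
    "\<And>a x. x \<in> carrier M \<Longrightarrow> a \<odot> x \<in> carrier M" by auto
  fix x assume x: "x \<in> carrier M"
  have "(-1) \<odot> x \<oplus> x = ((-1) + 1) \<odot> x"
    using smult_l_distr[of "-1" 1 x] smult_one[of x] x by simp
  also have "\<dots> = \<zero>" using smult_l_null[OF x] by simp
  finally show "\<ominus> x = (-1) \<odot> x"
    using x by (metis M.minus_equality UNIV_I complex_ring_simps(1) smult_closed)
qed

lemma csubI:
  fixes M :: "'v cvs" (structure)
  assumes "cvec M" "W \<subseteq> carrier M" "\<zero> \<in> W"
    "\<And>x y. x \<in> W \<Longrightarrow> y \<in> W \<Longrightarrow> x \<oplus> y \<in> W" "\<And>a x. x \<in> W \<Longrightarrow> a \<odot> x \<in> W"
  shows "csub W M"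
proof -
  interpret module complex_ring M by fact
  show ?thesis
    using assms by (intro submoduleI) (auto simp: cvec_closed(4)[OF assms(1)] subset_eq)
qed

lemma csubD:
  fixes M :: "'v cvs" (structure)
  assumes "csub W M" "cvec M"
  shows "W \<subseteq> carrier M" "\<zero> \<in> W"
    "\<And>x y. x \<in> W \<Longrightarrow> y \<in> W \<Longrightarrow> x \<oplus> y \<in> W" "\<And>a x. x \<in> W \<Longrightarrow> a \<odot> x \<in> W"
proof -
  interpret module complex_ring M by fact
  show "W \<subseteq> carrier M" "\<And>x y. x \<in> W \<Longrightarrow> y \<in> W \<Longrightarrow> x \<oplus> y \<in> W"
      "\<And>a x. x \<in> W \<Longrightarrow> a \<odot> x \<in> W"
    using submoduleE[OF assms(1)] by auto
  show "\<zero> \<in> W"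
    using subgroup.one_closed[OF submodule.axioms(1)[OF assms(1)]] by simp
qed

lemma cvec_image:
  fixes M :: "'v cvs" and N :: "'w cvs"
  assumes M: "cvec M"
    and car: "carrier N = f ` carrier M"
    and zero: "\<zero>\<^bsub>N\<^esub> = f \<zero>\<^bsub>M\<^esub>"
    and add: "\<And>x y. x \<in> carrier M \<Longrightarrow> y \<in> carrier M \<Longrightarrow> f x \<oplus>\<^bsub>N\<^esub> f y = f (x \<oplus>\<^bsub>M\<^esub> y)"
    and smult: "\<And>a x. x \<in> carrier M \<Longrightarrow> a \<odot>\<^bsub>N\<^esub> f x = f (a \<odot>\<^bsub>M\<^esub> x)"
  shows "cvec N"
proof -
  interpret module complex_ring M by fact
  note closed [simp] = cvec_closed(1-3)[OF M]
  show ?thesis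
  proof (rule cvecI)
    show "abelian_group N"
    proof (rule abelian_groupI)
      fix x assume "x \<in> carrier N"
      then obtain x' where x': "x' \<in> carrier M" "x = f x'" by (auto simp: car)
      then have "f (\<ominus>\<^bsub>M\<^esub> x') \<oplus>\<^bsub>N\<^esub> x = \<zero>\<^bsub>N\<^esub>" by (simp add: add zero M.l_neg)
      then show "\<exists>y\<in>carrier N. y \<oplus>\<^bsub>N\<^esub> x = \<zero>\<^bsub>N\<^esub>" using x' by (auto simp: car)
    qed (auto simp: car zero add M.a_ac)
  next
    fix a b x assume "x \<in> carrier N"
    then show "(a * b) \<odot>\<^bsub>N\<^esub> x = a \<odot>\<^bsub>N\<^esub> (b \<odot>\<^bsub>N\<^esub> x)"
      using smult_assoc1[of a b] by (auto simp: car smult)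
  next
    fix a b x assume "x \<in> carrier N"
    then show "(a + b) \<odot>\<^bsub>N\<^esub> x = a \<odot>\<^bsub>N\<^esub> x \<oplus>\<^bsub>N\<^esub> b \<odot>\<^bsub>N\<^esub> x"
      using smult_l_distr[of a b] by (auto simp: car smult add)
  next
    fix x assume "x \<in> carrier N"
    then show "1 \<odot>\<^bsub>N\<^esub> x = x"
      using smult_one by (auto simp: car smult)
  qed (auto simp: car smult add smult_r_distr)
qed

lemma quot_space_simps [simp]:
  "zero (quot_space M W) = W" "add (quot_space M W) = set_add M"
  "carrier (quot_space M W) = a_rcosets\<^bsub>M\<^esub> W"
  "smult (quot_space M W) = (\<lambda>c C. \<Union>x\<in>C. W +>\<^bsub>M\<^esub> (c \<odot>\<^bsub>M\<^esub> x))"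
  by (simp_all add: quot_space_def)

lemma r_coset_carrier_update [simp]: "W +>\<^bsub>M\<lparr>carrier := K\<rparr>\<^esub> x = W +>\<^bsub>M\<^esub> x"
  by (simp add: a_r_coset_def')

lemma set_add_carrier_update [simp]: "set_add (M\<lparr>carrier := K\<rparr>) = set_add M"
  by (simp add: set_add_def' fun_eq_iff)

context
  fixes M :: "'v cvs" (structure) and W :: "'v set"
  assumes M: "cvec M" and W: "csub W M"
begin

interpretation module complex_ring M by (fact M)

interpretation abelian_subgroup W M
  by (rule abelian_subgroupI3)
    (auto intro: additive_subgroup.intro submodule.axioms(1)[OF W] abelian_group_axioms)

lemma coset_eq_iff:
  assumes "x \<in> carrier M" "y \<in> carrier M"
  shows "W +> x = W +> y \<longleftrightarrow> x \<oplus> (-1) \<odot> y \<in> W"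
proof -
  have "W +> x = W +> y \<longleftrightarrow> x \<in> W +> y"
    using assms a_rcos_self a_repr_independence' by auto
  then show ?thesis using a_rcos_module[of y x] assms by (simp add: cvec_closed(4)[OF M])
qed

lemma coset_eq_self_iff:
  assumes "x \<in> carrier M"
  shows "W +> x = W \<longleftrightarrow> x \<in> W"
  using assms a_rcos_self a_rcos_const by auto

lemma coset_mem_iff:
  assumes "x \<in> carrier M"
  shows "y \<in> W +> x \<longleftrightarrow> (\<exists>w\<in>W. y = w \<oplus> x)"
  by (auto simp: a_r_coset_def')

lemma coset_smult:
  assumes "x \<in> carrier M"
  shows "(\<Union>y\<in>W +> x. W +> (c \<odot> y)) = W +> (c \<odot> x)"
proof -
  have "W +> (c \<odot> y) = W +> (c \<odot> x)" if y: "y \<in> W +> x" for y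
  proof -
    obtain w where w: "w \<in> W" "y = w \<oplus> x"
      using y unfolding coset_mem_iff[OF assms] by blast
    have wc: "w \<in> carrier M" using w csubD(1)[OF W M] by auto
    have cw: "c \<odot> w \<in> W" using w csubD(4)[OF W M] by auto
    have "c \<odot> y = c \<odot> w \<oplus> c \<odot> x" using w wc assms by (simp add: smult_r_distr)
    then have "c \<odot> y \<in> W +> (c \<odot> x)" using cw assms by (auto simp: a_r_coset_def')
    then show ?thesis using a_repr_independence'[of "c \<odot> y" "c \<odot> x"] assms by auto
  qed
  then show ?thesis using a_rcos_self[OF assms] by blast
qed

lemma coset_add:
  assumes "x \<in> carrier M" "y \<in> carrier M"
  shows "(W +> x) <+> (W +> y) = W +> (x \<oplus> y)"
  using a_rcos_sum assms by blast

lemma rcosets_eq_image: "a_rcosets W = (\<lambda>x. W +> x) ` carrier M"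
  by (auto simp: A_RCOSETS_def')

lemma cvec_quot_space: "cvec (quot_space M W)"
proof (rule cvec_image[OF M])
  show "carrier (quot_space M W) = (\<lambda>x. W +> x) ` carrier M" by (simp add: rcosets_eq_image)
  show "\<zero>\<^bsub>quot_space M W\<^esub> = W +> \<zero>" using coset_eq_self_iff[of \<zero>] csubD(2)[OF W M] by simp
qed (simp_all add: coset_add coset_smult)

end

interpretation fun_vs: vector_space "\<lambda>(c::complex) (f::'v \<Rightarrow> complex) b. c * f b"
  by unfold_locales (auto simp: fun_eq_iff algebra_simps)

lemma ex1_eq_members: "\<exists>!x. P x \<Longrightarrow> P x \<Longrightarrow> P y \<Longrightarrow> x = y"
  by blast

lemma sum_apply: "(\<Sum>x\<in>S. f x) y = (\<Sum>x\<in>S. f x y)" for f :: "'a \<Rightarrow> 'b \<Rightarrow> 'c::comm_monoid_add"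
  by (induction S rule: infinite_finite_induct) auto

lemma finite_basis_card_le:
  fixes M :: "'v cvs" (structure)
  assumes M: "cvec M" and B: "finite_basis M B" and B': "finite_basis M B'"
  shows "card B' \<le> card B"
proof -
  interpret module complex_ring M by fact
  have fin: "finite B" "finite B'" and sub: "B \<subseteq> carrier M" "B' \<subseteq> carrier M"
    using B B' by (auto simp: finite_basis_def)
  define L where "L a = (\<Oplus>b\<in>B. a b \<odot> b)" for a :: "'v \<Rightarrow> complex"
  define co where "co x = (\<lambda>b. if b \<in> B then (THE a. a \<in> B \<rightarrow>\<^sub>E UNIV \<and> x = L a) b else 0)" for x
  have L_cong: "L a = L a'" if "\<And>b. b \<in> B \<Longrightarrow> a b = a' b" for a a'
    unfolding L_def using that sub by (intro finsum_cong') auto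
  have L_closed: "L a \<in> carrier M" for a
    unfolding L_def using sub by (intro finsum_closed) auto
  have L_co: "L (co x) = x" if "x \<in> carrier M" for x
  proof -
    have "\<exists>!a. a \<in> B \<rightarrow>\<^sub>E UNIV \<and> x = L a" using B that by (auto simp: finite_basis_def L_def)
    from theI'[OF this] have "x = L (THE a. a \<in> B \<rightarrow>\<^sub>E UNIV \<and> x = L a)" by simp
    also have "\<dots> = L (co x)" by (rule L_cong) (simp add: co_def)
    finally show ?thesis by simp
  qed
  have co_L: "co (L a) = a" if "\<And>b. b \<notin> B \<Longrightarrow> a b = 0" for a
  proof -
    have "\<exists>!a'. a' \<in> B \<rightarrow>\<^sub>E UNIV \<and> L a = L a'"
      using B L_closed[of a] by (auto simp: finite_basis_def L_def)
    moreover have "restrict a B \<in> B \<rightarrow>\<^sub>E UNIV \<and> L a = L (restrict a B)"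
      by (auto intro!: L_cong)
    ultimately have "(THE a'. a' \<in> B \<rightarrow>\<^sub>E UNIV \<and> L a = L a') = restrict a B"
      by (intro the1_equality)
    then show ?thesis using that by (auto simp: co_def fun_eq_iff)
  qed
  have L_add: "L (\<lambda>b. a b + a' b) = L a \<oplus> L a'" for a a'
  proof -
    have "L (\<lambda>b. a b + a' b) = (\<Oplus>b\<in>B. a b \<odot> b \<oplus> a' b \<odot> b)"
      unfolding L_def using sub smult_l_distr by (intro finsum_cong') (auto simp: subset_eq)
    also have "\<dots> = L a \<oplus> L a'"
      unfolding L_def using sub by (intro finsum_addf) auto
    finally show ?thesis .
  qed
  have L_smult: "L (\<lambda>b. c * a b) = c \<odot> L a" for a c
  proof -
    have "c \<odot> L a = (\<Oplus>b\<in>B. c \<odot> (a b \<odot> b))"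
      unfolding L_def using sub fin by (intro finsum_smult_ldistr) auto
    also have "\<dots> = L (\<lambda>b. c * a b)"
      unfolding L_def using sub smult_assoc1 by (intro finsum_cong') (auto simp: subset_eq)
    finally show ?thesis by simp
  qed
  have co_add: "co (x \<oplus> y) = co x + co y" if "x \<in> carrier M" "y \<in> carrier M" for x y
  proof -
    have "x \<oplus> y = L (\<lambda>b. co x b + co y b)" using that by (simp add: L_add L_co)
    then show ?thesis using co_L[of "\<lambda>b. co x b + co y b"] by (simp add: fun_eq_iff co_def)
  qed
  have co_smult: "co (c \<odot> x) = (\<lambda>b. c * co x b)" if "x \<in> carrier M" for x c
  proof -
    have "c \<odot> x = L (\<lambda>b. c * co x b)" using that by (simp add: L_smult L_co)
    then show ?thesis using co_L[of "\<lambda>b. c * co x b"] by (simp add: fun_eq_iff co_def)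
  qed
  have co_zero: "co \<zero> = 0" 
    using co_smult[of \<zero> 0] by (simp add: fun_eq_iff zero_fun_def)
  have co_sum: "co (\<Oplus>b\<in>S. a b \<odot> b) = (\<Sum>b\<in>S. (\<lambda>d. a b * co b d))"
    if "finite S" "S \<subseteq> carrier M" for S a
    using that
  proof (induction S rule: finite_induct)
    case empty then show ?case by (simp add: co_zero)
  next
    case (insert x F)
    have "(\<Oplus>b\<in>insert x F. a b \<odot> b) = a x \<odot> x \<oplus> (\<Oplus>b\<in>F. a b \<odot> b)"
      using insert by (intro finsum_insert) auto
    then show ?case using insert
      by (subst sum.insert) (auto simp: co_add co_smult finsum_closed Pi_def subset_eq)
  qed
  have uniq: "a b = 0" if "(\<Oplus>b\<in>B'. a b \<odot> b) = \<zero>" "b \<in> B'" for a b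
  proof -
    have "\<exists>!a. a \<in> B' \<rightarrow>\<^sub>E UNIV \<and> \<zero> = (\<Oplus>b\<in>B'. a b \<odot> b)"
      using B' by (auto simp: finite_basis_def)
    moreover have "(\<Oplus>b\<in>B'. restrict a B' b \<odot> b) = (\<Oplus>b\<in>B'. a b \<odot> b)"
      using sub by (intro finsum_cong') auto
    moreover have "(\<Oplus>b\<in>B'. (\<lambda>b\<in>B'. 0) b \<odot> b) = (\<Oplus>b\<in>B'. \<zero>)"
      using sub smult_l_null by (intro finsum_cong') auto
    moreover have "(\<Oplus>b\<in>B'. \<zero>) = \<zero>" by (rule finsum_zero)
    moreover have "restrict a B' \<in> B' \<rightarrow>\<^sub>E UNIV" "(\<lambda>b\<in>B'. 0) \<in> B' \<rightarrow>\<^sub>E (UNIV :: complex set)"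
      by simp_all
    ultimately have "restrict a B' = (\<lambda>b\<in>B'. 0)"
      using that(1) by (intro ex1_eq_members[where P = "\<lambda>a. a \<in> B' \<rightarrow>\<^sub>E UNIV \<and> \<zero> = (\<Oplus>b\<in>B'. a b \<odot> b)"]) simp_all
    then show ?thesis using that(2) by (metis restrict_apply')
  qed
  have inj: "inj_on co B'"
    by (rule inj_onI) (metis L_co sub(2) subsetD)
  have "fun_vs.independent (co ` B')"
  proof (rule fun_vs.independent_if_scalars_zero)
    fix f x assume z: "(\<Sum>x\<in>co ` B'. (\<lambda>b. f x * x b)) = 0" and x: "x \<in> co ` B'"
    have "co (\<Oplus>b\<in>B'. f (co b) \<odot> b) = 0"
      using z by (simp add: co_sum[OF fin(2) sub(2)] sum.reindex[OF inj] o_def)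
    moreover have "(\<Oplus>b\<in>B'. f (co b) \<odot> b) \<in> carrier M"
      using sub by (intro finsum_closed) auto
    ultimately have "(\<Oplus>b\<in>B'. f (co b) \<odot> b) = \<zero>"
      using L_co co_zero by (metis M.zero_closed)
    then show "f x = 0" using x uniq[of "\<lambda>b. f (co b)"] by auto
  qed (use fin in auto)
  moreover have "co ` B' \<subseteq> fun_vs.span ((\<lambda>b d. if d = b then 1 else 0) ` B)"
  proof safe
    fix x
    have "co x = (\<Sum>b\<in>B. (\<lambda>d. co x b * (if d = b then 1 else 0)))"
      using fin by (auto simp: fun_eq_iff co_def sum_apply if_distrib cong: if_cong)
    also have "\<dots> \<in> fun_vs.span ((\<lambda>b d. if d = b then 1 else 0) ` B)"
      by (intro fun_vs.span_sum fun_vs.span_scale fun_vs.span_base) auto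
    finally show "co x \<in> fun_vs.span ((\<lambda>b d. if d = b then 1 else 0) ` B)" .
  qed
  ultimately have "card (co ` B') \<le> card ((\<lambda>b d. if d = b then 1 else 0 :: complex) ` B)"
    using fun_vs.independent_span_bound fin by blast
  also have "\<dots> \<le> card B" by (rule card_image_le[OF fin(1)])
  finally show ?thesis by (simp add: card_image[OF inj])
qed

lemma cdim_eq_card:
  assumes "cvec M" "finite_basis M B"
  shows "cdim M = enat (card B)"
proof -
  have "finite_basis M (SOME B. finite_basis M B)" using assms(2) by (rule someI)
  then have "card (SOME B. finite_basis M B) = card B"
    using assms finite_basis_card_le by (metis le_antisym)
  then show ?thesis using assms by (auto simp: cdim_def)
qed

lemma finite_basis_image:
  fixes M :: "'v cvs" and N :: "'w cvs"
  assumes M: "cvec M" and N: "cvec N" and bij: "bij_betw f (carrier M) (carrier N)"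
    and add: "\<And>x y. x \<in> carrier M \<Longrightarrow> y \<in> carrier M \<Longrightarrow> f (x \<oplus>\<^bsub>M\<^esub> y) = f x \<oplus>\<^bsub>N\<^esub> f y"
    and smult: "\<And>a x. x \<in> carrier M \<Longrightarrow> f (a \<odot>\<^bsub>M\<^esub> x) = a \<odot>\<^bsub>N\<^esub> f x"
    and B: "finite_basis M B"
  shows "finite_basis N (f ` B)"
proof -
  interpret M: module complex_ring M by fact
  interpret N: module complex_ring N by fact
  have fin: "finite B" and sub: "B \<subseteq> carrier M" using B by (auto simp: finite_basis_def)
  have inj: "inj_on f (carrier M)" and im: "f ` carrier M = carrier N"
    using bij by (auto simp: bij_betw_def)
  have fc: "f x \<in> carrier N" if "x \<in> carrier M" for x using that im by blast
  have injB: "inj_on f B" using inj sub by (rule inj_on_subset)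
  have zero: "f \<zero>\<^bsub>M\<^esub> = \<zero>\<^bsub>N\<^esub>"
    using smult[of "\<zero>\<^bsub>M\<^esub>" 0] fc by (metis M.M.zero_closed M.smult_l_null N.smult_l_null complex_ring_simps(4))
  have fsum: "f (\<Oplus>\<^bsub>M\<^esub>b\<in>S. a b \<odot>\<^bsub>M\<^esub> b) = (\<Oplus>\<^bsub>N\<^esub>b\<in>S. a b \<odot>\<^bsub>N\<^esub> f b)"
    if "finite S" "S \<subseteq> carrier M" for S and a :: "'v \<Rightarrow> complex"
    using that
  proof (induction S rule: finite_induct)
    case empty then show ?case by (simp add: zero)
  next
    case (insert x F)
    have "f (\<Oplus>\<^bsub>M\<^esub>b\<in>insert x F. a b \<odot>\<^bsub>M\<^esub> b) = f (a x \<odot>\<^bsub>M\<^esub> x \<oplus>\<^bsub>M\<^esub> (\<Oplus>\<^bsub>M\<^esub>b\<in>F. a b \<odot>\<^bsub>M\<^esub> b))"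
      using insert by (subst M.finsum_insert) auto
    also have "\<dots> = a x \<odot>\<^bsub>N\<^esub> f x \<oplus>\<^bsub>N\<^esub> (\<Oplus>\<^bsub>N\<^esub>b\<in>F. a b \<odot>\<^bsub>N\<^esub> f b)"
      using insert by (subst add) (auto simp: smult Pi_def subset_eq intro!: M.finsum_closed)
    also have "\<dots> = (\<Oplus>\<^bsub>N\<^esub>b\<in>insert x F. a b \<odot>\<^bsub>N\<^esub> f b)"
      using insert fc by (subst N.finsum_insert) auto
    finally show ?case .
  qed
  have fsumB: "(\<Oplus>\<^bsub>N\<^esub>d\<in>f ` B. a d \<odot>\<^bsub>N\<^esub> d) = f (\<Oplus>\<^bsub>M\<^esub>b\<in>B. a (f b) \<odot>\<^bsub>M\<^esub> b)" for a
    using fsum[OF fin sub, of "\<lambda>b. a (f b)"] injB sub fc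
    by (subst N.finsum_reindex) (auto simp: Pi_def subset_eq)
  have Mclosed: "(\<Oplus>\<^bsub>M\<^esub>b\<in>B. a b \<odot>\<^bsub>M\<^esub> b) \<in> carrier M" for a
    using sub by (intro M.finsum_closed) auto
  show ?thesis unfolding finite_basis_def
  proof (intro conjI ballI)
    show "finite (f ` B)" "f ` B \<subseteq> carrier N" using fin sub fc by auto
    fix y assume "y \<in> carrier N"
    then obtain x where x: "x \<in> carrier M" "y = f x" using im by auto
    have key: "y = (\<Oplus>\<^bsub>N\<^esub>d\<in>f ` B. a d \<odot>\<^bsub>N\<^esub> d) \<longleftrightarrow> x = (\<Oplus>\<^bsub>M\<^esub>b\<in>B. a (f b) \<odot>\<^bsub>M\<^esub> b)" for a
      unfolding fsumB x(2) by (rule inj_on_eq_iff[OF inj x(1) Mclosed])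
    have ex: "\<exists>!a. a \<in> B \<rightarrow>\<^sub>E UNIV \<and> x = (\<Oplus>\<^bsub>M\<^esub>b\<in>B. a b \<odot>\<^bsub>M\<^esub> b)"
      using B x(1) by (simp add: finite_basis_def)
    from ex obtain a where a: "a \<in> B \<rightarrow>\<^sub>E UNIV \<and> x = (\<Oplus>\<^bsub>M\<^esub>b\<in>B. a b \<odot>\<^bsub>M\<^esub> b)" ..
    have uniq: "a' = a" if "a' \<in> B \<rightarrow>\<^sub>E UNIV \<and> x = (\<Oplus>\<^bsub>M\<^esub>b\<in>B. a' b \<odot>\<^bsub>M\<^esub> b)" for a'
      by (rule ex1_eq_members[where P = "\<lambda>a. a \<in> B \<rightarrow>\<^sub>E UNIV \<and> x = (\<Oplus>\<^bsub>M\<^esub>b\<in>B. a b \<odot>\<^bsub>M\<^esub> b)", OF ex that a])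
    have restr: "(\<Oplus>\<^bsub>M\<^esub>b\<in>B. restrict h B b \<odot>\<^bsub>M\<^esub> b) = (\<Oplus>\<^bsub>M\<^esub>b\<in>B. h b \<odot>\<^bsub>M\<^esub> b)" for h
      using sub by (intro M.finsum_cong') auto
    show "\<exists>!a. a \<in> f ` B \<rightarrow>\<^sub>E UNIV \<and> y = (\<Oplus>\<^bsub>N\<^esub>d\<in>f ` B. a d \<odot>\<^bsub>N\<^esub> d)"
    proof (rule ex1I)
      let ?a = "\<lambda>d\<in>f ` B. a (inv_into B f d)"
      have "(\<Oplus>\<^bsub>M\<^esub>b\<in>B. ?a (f b) \<odot>\<^bsub>M\<^esub> b) = (\<Oplus>\<^bsub>M\<^esub>b\<in>B. a b \<odot>\<^bsub>M\<^esub> b)"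
        using sub injB by (intro M.finsum_cong') auto
      then show "?a \<in> f ` B \<rightarrow>\<^sub>E UNIV \<and> y = (\<Oplus>\<^bsub>N\<^esub>d\<in>f ` B. ?a d \<odot>\<^bsub>N\<^esub> d)"
        unfolding key using a by simp
      fix a' assume a': "a' \<in> f ` B \<rightarrow>\<^sub>E UNIV \<and> y = (\<Oplus>\<^bsub>N\<^esub>d\<in>f ` B. a' d \<odot>\<^bsub>N\<^esub> d)"
      then have "x = (\<Oplus>\<^bsub>M\<^esub>b\<in>B. a' (f b) \<odot>\<^bsub>M\<^esub> b)" using key by simp
      then have "restrict (\<lambda>b. a' (f b)) B = a"
        by (intro uniq) (simp add: restr[of "\<lambda>b. a' (f b)"] del: restrict_apply)
      then have "a' (f b) = a b" if "b \<in> B" for b using that by (metis restrict_apply')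
      then have "restrict a' (f ` B) = ?a" using injB by (auto simp: fun_eq_iff)
      moreover have "restrict a' (f ` B) = a'" using a' by (metis PiE_restrict)
      ultimately show "a' = ?a" by simp
    qed
  qed
qed

lemma cdim_iso:
  fixes M :: "'v cvs" and N :: "'w cvs"
  assumes M: "cvec M" and N: "cvec N" and bij: "bij_betw f (carrier M) (carrier N)"
    and add: "\<And>x y. x \<in> carrier M \<Longrightarrow> y \<in> carrier M \<Longrightarrow> f (x \<oplus>\<^bsub>M\<^esub> y) = f x \<oplus>\<^bsub>N\<^esub> f y"
    and smult: "\<And>a x. x \<in> carrier M \<Longrightarrow> f (a \<odot>\<^bsub>M\<^esub> x) = a \<odot>\<^bsub>N\<^esub> f x"
  shows "cdim M = cdim N"
proof (cases "\<exists>B. finite_basis M B")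
  case True
  then obtain B where B: "finite_basis M B" by auto
  have "card (f ` B) = card B"
    using B bij by (intro card_image) (auto simp: finite_basis_def bij_betw_def intro: inj_on_subset)
  then show ?thesis
    using cdim_eq_card[OF M B] cdim_eq_card[OF N finite_basis_image[OF M N bij add smult B]] by simp
next
  case False
  let ?g = "inv_into (carrier M) f"
  have g: "bij_betw ?g (carrier N) (carrier M)" using bij by (rule bij_betw_inv_into)
  have gc: "?g y \<in> carrier M" "f (?g y) = y" if "y \<in> carrier N" for y
    using that bij by (auto simp: bij_betw_def inv_into_into f_inv_into_f)
  have gf: "?g (f x) = x" if "x \<in> carrier M" for x
    using that bij by (auto simp: bij_betw_def)
  have gadd: "?g (x \<oplus>\<^bsub>N\<^esub> y) = ?g x \<oplus>\<^bsub>M\<^esub> ?g y" if "x \<in> carrier N" "y \<in> carrier N" for x y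
    using add[OF gc(1)[OF that(1)] gc(1)[OF that(2)]] gf[of "?g x \<oplus>\<^bsub>M\<^esub> ?g y"] that
    by (simp add: gc cvec_closed(2)[OF M])
  have gsmult: "?g (a \<odot>\<^bsub>N\<^esub> x) = a \<odot>\<^bsub>M\<^esub> ?g x" if "x \<in> carrier N" for a x
    using smult[OF gc(1)[OF that]] gf[of "a \<odot>\<^bsub>M\<^esub> ?g x"] that
    by (simp add: gc cvec_closed(3)[OF M])
  have "\<not> (\<exists>B. finite_basis N B)"
    using False finite_basis_image[OF N M g gadd gsmult] by blast
  then show ?thesis using False by (simp add: cdim_def)
qed

lemma cdim_eq_of_linear_relation:
  fixes M :: "'v cvs" and N :: "'w cvs"
  assumes M: "cvec M" and N: "cvec N" and T: "T \<subseteq> carrier M \<times> carrier N"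
    and add: "\<And>x y x' y'. (x, y) \<in> T \<Longrightarrow> (x', y') \<in> T \<Longrightarrow> (x \<oplus>\<^bsub>M\<^esub> x', y \<oplus>\<^bsub>N\<^esub> y') \<in> T"
    and smult: "\<And>a x y. (x, y) \<in> T \<Longrightarrow> (a \<odot>\<^bsub>M\<^esub> x, a \<odot>\<^bsub>N\<^esub> y) \<in> T"
    and total: "carrier M \<subseteq> fst ` T" "carrier N \<subseteq> snd ` T"
    and zero: "\<And>x y. (x, y) \<in> T \<Longrightarrow> x = \<zero>\<^bsub>M\<^esub> \<longleftrightarrow> y = \<zero>\<^bsub>N\<^esub>"
  shows "cdim M = cdim N"
proof -
  interpret M: module complex_ring M by fact
  interpret N: module complex_ring N by fact
  have iff: "x = x' \<longleftrightarrow> y = y'" if xy: "(x, y) \<in> T" "(x', y') \<in> T" for x y x' y'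
  proof -
    have c: "x \<in> carrier M" "x' \<in> carrier M" "y \<in> carrier N" "y' \<in> carrier N" using T xy by auto
    have "(x \<oplus>\<^bsub>M\<^esub> \<ominus>\<^bsub>M\<^esub> x', y \<oplus>\<^bsub>N\<^esub> \<ominus>\<^bsub>N\<^esub> y') \<in> T"
      using add[OF xy(1) smult[OF xy(2), of "-1"]] c by (simp add: cvec_closed(4)[OF M] cvec_closed(4)[OF N])
    from zero[OF this] show ?thesis using c
      by (metis M.M.a_inv_closed M.M.minus_equality M.M.minus_minus M.r_neg N.M.a_inv_closed
          N.M.minus_equality N.M.minus_minus N.r_neg)
  qed
  define f where "f x = (SOME y. (x, y) \<in> T)" for x
  have fT: "(x, f x) \<in> T" if "x \<in> carrier M" for x
  proof -
    have "\<exists>y. (x, y) \<in> T" using total(1) that by force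
    then show ?thesis unfolding f_def by (rule someI_ex)
  qed
  have f_eq: "f x = y" if "(x, y) \<in> T" for x y
    using iff[OF fT[of x] that] T that by auto
  show ?thesis
  proof (rule cdim_iso[OF M N, of f])
    show "bij_betw f (carrier M) (carrier N)"
      unfolding bij_betw_def
    proof
      show "inj_on f (carrier M)" using iff fT by (metis inj_onI)
      show "f ` carrier M = carrier N"
      proof
        show "f ` carrier M \<subseteq> carrier N" using fT T by blast
        show "carrier N \<subseteq> f ` carrier M"
        proof
          fix y assume "y \<in> carrier N"
          then obtain x where "(x, y) \<in> T" using total(2) by force
          then show "y \<in> f ` carrier M" using f_eq T by blast
        qed
      qed
    qed
    show "f (x \<oplus>\<^bsub>M\<^esub> y) = f x \<oplus>\<^bsub>N\<^esub> f y" if "x \<in> carrier M" "y \<in> carrier M" for x y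
      using that by (intro f_eq add fT)
    show "f (a \<odot>\<^bsub>M\<^esub> x) = a \<odot>\<^bsub>N\<^esub> f x" if "x \<in> carrier M" for a x
      using that by (intro f_eq smult fT)
  qed
qed

text \<open>The map \<open>r\<close> identifies \<open>G\<close> with \<open>Y / (Y \<inter> Z)\<close>, all inside \<open>F\<close>.\<close>

definition presents :: "'v cvs \<Rightarrow> 'v set \<Rightarrow> 'v set \<Rightarrow> ('v \<Rightarrow> 'w) \<Rightarrow> 'w cvs \<Rightarrow> bool" where
  "presents F Y Z r G \<longleftrightarrow> cvec G \<and> carrier G = r ` Y \<and>
     (\<forall>x\<in>Y. \<forall>y\<in>Y. r (x \<oplus>\<^bsub>F\<^esub> y) = r x \<oplus>\<^bsub>G\<^esub> r y) \<and>
     (\<forall>a. \<forall>x\<in>Y. r (a \<odot>\<^bsub>F\<^esub> x) = a \<odot>\<^bsub>G\<^esub> r x) \<and>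
     (\<forall>x\<in>Y. r x = \<zero>\<^bsub>G\<^esub> \<longleftrightarrow> x \<in> Z)"

lemma cdim_eq_of_presentations:
  assumes G: "presents F Y Z r G" and G': "presents F' Y' Z' r' G'"
    and R: "R \<subseteq> Y \<times> Y'"
    and add: "\<And>x y x' y'. (x, y) \<in> R \<Longrightarrow> (x', y') \<in> R \<Longrightarrow> (x \<oplus>\<^bsub>F\<^esub> x', y \<oplus>\<^bsub>F'\<^esub> y') \<in> R"
    and smult: "\<And>a x y. (x, y) \<in> R \<Longrightarrow> (a \<odot>\<^bsub>F\<^esub> x, a \<odot>\<^bsub>F'\<^esub> y) \<in> R"
    and total: "Y \<subseteq> fst ` R" "Y' \<subseteq> snd ` R"
    and zero: "\<And>x y. (x, y) \<in> R \<Longrightarrow> x \<in> Z \<longleftrightarrow> y \<in> Z'"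
  shows "cdim G = cdim G'"
proof (rule cdim_eq_of_linear_relation[where T = "map_prod r r' ` R"])
  show "cvec G" "cvec G'" using G G' by (simp_all add: presents_def)
  have car: "carrier G = r ` Y" "carrier G' = r' ` Y'" using G G' by (auto simp: presents_def)
  show "map_prod r r' ` R \<subseteq> carrier G \<times> carrier G'"
    using R by (auto simp: car)
  show "carrier G \<subseteq> fst ` map_prod r r' ` R" "carrier G' \<subseteq> snd ` map_prod r r' ` R"
    using total by (force simp: car)+
  show "(a \<odot>\<^bsub>G\<^esub> x, a \<odot>\<^bsub>G'\<^esub> y) \<in> map_prod r r' ` R" if xy: "(x, y) \<in> map_prod r r' ` R" for a x y
  proof -
    obtain u v where uv: "(u, v) \<in> R" "x = r u" "y = r' v" using xy by auto
    then have "u \<in> Y" "v \<in> Y'" using R by auto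
    then have "(a \<odot>\<^bsub>G\<^esub> x, a \<odot>\<^bsub>G'\<^esub> y) = map_prod r r' (a \<odot>\<^bsub>F\<^esub> u, a \<odot>\<^bsub>F'\<^esub> v)"
      using G G' uv by (simp add: presents_def)
    then show ?thesis using smult[OF uv(1)] by (metis image_eqI)
  qed
  show "(x \<oplus>\<^bsub>G\<^esub> x', y \<oplus>\<^bsub>G'\<^esub> y') \<in> map_prod r r' ` R"
    if xy: "(x, y) \<in> map_prod r r' ` R" "(x', y') \<in> map_prod r r' ` R" for x y x' y'
  proof -
    obtain u v where uv: "(u, v) \<in> R" "x = r u" "y = r' v" using xy by auto
    obtain u' v' where uv': "(u', v') \<in> R" "x' = r u'" "y' = r' v'" using xy by auto
    have "u \<in> Y" "v \<in> Y'" "u' \<in> Y" "v' \<in> Y'" using R uv uv' by auto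
    then have "(x \<oplus>\<^bsub>G\<^esub> x', y \<oplus>\<^bsub>G'\<^esub> y') = map_prod r r' (u \<oplus>\<^bsub>F\<^esub> u', v \<oplus>\<^bsub>F'\<^esub> v')"
      using G G' uv uv' by (simp add: presents_def)
    then show ?thesis using add[OF uv(1) uv'(1)] by (metis image_eqI)
  qed
  show "(x = \<zero>\<^bsub>G\<^esub>) = (y = \<zero>\<^bsub>G'\<^esub>)" if xy: "(x, y) \<in> map_prod r r' ` R" for x y
  proof -
    obtain u v where uv: "(u, v) \<in> R" "x = r u" "y = r' v" using xy by auto
    then have "u \<in> Y" "v \<in> Y'" using R by auto
    then show ?thesis using G G' uv zero[OF uv(1)] by (simp add: presents_def)
  qed
qed

lemma csub_restrict:
  assumes "cvec M" "csub K M" "csub W M" "W \<subseteq> K"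
  shows "cvec (M\<lparr>carrier := K\<rparr>)" "csub W (M\<lparr>carrier := K\<rparr>)"
proof -
  show "cvec (M\<lparr>carrier := K\<rparr>)"
    using submodule.submodule_is_module assms by blast
  then show "csub W (M\<lparr>carrier := K\<rparr>)"
    by (rule csubI) (use assms csubD[OF assms(3,1)] in auto)
qed

lemma induced_map_coset:
  fixes F :: "'v cvs" and N :: "'w cvs"
  assumes F: "cvec F" and K: "csub K F" and I: "csub I F" and IK: "I \<subseteq> K"
    and N: "cvec N" and V: "csub V N"
    and f: "\<And>x. x \<in> K \<Longrightarrow> f x \<in> carrier N"
    and add: "\<And>x y. x \<in> K \<Longrightarrow> y \<in> K \<Longrightarrow> f (x \<oplus>\<^bsub>F\<^esub> y) = f x \<oplus>\<^bsub>N\<^esub> f y"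
    and fI: "\<And>x. x \<in> I \<Longrightarrow> f x \<in> V"
    and x: "x \<in> K"
  shows "induced_map N V f (I +>\<^bsub>F\<^esub> x) = V +>\<^bsub>N\<^esub> f x"
proof -
  interpret F: module complex_ring F by fact
  interpret N: module complex_ring N by fact
  have KF: "K \<subseteq> carrier F" and VN: "V \<subseteq> carrier N" using csubD[OF K F] csubD[OF V N] by auto
  have eq: "V +>\<^bsub>N\<^esub> f y = V +>\<^bsub>N\<^esub> f x" if "y \<in> I +>\<^bsub>F\<^esub> x" for y
  proof -
    obtain i where i: "i \<in> I" "y = i \<oplus>\<^bsub>F\<^esub> x" using \<open>y \<in> I +>\<^bsub>F\<^esub> x\<close> by (auto simp: a_r_coset_def')
    then have fy: "f y = f i \<oplus>\<^bsub>N\<^esub> f x" using add x IK by auto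
    have c: "f i \<in> carrier N" "f x \<in> carrier N" using f i IK x by auto
    have "f y \<oplus>\<^bsub>N\<^esub> (-1) \<odot>\<^bsub>N\<^esub> f x = f i"
      using c by (simp add: fy N.M.a_assoc N.r_neg flip: cvec_closed(4)[OF N])
    moreover have "f y \<in> carrier N" using c by (simp add: fy)
    ultimately show ?thesis
      using coset_eq_iff[OF N V, of "f y" "f x"] c fI[OF i(1)] by simp
  qed
  have "\<zero>\<^bsub>F\<^esub> \<oplus>\<^bsub>F\<^esub> x \<in> I +>\<^bsub>F\<^esub> x" using csubD(2)[OF I F] by (auto simp: a_r_coset_def')
  then have "I +>\<^bsub>F\<^esub> x \<noteq> {}" by auto
  then show ?thesis unfolding induced_map_def using eq by auto
qed

lemma kernel_quotient_presents:
  fixes F :: "'v cvs" and N :: "'w cvs"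
  assumes F: "cvec F" and K: "csub K F" and I: "csub I F" and L: "csub L F" and J: "csub J F"
    and sub: "I \<subseteq> K" "L \<subseteq> K" "J \<subseteq> L" "J \<subseteq> I"
    and N: "cvec N" and V: "csub V N"
    and f: "\<And>x. x \<in> K \<Longrightarrow> f x \<in> carrier N"
    and add: "\<And>x y. x \<in> K \<Longrightarrow> y \<in> K \<Longrightarrow> f (x \<oplus>\<^bsub>F\<^esub> y) = f x \<oplus>\<^bsub>N\<^esub> f y"
    and smult: "\<And>a x. x \<in> K \<Longrightarrow> f (a \<odot>\<^bsub>F\<^esub> x) = a \<odot>\<^bsub>N\<^esub> f x"
    and fI: "\<And>x. x \<in> I \<Longrightarrow> f x \<in> V" and fL: "\<And>x. x \<in> L \<Longrightarrow> f x \<in> V"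
  defines "H \<equiv> quot_space (F\<lparr>carrier := K\<rparr>) I"
  defines "B \<equiv> induced_map F I id ` carrier (quot_space (F\<lparr>carrier := L\<rparr>) J)"
  shows "presents F {x \<in> K. f x \<in> V} (L <+>\<^bsub>F\<^esub> I) (\<lambda>x. B +>\<^bsub>H\<^esub> (I +>\<^bsub>F\<^esub> x))
    (quot_space (H\<lparr>carrier := {C \<in> carrier H. induced_map N V f C = V}\<rparr>) B)"
proof -
  interpret F: module complex_ring F by fact
  interpret N: module complex_ring N by fact
  note FK = csub_restrict[OF F K I sub(1)]
  note FL = csub_restrict[OF F L J sub(3)]
  note Kc = csubD[OF K F] and Lc = csubD[OF L F] and Vc = csubD[OF V N] and Ic = csubD[OF I F]
  have H: "cvec H" unfolding H_def by (rule cvec_quot_space[OF FK])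
  interpret H: module complex_ring H by fact
  have carH: "carrier H = (\<lambda>x. I +>\<^bsub>F\<^esub> x) ` K"
    unfolding H_def by (simp add: rcosets_eq_image[OF FK])
  have zeroH: "\<zero>\<^bsub>H\<^esub> = I" by (simp add: H_def)
  have addH: "(I +>\<^bsub>F\<^esub> x) \<oplus>\<^bsub>H\<^esub> (I +>\<^bsub>F\<^esub> y) = I +>\<^bsub>F\<^esub> (x \<oplus>\<^bsub>F\<^esub> y)" if "x \<in> K" "y \<in> K" for x y
    unfolding H_def using coset_add[OF FK] that by simp
  have smultH: "a \<odot>\<^bsub>H\<^esub> (I +>\<^bsub>F\<^esub> x) = I +>\<^bsub>F\<^esub> (a \<odot>\<^bsub>F\<^esub> x)" if "x \<in> K" for a x
    unfolding H_def using coset_smult[OF FK] that by simp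
  have Ieq: "I +>\<^bsub>F\<^esub> x = I +>\<^bsub>F\<^esub> y \<longleftrightarrow> x \<oplus>\<^bsub>F\<^esub> (-1) \<odot>\<^bsub>F\<^esub> y \<in> I" if "x \<in> K" "y \<in> K" for x y
    using coset_eq_iff[OF F I] that Kc(1) by blast
  have Izero: "I +>\<^bsub>F\<^esub> x = I \<longleftrightarrow> x \<in> I" if "x \<in> K" for x
    using coset_eq_self_iff[OF F I] that Kc(1) by blast
  define Y where "Y = {x \<in> K. f x \<in> V}"
  have YK: "x \<in> K" "f x \<in> V" if "x \<in> Y" for x using that by (auto simp: Y_def)
  have Y_add: "x \<oplus>\<^bsub>F\<^esub> y \<in> Y" if "x \<in> Y" "y \<in> Y" for x y
    using that Kc Vc by (auto simp: Y_def add)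
  have Y_smult: "a \<odot>\<^bsub>F\<^esub> x \<in> Y" if "x \<in> Y" for x a
    using that Kc Vc by (auto simp: Y_def smult)
  have IY: "I \<subseteq> Y" and LY: "L \<subseteq> Y" using sub fI fL by (auto simp: Y_def)
  have ind: "induced_map N V f (I +>\<^bsub>F\<^esub> x) = V \<longleftrightarrow> f x \<in> V" if "x \<in> K" for x
    using induced_map_coset[OF F K I sub(1) N V f add fI that] coset_eq_self_iff[OF N V f[OF that]]
    by simp
  define calG where "calG = {C \<in> carrier H. induced_map N V f C = V}"
  have calG_eq: "calG = (\<lambda>x. I +>\<^bsub>F\<^esub> x) ` Y"
    unfolding calG_def carH Y_def using ind by auto
  have calG: "csub calG H"
  proof (rule csubI[OF H])
    show "\<zero>\<^bsub>H\<^esub> \<in> calG" 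
      using Izero[OF Kc(2)] Ic(2) IY by (force simp: calG_eq zeroH)
    show "x \<oplus>\<^bsub>H\<^esub> y \<in> calG" if "x \<in> calG" "y \<in> calG" for x y
      using that addH Y_add YK by (auto simp: calG_eq)
    show "a \<odot>\<^bsub>H\<^esub> x \<in> calG" if "x \<in> calG" for a x
      using that smultH Y_smult YK by (auto simp: calG_eq)
  qed (auto simp: calG_def)
  have "induced_map F I id (J +>\<^bsub>F\<^esub> x) = I +>\<^bsub>F\<^esub> x" if "x \<in> L" for x
  proof -
    have "induced_map F I id (J +>\<^bsub>F\<^esub> x) = I +>\<^bsub>F\<^esub> id x"
      by (rule induced_map_coset[OF F L J sub(3) F I]) (use that sub Lc in auto)
    then show ?thesis by simp
  qed
  then have B_eq: "B = (\<lambda>x. I +>\<^bsub>F\<^esub> x) ` L"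
    unfolding B_def by (auto simp: rcosets_eq_image[OF FL])
  have B: "csub B H"
  proof (rule csubI[OF H])
    show "\<zero>\<^bsub>H\<^esub> \<in> B" 
      using Izero[OF Kc(2)] Ic(2) Lc(2) by (force simp: B_eq zeroH)
    show "x \<oplus>\<^bsub>H\<^esub> y \<in> B" if "x \<in> B" "y \<in> B" for x y
      using that addH Lc sub by (auto simp: B_eq subset_eq)
    show "a \<odot>\<^bsub>H\<^esub> x \<in> B" if "x \<in> B" for a x
      using that smultH Lc sub by (auto simp: B_eq subset_eq)
  qed (use sub in \<open>auto simp: B_eq carH\<close>)
  have "B \<subseteq> calG" using LY by (auto simp: B_eq calG_eq)
  note HG = csub_restrict[OF H calG B this]
  have mem: "I +>\<^bsub>F\<^esub> x \<in> B \<longleftrightarrow> x \<in> L <+>\<^bsub>F\<^esub> I" if x: "x \<in> Y" for x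
  proof
    assume "I +>\<^bsub>F\<^esub> x \<in> B"
    then obtain l where l: "l \<in> L" "I +>\<^bsub>F\<^esub> x = I +>\<^bsub>F\<^esub> l" by (auto simp: B_eq)
    have c: "x \<in> carrier F" "l \<in> carrier F" using x YK l Lc Kc by auto
    have "x \<oplus>\<^bsub>F\<^esub> (-1) \<odot>\<^bsub>F\<^esub> l \<in> I" using Ieq[of x l] l x YK sub by auto
    moreover have "x = l \<oplus>\<^bsub>F\<^esub> (x \<oplus>\<^bsub>F\<^esub> (-1) \<odot>\<^bsub>F\<^esub> l)"
      using c by (simp add: F.M.a_lcomm[of l x] F.r_neg flip: cvec_closed(4)[OF F])
    ultimately show "x \<in> L <+>\<^bsub>F\<^esub> I" using l by (auto simp: set_add_def')
  next
    assume "x \<in> L <+>\<^bsub>F\<^esub> I"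
    then obtain l i where li: "l \<in> L" "i \<in> I" "x = l \<oplus>\<^bsub>F\<^esub> i" by (auto simp: set_add_def')
    have c: "i \<in> carrier F" "l \<in> carrier F" using li Lc Ic by auto
    have "x \<oplus>\<^bsub>F\<^esub> (-1) \<odot>\<^bsub>F\<^esub> l = i"
      using c by (simp add: li(3) F.M.a_comm[of l i] F.M.a_assoc F.r_neg flip: cvec_closed(4)[OF F])
    then have "I +>\<^bsub>F\<^esub> x = I +>\<^bsub>F\<^esub> l" using Ieq[of x l] li x YK sub by auto
    then show "I +>\<^bsub>F\<^esub> x \<in> B" using li by (auto simp: B_eq)
  qed
  have gin: "I +>\<^bsub>F\<^esub> x \<in> calG" if "x \<in> Y" for x using that by (auto simp: calG_eq)
  show ?thesis
    unfolding Y_def[symmetric] calG_def[symmetric] presents_def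
  proof (intro conjI ballI allI)
    let ?G = "quot_space (H\<lparr>carrier := calG\<rparr>) B"
    let ?r = "\<lambda>x. B +>\<^bsub>H\<^esub> (I +>\<^bsub>F\<^esub> x)"
    show "cvec ?G" by (rule cvec_quot_space[OF HG])
    show "carrier ?G = ?r ` Y"
      unfolding quot_space_simps rcosets_eq_image[OF HG] by (simp add: calG_eq image_image)
    show "?r (x \<oplus>\<^bsub>F\<^esub> y) = ?r x \<oplus>\<^bsub>?G\<^esub> ?r y" if "x \<in> Y" "y \<in> Y" for x y
      using coset_add[OF HG, of "I +>\<^bsub>F\<^esub> x" "I +>\<^bsub>F\<^esub> y"] that YK gin by (simp add: addH)
    show "?r (a \<odot>\<^bsub>F\<^esub> x) = a \<odot>\<^bsub>?G\<^esub> ?r x" if "x \<in> Y" for a x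
      using coset_smult[OF HG, of "I +>\<^bsub>F\<^esub> x" a] that YK gin by (simp add: smultH)
    show "?r x = \<zero>\<^bsub>?G\<^esub> \<longleftrightarrow> x \<in> L <+>\<^bsub>F\<^esub> I" if "x \<in> Y" for x
      using coset_eq_self_iff[OF HG, of "I +>\<^bsub>F\<^esub> x"] that gin mem by simp
  qed
qed

section \<open>Smooth and holomorphic functions of several variables\<close>

lemma frechet_derivative_cong_open:
  assumes "open U" "x \<in> U" "\<And>y. y \<in> U \<Longrightarrow> f y = g y"
  shows "frechet_derivative f (at x) = frechet_derivative g (at x)"
proof -
  have "(f has_derivative D) (at x) \<longleftrightarrow> (g has_derivative D) (at x)" for D
    using has_derivative_transform_within_open[OF _ assms(1,2)] assms(3) by metis
  then show ?thesis by (simp add: frechet_derivative_def)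
qed

lemma differentiable_cong_open:
  assumes "open U" "x \<in> U" "\<And>y. y \<in> U \<Longrightarrow> f y = g y"
  shows "f differentiable (at x) \<longleftrightarrow> g differentiable (at x)"
  unfolding differentiable_def
  using has_derivative_transform_within_open[OF _ assms(1,2)] assms(3) by metis

lemma has_frechet_derivative:
  "f differentiable (at x) \<Longrightarrow> (f has_derivative frechet_derivative f (at x)) (at x)"
  by (simp add: frechet_derivative_works)

lemma frechet_derivative_eqI:
  "(f has_derivative D) (at x) \<Longrightarrow> frechet_derivative f (at x) = D"
  using frechet_derivative_at by metis

lemma Ck_on_cong:
  assumes "open U" "\<And>y. y \<in> U \<Longrightarrow> f y = g y" "Ck_on k f U"
  shows "Ck_on k g U"
  using assms(2,3)
proof (induction k arbitrary: f g)
  case 0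
  then show ?case by (simp cong: continuous_on_cong)
next
  case (Suc k)
  have "frechet_derivative f (at x) = frechet_derivative g (at x)" if "x \<in> U" for x
    using frechet_derivative_cong_open[OF \<open>open U\<close> that] Suc.prems(1) by blast
  then have "Ck_on k (\<lambda>x. frechet_derivative g (at x) v) U" for v
    using Suc.prems(2) by (auto intro: Suc.IH[of "\<lambda>x. frechet_derivative f (at x) v"])
  moreover have "g differentiable (at x)" if "x \<in> U" for x
    using differentiable_cong_open[OF \<open>open U\<close> that, of f g] Suc.prems that by auto
  ultimately show ?case by simp
qed

lemma Ck_on_bounded_linear:
  assumes "open U" "bounded_linear L" "Ck_on k f U"
  shows "Ck_on k (\<lambda>x. L (f x)) U"
  using assms(3)
proof (induction k arbitrary: f)
  case 0
  then show ?case using assms(2) by (simp add: bounded_linear.continuous_on)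
next
  case (Suc k)
  have D: "((\<lambda>x. L (f x)) has_derivative (\<lambda>v. L (frechet_derivative f (at x) v))) (at x)"
    if "x \<in> U" for x
    using Suc.prems that by (intro bounded_linear.has_derivative[OF assms(2)] has_frechet_derivative) auto
  have "Ck_on k (\<lambda>x. frechet_derivative (\<lambda>x. L (f x)) (at x) v) U" for v
    by (rule Ck_on_cong[OF assms(1) _ Suc.IH[of "\<lambda>x. frechet_derivative f (at x) v"]])
      (use Suc.prems frechet_derivative_eqI[OF D] in auto)
  then show ?case using D by (auto simp: differentiable_def)
qed

lemma Ck_on_add:
  assumes "open U" "Ck_on k f U" "Ck_on k g U"
  shows "Ck_on k (\<lambda>x. f x + g x) U"
  using assms(2,3)
proof (induction k arbitrary: f g)
  case 0
  then show ?case by (simp add: continuous_on_add)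
next
  case (Suc k)
  have D: "((\<lambda>x. f x + g x) has_derivative
      (\<lambda>v. frechet_derivative f (at x) v + frechet_derivative g (at x) v)) (at x)" if "x \<in> U" for x
    using Suc.prems that by (intro has_derivative_add has_frechet_derivative) auto
  have "Ck_on k (\<lambda>x. frechet_derivative (\<lambda>x. f x + g x) (at x) v) U" for v
    by (rule Ck_on_cong[OF assms(1) _ Suc.IH[of "\<lambda>x. frechet_derivative f (at x) v"
            "\<lambda>x. frechet_derivative g (at x) v"]])
      (use Suc.prems frechet_derivative_eqI[OF D] in auto)
  then show ?case using D by (auto simp: differentiable_def)
qed

lemma Ck_on_const: "Ck_on k (\<lambda>x. c) U"
  by (induction k arbitrary: c) auto

lemma smooth_on_const: "smooth_on (\<lambda>x. c) U"
  by (simp add: smooth_on_def Ck_on_const)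

lemma smooth_on_cong:
  "open U \<Longrightarrow> (\<And>y. y \<in> U \<Longrightarrow> f y = g y) \<Longrightarrow> smooth_on f U \<Longrightarrow> smooth_on g U"
  unfolding smooth_on_def using Ck_on_cong by blast

lemma smooth_on_add:
  "open U \<Longrightarrow> smooth_on f U \<Longrightarrow> smooth_on g U \<Longrightarrow> smooth_on (\<lambda>x. f x + g x) U"
  by (simp add: smooth_on_def Ck_on_add)

lemma smooth_on_cmult:
  "open U \<Longrightarrow> smooth_on f U \<Longrightarrow> smooth_on (\<lambda>x. (c::complex) * f x) U"
  by (simp add: smooth_on_def Ck_on_bounded_linear[OF _ bounded_linear_mult_right])

lemma smooth_on_sum:
  assumes "open U" "\<And>i. i \<in> I \<Longrightarrow> smooth_on (f i) U"
  shows "smooth_on (\<lambda>x. \<Sum>i\<in>I. f i x) U"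
  using assms(2)
  by (induction I rule: infinite_finite_induct) (auto intro!: smooth_on_const smooth_on_add[OF assms(1)])

lemma smooth_onD:
  assumes "smooth_on f U"
  shows "x \<in> U \<Longrightarrow> f differentiable (at x)"
    and "smooth_on (\<lambda>x. frechet_derivative f (at x) v) U"
    and "continuous_on U f"
proof -
  have "Ck_on (Suc k) f U" for k using assms by (simp only: smooth_on_def)
  then show "x \<in> U \<Longrightarrow> f differentiable (at x)"
    and "smooth_on (\<lambda>x. frechet_derivative f (at x) v) U"
    by (auto simp: smooth_on_def)
  show "continuous_on U f" using assms by (auto simp: smooth_on_def dest: spec[of _ 0])
qed

lemma second_difference_mvt:
  fixes g :: "'e::real_normed_vector \<Rightarrow> real"
  assumes h: "h > 0"
    and g: "\<And>s t. 0 \<le> s \<Longrightarrow> s \<le> h \<Longrightarrow> 0 \<le> t \<Longrightarrow> t \<le> h \<Longrightarrow>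
      (g has_derivative g' (x + s *\<^sub>R v + t *\<^sub>R w)) (at (x + s *\<^sub>R v + t *\<^sub>R w))"
    and gv: "\<And>s t. 0 \<le> s \<Longrightarrow> s \<le> h \<Longrightarrow> 0 \<le> t \<Longrightarrow> t \<le> h \<Longrightarrow>
      ((\<lambda>y. g' y v) has_derivative gv' (x + s *\<^sub>R v + t *\<^sub>R w)) (at (x + s *\<^sub>R v + t *\<^sub>R w))"
  shows "\<exists>s t. 0 < s \<and> s < h \<and> 0 < t \<and> t < h \<and>
    g (x + h *\<^sub>R v + h *\<^sub>R w) - g (x + h *\<^sub>R v) - g (x + h *\<^sub>R w) + g x =
    h * (h * gv' (x + s *\<^sub>R v + t *\<^sub>R w) w)"
proof -
  have line: "((\<lambda>s. x + s *\<^sub>R v + t *\<^sub>R w) has_derivative (\<lambda>r. r *\<^sub>R v)) (at s)" for s t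
    by (auto intro!: derivative_eq_intros)
  have line': "((\<lambda>t. x + s *\<^sub>R v + t *\<^sub>R w) has_derivative (\<lambda>r. r *\<^sub>R w)) (at t)" for s t
    by (auto intro!: derivative_eq_intros)
  have D: "((\<lambda>s. g (x + s *\<^sub>R v + t *\<^sub>R w)) has_real_derivative g' (x + s *\<^sub>R v + t *\<^sub>R w) v) (at s)"
    if "0 \<le> s" "s \<le> h" "0 \<le> t" "t \<le> h" for s t
  proof -
    note G = g[OF that]
    have "((\<lambda>s. g (x + s *\<^sub>R v + t *\<^sub>R w)) has_derivative
        (\<lambda>r. g' (x + s *\<^sub>R v + t *\<^sub>R w) (r *\<^sub>R v))) (at s)"
      by (rule has_derivative_compose[OF line G])
    then show ?thesis
      using has_derivative_linear[OF G]
      by (simp add: has_field_derivative_def linear_scale mult.commute[of _ "g' _ v"])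
  qed
  have D': "((\<lambda>t. g' (x + s *\<^sub>R v + t *\<^sub>R w) v) has_real_derivative gv' (x + s *\<^sub>R v + t *\<^sub>R w) w) (at t)"
    if "0 \<le> s" "s \<le> h" "0 \<le> t" "t \<le> h" for s t
  proof -
    note G = gv[OF that]
    have "((\<lambda>t. g' (x + s *\<^sub>R v + t *\<^sub>R w) v) has_derivative
        (\<lambda>r. gv' (x + s *\<^sub>R v + t *\<^sub>R w) (r *\<^sub>R w))) (at t)"
      by (rule has_derivative_compose[OF line' G])
    then show ?thesis
      using has_derivative_linear[OF G]
      by (simp add: has_field_derivative_def linear_scale mult.commute[of _ "gv' _ w"])
  qed
  define \<phi> where "\<phi> s = g (x + s *\<^sub>R v + h *\<^sub>R w) - g (x + s *\<^sub>R v + 0 *\<^sub>R w)" for s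
  have "\<exists>s>0. s < h \<and> \<phi> h - \<phi> 0 = (h - 0) * (g' (x + s *\<^sub>R v + h *\<^sub>R w) v - g' (x + s *\<^sub>R v + 0 *\<^sub>R w) v)"
    unfolding \<phi>_def using h by (intro MVT2 DERIV_diff D) auto
  then obtain s where s: "0 < s" "s < h"
    "\<phi> h - \<phi> 0 = h * (g' (x + s *\<^sub>R v + h *\<^sub>R w) v - g' (x + s *\<^sub>R v + 0 *\<^sub>R w) v)" by auto
  have "\<exists>t>0. t < h \<and> g' (x + s *\<^sub>R v + h *\<^sub>R w) v - g' (x + s *\<^sub>R v + 0 *\<^sub>R w) v =
      (h - 0) * gv' (x + s *\<^sub>R v + t *\<^sub>R w) w"
    using h s by (intro MVT2 D') auto
  then obtain t where t: "0 < t" "t < h" "g' (x + s *\<^sub>R v + h *\<^sub>R w) v - g' (x + s *\<^sub>R v + 0 *\<^sub>R w) v =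
      h * gv' (x + s *\<^sub>R v + t *\<^sub>R w) w" by auto
  have "\<phi> h - \<phi> 0 = h * (h * gv' (x + s *\<^sub>R v + t *\<^sub>R w) w)" by (simp only: s(3) t(3))
  then show ?thesis using s t by (intro exI[of _ s] exI[of _ t]) (simp add: \<phi>_def)
qed

lemma symmetric_second_derivative_real:
  fixes g :: "'e::real_normed_vector \<Rightarrow> real"
  assumes U: "open U" "x \<in> U"
    and g: "\<And>y. y \<in> U \<Longrightarrow> (g has_derivative g' y) (at y)"
    and gv: "\<And>y. y \<in> U \<Longrightarrow> ((\<lambda>y. g' y v) has_derivative gv' y) (at y)"
    and gw: "\<And>y. y \<in> U \<Longrightarrow> ((\<lambda>y. g' y w) has_derivative gw' y) (at y)"
    and cv: "continuous_on U (\<lambda>y. gv' y w)" and cw: "continuous_on U (\<lambda>y. gw' y v)"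
  shows "gv' x w = gw' x v"
proof (rule ccontr)
  assume neq: "gv' x w \<noteq> gw' x v"
  define e where "e = \<bar>gv' x w - gw' x v\<bar> / 2"
  have e: "e > 0" using neq by (simp add: e_def)
  have "isCont (\<lambda>y. gv' y w) x" using cv U by (simp add: continuous_on_eq_continuous_at)
  from this[unfolded continuous_at_eps_delta, rule_format, OF e]
  obtain d1 where d1: "d1 > 0" "\<And>y. dist y x < d1 \<Longrightarrow> dist (gv' y w) (gv' x w) < e" by blast
  have "isCont (\<lambda>y. gw' y v) x" using cw U by (simp add: continuous_on_eq_continuous_at)
  from this[unfolded continuous_at_eps_delta, rule_format, OF e]
  obtain d2 where d2: "d2 > 0" "\<And>y. dist y x < d2 \<Longrightarrow> dist (gw' y v) (gw' x v) < e" by blast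
  obtain d3 where d3: "d3 > 0" "\<And>y. dist y x < d3 \<Longrightarrow> y \<in> U"
    using U unfolding open_dist by blast
  define d where "d = min d1 (min d2 d3)"
  have d: "d > 0" and near: "\<And>y. dist y x < d \<Longrightarrow>
      dist (gv' y w) (gv' x w) < e \<and> dist (gw' y v) (gw' x v) < e \<and> y \<in> U"
    using d1 d2 d3 by (auto simp: d_def)
  define N where "N = norm v + norm w + 1"
  define h where "h = d / N / 2"
  have pos: "N > 0" unfolding N_def by (smt (verit) norm_ge_zero)
  have h: "h > 0" using d pos by (simp add: h_def)
  have in_ball: "dist (x + s *\<^sub>R v + t *\<^sub>R w) x < d" if "0 \<le> s" "s \<le> h" "0 \<le> t" "t \<le> h" for s t
  proof -
    have "dist (x + s *\<^sub>R v + t *\<^sub>R w) x = norm (s *\<^sub>R v + t *\<^sub>R w)" by (simp add: dist_norm)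
    also have "\<dots> \<le> s * norm v + t * norm w" using that by (intro norm_triangle_le) simp
    also have "\<dots> \<le> h * norm v + h * norm w" using that by (intro add_mono mult_right_mono) auto
    also have "\<dots> \<le> h * N" using h by (simp add: N_def algebra_simps)
    also have "\<dots> = d / 2" using pos by (simp add: h_def)
    also have "\<dots> < d" using d by simp
    finally show ?thesis .
  qed
  have in_ball': "dist (x + s *\<^sub>R w + t *\<^sub>R v) x < d" if "0 \<le> s" "s \<le> h" "0 \<le> t" "t \<le> h" for s t
    using in_ball[OF that(3,4,1,2)] by (simp add: add_ac)
  have "\<exists>s t. 0 < s \<and> s < h \<and> 0 < t \<and> t < h \<and>
    g (x + h *\<^sub>R v + h *\<^sub>R w) - g (x + h *\<^sub>R v) - g (x + h *\<^sub>R w) + g x =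
    h * (h * gv' (x + s *\<^sub>R v + t *\<^sub>R w) w)"
    using near in_ball by (intro second_difference_mvt[OF h, where g' = g'] g gv) blast+
  then obtain s t where st: "0 < s" "s < h" "0 < t" "t < h" and 1:
    "g (x + h *\<^sub>R v + h *\<^sub>R w) - g (x + h *\<^sub>R v) - g (x + h *\<^sub>R w) + g x =
      h * (h * gv' (x + s *\<^sub>R v + t *\<^sub>R w) w)" by blast
  have "\<exists>s t. 0 < s \<and> s < h \<and> 0 < t \<and> t < h \<and>
    g (x + h *\<^sub>R w + h *\<^sub>R v) - g (x + h *\<^sub>R w) - g (x + h *\<^sub>R v) + g x =
    h * (h * gw' (x + s *\<^sub>R w + t *\<^sub>R v) v)"
    using near in_ball' by (intro second_difference_mvt[OF h, where g' = g'] g gw) blast+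
  then obtain s' t' where st': "0 < s'" "s' < h" "0 < t'" "t' < h" and 2:
    "g (x + h *\<^sub>R w + h *\<^sub>R v) - g (x + h *\<^sub>R w) - g (x + h *\<^sub>R v) + g x =
      h * (h * gw' (x + s' *\<^sub>R w + t' *\<^sub>R v) v)" by blast
  have "h * (h * gv' (x + s *\<^sub>R v + t *\<^sub>R w) w) = h * (h * gw' (x + s' *\<^sub>R w + t' *\<^sub>R v) v)"
    unfolding 1[symmetric] 2[symmetric] by (simp add: add_ac)
  then have "gv' (x + s *\<^sub>R v + t *\<^sub>R w) w = gw' (x + s' *\<^sub>R w + t' *\<^sub>R v) v" using h by simp
  then have "dist (gv' x w) (gw' x v) \<le> dist (gv' (x + s *\<^sub>R v + t *\<^sub>R w) w) (gv' x w) +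
      dist (gw' (x + s' *\<^sub>R w + t' *\<^sub>R v) v) (gw' x v)"
    using dist_triangle3[of "gv' x w" "gw' x v" "gv' (x + s *\<^sub>R v + t *\<^sub>R w) w"] by simp
  moreover have "dist (gv' (x + s *\<^sub>R v + t *\<^sub>R w) w) (gv' x w) < e"
    using near in_ball st by simp
  moreover have "dist (gw' (x + s' *\<^sub>R w + t' *\<^sub>R v) v) (gw' x v) < e"
    using near in_ball' st' by simp
  ultimately have "dist (gv' x w) (gw' x v) < e + e" by linarith
  then show False by (simp add: e_def dist_real_def)
qed

lemma smooth_on_symmetric:
  fixes f :: "'e::real_normed_vector \<Rightarrow> complex"
  assumes U: "open U" "x \<in> U" and f: "smooth_on f U"
  shows "frechet_derivative (\<lambda>y. frechet_derivative f (at y) v) (at x) w =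
    frechet_derivative (\<lambda>y. frechet_derivative f (at y) w) (at x) v"
proof -
  let ?f' = "\<lambda>y. frechet_derivative f (at y)"
  let ?f'' = "\<lambda>v y. frechet_derivative (\<lambda>y. ?f' y v) (at y)"
  have 1: "(f has_derivative ?f' y) (at y)" if "y \<in> U" for y
    using smooth_onD(1)[OF f that] by (rule has_frechet_derivative)
  have 2: "((\<lambda>y. ?f' y v) has_derivative ?f'' v y) (at y)" if "y \<in> U" for y v
    using smooth_onD(1)[OF smooth_onD(2)[OF f] that] by (rule has_frechet_derivative)
  have 3: "continuous_on U (\<lambda>y. ?f'' v y w)" for v w
    by (intro smooth_onD(3) smooth_onD(2) f)
  show ?thesis
  proof (rule complex_eqI)
    show "Re (?f'' v x w) = Re (?f'' w x v)"
      by (rule symmetric_second_derivative_real[OF U, of "\<lambda>y. Re (f y)" "\<lambda>y v. Re (?f' y v)" v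
            "\<lambda>y w. Re (?f'' v y w)" w "\<lambda>y v. Re (?f'' w y v)"])
        (auto intro!: continuous_on_Re 3 bounded_linear.has_derivative[OF bounded_linear_Re] 1 2)
    show "Im (?f'' v x w) = Im (?f'' w x v)"
      by (rule symmetric_second_derivative_real[OF U, of "\<lambda>y. Im (f y)" "\<lambda>y v. Im (?f' y v)" v
            "\<lambda>y w. Im (?f'' v y w)" w "\<lambda>y v. Im (?f'' w y v)"])
        (auto intro!: continuous_on_Im 3 bounded_linear.has_derivative[OF bounded_linear_Im] 1 2)
  qed
qed

definition cdiff_on :: "(complex^'n \<Rightarrow> complex) \<Rightarrow> (complex^'n) set \<Rightarrow> bool" where
  "cdiff_on h U \<longleftrightarrow> (\<forall>x\<in>U. h differentiable (at x) \<and>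
     (\<forall>c v. frechet_derivative h (at x) (c *s v) = c * frechet_derivative h (at x) v))"

lemma bounded_linear_scale_left: "bounded_linear (\<lambda>c. c *s (v::complex^'n))"
  unfolding linear_conv_bounded_linear[symmetric]
  by (rule linearI) (auto simp: vec_eq_iff algebra_simps scaleR_conv_of_real[where 'a = complex])

lemma scaleR_eq_vector_scale: "r *\<^sub>R (v::complex^'n) = of_real r *s v"
  by (simp add: vec_eq_iff scaleR_conv_of_real[where 'a = complex])

lemma norm_vector_scale: "norm (c *s (v::complex^'n)) = norm c * norm v"
  by (simp add: norm_vec_def L2_set_def norm_mult power_mult_distrib flip: sum_distrib_left)
    (simp add: real_sqrt_mult)

lemma cdiff_on_Cauchy:
  fixes h :: "complex^'n \<Rightarrow> complex"
  assumes h: "cdiff_on h U" and sub: "\<And>z. z \<in> cball 0 1 \<Longrightarrow> x + z *s u \<in> U"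
  shows "frechet_derivative h (at x) u =
    integral (cbox 0 1) (\<lambda>t. h (x + exp (2 * of_real pi * \<i> * of_real t) *s u) *
      exp (- (2 * of_real pi * \<i> * of_real t)))"
proof -
  define g where "g z = h (x + z *s u)" for z
  have D: "(g has_field_derivative frechet_derivative h (at (x + z *s u)) u) (at z)"
    if "z \<in> cball 0 1" for z
  proof -
    have 1: "((\<lambda>z. x + z *s u) has_derivative (\<lambda>r. r *s u)) (at z)"
      by (auto intro!: derivative_eq_intros bounded_linear_imp_has_derivative bounded_linear_scale_left)
    have 2: "(h has_derivative frechet_derivative h (at (x + z *s u))) (at (x + z *s u))"
      using h sub[OF that] by (intro has_frechet_derivative) (auto simp: cdiff_on_def)
    have "(g has_derivative (\<lambda>r. frechet_derivative h (at (x + z *s u)) (r *s u))) (at z)"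
      unfolding g_def by (rule has_derivative_compose[OF 1 2])
    moreover have "frechet_derivative h (at (x + z *s u)) (r *s u) =
        frechet_derivative h (at (x + z *s u)) u * r" for r
      using h sub[OF that] by (auto simp: cdiff_on_def)
    ultimately show ?thesis by (simp add: has_field_derivative_def)
  qed
  have cont: "continuous_on (cball 0 1) g"
    using D by (intro continuous_at_imp_continuous_on ballI) (auto intro: DERIV_isCont)
  have hol: "g holomorphic_on ball 0 1"
    by (metis D ball_subset_cball holomorphic_on_open open_ball subsetD)
  have "(g has_field_derivative (1 / (2 * of_real pi * \<i>) *
      contour_integral (circlepath 0 1) (\<lambda>u. g u / (u - 0)^2))) (at 0)"
    by (rule Cauchy_derivative_integral_circlepath(2)[OF cont hol]) simp
  then have "frechet_derivative h (at x) u = 1 / (2 * of_real pi * \<i>) *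
      contour_integral (circlepath 0 1) (\<lambda>u. g u / (u - 0)^2)"
    using D[of 0] DERIV_unique by force
  also have "\<dots> = integral (cbox 0 1) (\<lambda>t. 1 / (2 * of_real pi * \<i>) *
      (g (exp (2 * of_real pi * \<i> * of_real t)) / (exp (2 * of_real pi * \<i> * of_real t))^2 *
        (2 * of_real pi * \<i> * exp (2 * of_real pi * \<i> * of_real t))))"
    unfolding contour_integral_integral vector_derivative_circlepath integral_mult_right cbox_interval
    by (simp add: circlepath)
  also have "\<dots> = integral (cbox 0 1) (\<lambda>t. h (x + exp (2 * of_real pi * \<i> * of_real t) *s u) *
      exp (- (2 * of_real pi * \<i> * of_real t)))"
    by (intro integral_cong) (simp add: g_def exp_minus field_simps power2_eq_square)
  finally show ?thesis .
qed

lemma continuous_on_circle_shift: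
  fixes u :: "complex^'n"
  shows "continuous_on S (\<lambda>(x, t). x + exp (2 * of_real pi * \<i> * complex_of_real t) *s u)"
  unfolding split_beta
  by (intro continuous_intros bounded_linear.continuous_on[OF bounded_linear_scale_left])

lemma cdiff_on_frechet_continuous_locally:
  fixes h :: "complex^'n \<Rightarrow> complex"
  assumes h: "cdiff_on h U" and B: "cball x0 (2 * r) \<subseteq> U" and r: "r > 0" and u: "norm u \<le> r"
  shows "continuous_on (ball x0 r) (\<lambda>x. frechet_derivative h (at x) u)"
proof -
  have in_U: "x + z *s u \<in> U" if "x \<in> ball x0 r" "z \<in> cball 0 1" for x z
  proof -
    have "dist x0 (x + z *s u) \<le> dist x0 x + norm (z *s u)"
      by (metis add_diff_cancel_left' dist_norm dist_triangle norm_minus_commute)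
    also have "norm (z *s u) \<le> 1 * r"
      unfolding norm_vector_scale using that u by (intro mult_mono) auto
    finally show ?thesis using that B by (auto simp: mem_ball mem_cball subset_eq)
  qed
  have hc: "continuous_on U h"
    using h by (intro continuous_at_imp_continuous_on)
      (auto simp: cdiff_on_def intro: differentiable_imp_continuous_within)
  have "continuous_on (ball x0 r) (\<lambda>x. integral (cbox 0 1) (\<lambda>t. h (x + exp (2 * of_real pi * \<i> * of_real t) *s u) *
      exp (- (2 * of_real pi * \<i> * of_real t))))"
  proof (rule integral_continuous_on_param)
    have "continuous_on (ball x0 r \<times> cbox 0 1)
        (\<lambda>p. h ((\<lambda>(x, t). x + exp (2 * of_real pi * \<i> * complex_of_real t) *s u) p))"
      by (rule continuous_on_compose2[OF hc continuous_on_circle_shift]) (auto intro!: in_U)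
    then show "continuous_on (ball x0 r \<times> cbox 0 1)
        (\<lambda>(x, t). h (x + exp (2 * of_real pi * \<i> * of_real t) *s u) *
          exp (- (2 * of_real pi * \<i> * of_real t)))"
      unfolding split_beta by (intro continuous_intros)
  qed
  then show ?thesis
    by (rule continuous_on_eq) (intro cdiff_on_Cauchy[OF h, symmetric] in_U)
qed

lemma cdiff_on_obtain_scale:
  assumes "open U" "x0 \<in> U"
  obtains r e where "r > 0" "cball x0 (2 * r) \<subseteq> U" "e > 0" "norm (of_real e *s (v::complex^'n)) \<le> r"
proof -
  obtain R where R: "R > 0" "cball x0 R \<subseteq> U" using assms open_contains_cball by blast
  define N where "N = norm v + 1"
  define e where "e = (R / 2) / N"
  have pos: "N > 0" unfolding N_def by (smt (verit) norm_ge_zero)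
  have e: "e > 0" using R pos by (simp add: e_def)
  have "norm (of_real e *s v) = e * norm v" using e by (simp add: norm_vector_scale)
  also have "\<dots> \<le> e * N" using e by (simp add: N_def)
  also have "\<dots> = R / 2" using pos by (simp add: e_def)
  finally show thesis using that[of "R / 2" e] R e by simp
qed

lemma cdiff_on_frechet_continuous:
  fixes h :: "complex^'n \<Rightarrow> complex"
  assumes h: "cdiff_on h U" and U: "open U"
  shows "continuous_on U (\<lambda>x. frechet_derivative h (at x) v)"
proof (rule continuous_at_imp_continuous_on, safe)
  fix x0 assume x0: "x0 \<in> U"
  obtain r e where re: "r > 0" "cball x0 (2 * r) \<subseteq> U" "e > 0" "norm (of_real e *s v) \<le> r"
    using cdiff_on_obtain_scale[OF U x0] .
  have "continuous_on (ball x0 r) (\<lambda>x. frechet_derivative h (at x) (of_real e *s v) / of_real e)"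
    by (intro continuous_intros cdiff_on_frechet_continuous_locally[OF h re(2,1,4)]) (use re in auto)
  then have "continuous_on (ball x0 r) (\<lambda>x. frechet_derivative h (at x) v)"
  proof (rule continuous_on_eq)
    fix x assume "x \<in> ball x0 r"
    then have "x \<in> U" using re(1,2) by (auto simp: subset_eq)
    then show "frechet_derivative h (at x) (of_real e *s v) / of_real e = frechet_derivative h (at x) v"
      using h re(3) by (simp add: cdiff_on_def)
  qed
  then show "isCont (\<lambda>x. frechet_derivative h (at x) v) x0"
    using re(1) by (simp add: continuous_on_eq_continuous_at)
qed

lemma cdiff_on_frechet:
  fixes h :: "complex^'n \<Rightarrow> complex"
  assumes h: "cdiff_on h U" and U: "open U"
  shows "cdiff_on (\<lambda>x. frechet_derivative h (at x) v) U"
proof -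
  define H where "H x = Blinfun (frechet_derivative h (at x))" for x
  have H: "blinfun_apply (H x) = frechet_derivative h (at x)" if "x \<in> U" for x
    using h that unfolding H_def cdiff_on_def
    by (intro bounded_linear_Blinfun_apply) (auto intro: has_derivative_bounded_linear has_frechet_derivative)
  have Hc: "continuous_on U H"
  proof (rule continuous_on_blinfun_componentwise)
    show "continuous_on U (\<lambda>x. blinfun_apply (H x) i)" for i
      by (rule continuous_on_eq[OF cdiff_on_frechet_continuous[OF h U, of i]]) (simp add: H)
  qed
  have hc: "continuous_on U h"
    using h by (intro continuous_at_imp_continuous_on)
      (auto simp: cdiff_on_def intro: differentiable_imp_continuous_within)
  have "\<exists>D. ((\<lambda>x. frechet_derivative h (at x) v) has_derivative D) (at x0) \<and>
      (\<forall>c w. D (c *s w) = c * D w)" if x0: "x0 \<in> U" for x0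
  proof -
    obtain r e where r: "r > 0" and B: "cball x0 (2 * r) \<subseteq> U" and e: "e > 0"
        and u: "norm (of_real e *s v) \<le> r"
      using cdiff_on_obtain_scale[OF U x0] .
    define u where "u = of_real e *s v"
    define E where "E t = exp (2 * of_real pi * \<i> * complex_of_real t)" for t
    define E' where "E' t = exp (- (2 * of_real pi * \<i> * complex_of_real t))" for t
    have normE: "norm (E t) = 1" for t by (simp add: E_def)
    have in_U: "x + z *s u \<in> U" if "x \<in> ball x0 r" "z \<in> cball 0 1" for x z
    proof -
      have "dist x0 (x + z *s u) \<le> dist x0 x + norm (z *s u)"
        by (metis add_diff_cancel_left' dist_norm dist_triangle norm_minus_commute)
      also have "norm (z *s u) \<le> 1 * r"
        unfolding norm_vector_scale using that u by (intro mult_mono) (auto simp: u_def)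
      finally show ?thesis using that B by (auto simp: mem_ball mem_cball subset_eq)
    qed
    have EU: "x + E t *s u \<in> U" if "x \<in> ball x0 r" for x t
      using in_U[OF that, of "E t"] by (simp add: normE)
    have shift: "continuous_on S (\<lambda>(x, t). x + E t *s u)" for S
      unfolding E_def by (rule continuous_on_circle_shift)
    define M where "M x t = blinfun_mult_left (E' t) o\<^sub>L H (x + E t *s u)" for x t
    have M: "blinfun_apply (M x t) = (\<lambda>w. frechet_derivative h (at (x + E t *s u)) w * E' t)"
      if "x \<in> ball x0 r" for x t
      using H[OF EU[OF that]] by (simp add: M_def fun_eq_iff)
    have F: "frechet_derivative h (at x) u = integral (cbox 0 1) (\<lambda>t. h (x + E t *s u) * E' t)"
      if "x \<in> ball x0 r" for x
      unfolding E_def E'_def by (rule cdiff_on_Cauchy[OF h in_U[OF that]])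
    have contM: "continuous_on (ball x0 r \<times> cbox 0 1) (\<lambda>(x, t). M x t)"
    proof -
      have "continuous_on (ball x0 r \<times> cbox 0 1) (\<lambda>p. H ((\<lambda>(x, t). x + E t *s u) p))"
        by (rule continuous_on_compose2[OF Hc shift]) (auto intro!: EU)
      moreover have "continuous_on (ball x0 r \<times> cbox 0 1) (\<lambda>p. blinfun_mult_left (E' (snd p)) :: complex \<Rightarrow>\<^sub>L complex)"
        unfolding E'_def
        by (intro bounded_linear.continuous_on[OF bounded_linear_blinfun_mult_left] continuous_intros)
      ultimately show ?thesis unfolding M_def split_beta
        by (intro bounded_bilinear.continuous_on[OF bounded_bilinear_blinfun_compose])
    qed
    have "((\<lambda>x. integral (cbox 0 1) (\<lambda>t. h (x + E t *s u) * E' t)) has_derivative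
        blinfun_apply (integral (cbox 0 1) (M x0))) (at x0 within ball x0 r)"
    proof (rule leibniz_rule[OF _ _ contM])
      fix x :: "complex^'n" and t :: real assume x: "x \<in> ball x0 r"
      have 1: "((\<lambda>x. x + E t *s u) has_derivative (\<lambda>w. w)) (at x)"
        by (auto intro!: derivative_eq_intros)
      have 2: "(h has_derivative frechet_derivative h (at (x + E t *s u))) (at (x + E t *s u))"
        using h EU[OF x] by (intro has_frechet_derivative) (auto simp: cdiff_on_def)
      have "((\<lambda>x. h (x + E t *s u)) has_derivative frechet_derivative h (at (x + E t *s u))) (at x)"
        by (rule has_derivative_compose[OF 1 2])
      then show "((\<lambda>x. h (x + E t *s u) * E' t) has_derivative blinfun_apply (M x t)) (at x within ball x0 r)"
        unfolding M[OF x] by (rule has_derivative_mult_left[OF has_derivative_at_withinI])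
    next
      fix x assume x: "x \<in> ball x0 r"
      have "continuous_on (cbox 0 1) (\<lambda>t. x + E t *s u)"
        unfolding E_def
        by (intro continuous_intros bounded_linear.continuous_on[OF bounded_linear_scale_left])
      then have "continuous_on (cbox 0 1) (\<lambda>t. h (x + E t *s u))"
        by (rule continuous_on_compose2[OF hc]) (use EU[OF x] in blast)
      moreover have "continuous_on (cbox 0 1) E'" unfolding E'_def by (intro continuous_intros)
      ultimately show "(\<lambda>t. h (x + E t *s u) * E' t) integrable_on cbox 0 1"
        by (intro integrable_continuous continuous_on_mult)
    qed (use r in auto)
    then have 1: "((\<lambda>x. integral (cbox 0 1) (\<lambda>t. h (x + E t *s u) * E' t)) has_derivative
        blinfun_apply (integral (cbox 0 1) (M x0))) (at x0)"
      using r at_within_open[of x0 "ball x0 r"] by simp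
    have int: "M x0 integrable_on cbox 0 1"
    proof (rule integrable_continuous)
      show "continuous_on (cbox 0 1) (M x0)"
      proof -
        have c: "continuous_on (cbox 0 1) (\<lambda>t::real. (x0, t))" by (intro continuous_intros)
        have "(\<lambda>t. (x0, t)) ` cbox 0 1 \<subseteq> ball x0 r \<times> cbox 0 1"
          using r by (auto simp: image_subset_iff)
        from continuous_on_compose2[OF contM c this] show ?thesis by simp
      qed
    qed
    have "((\<lambda>x. frechet_derivative h (at x) u) has_derivative
        blinfun_apply (integral (cbox 0 1) (M x0))) (at x0)"
      by (rule has_derivative_transform_within_open[OF 1, of "ball x0 r"]) (use r F in auto)
    then have "((\<lambda>x. frechet_derivative h (at x) u / of_real e) has_derivative
        (\<lambda>w. blinfun_apply (integral (cbox 0 1) (M x0)) w / of_real e)) (at x0)"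
      unfolding divide_inverse by (rule has_derivative_mult_left)
    then have "((\<lambda>x. frechet_derivative h (at x) v) has_derivative
        (\<lambda>w. blinfun_apply (integral (cbox 0 1) (M x0)) w / of_real e)) (at x0)"
    proof (rule has_derivative_transform_within_open[OF _ U x0])
      show "frechet_derivative h (at x) u / of_real e = frechet_derivative h (at x) v" if "x \<in> U" for x
        using h e that by (simp add: cdiff_on_def u_def)
    qed
    moreover have "blinfun_apply (integral (cbox 0 1) (M x0)) (c *s w) / of_real e =
        c * (blinfun_apply (integral (cbox 0 1) (M x0)) w / of_real e)" for c w
    proof -
      have "blinfun_apply (integral (cbox 0 1) (M x0)) (c *s w) =
          integral (cbox 0 1) (\<lambda>t. c * blinfun_apply (M x0 t) w)"
        unfolding blinfun_apply_integral[OF int]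
        using h EU[of x0] r by (intro integral_cong) (auto simp: M cdiff_on_def mult.assoc)
      then show ?thesis unfolding blinfun_apply_integral[OF int] integral_mult_right by simp
    qed
    ultimately show ?thesis by blast
  qed
  then show ?thesis
    unfolding cdiff_on_def differentiable_def using frechet_derivative_eqI by (metis (no_types, lifting))
qed

lemma cdiff_on_smooth:
  fixes h :: "complex^'n \<Rightarrow> complex"
  assumes h: "cdiff_on h U" and U: "open U"
  shows "smooth_on h U"
  unfolding smooth_on_def
proof
  show "Ck_on k h U" for k
    using h
  proof (induction k arbitrary: h)
    case 0
    then show ?case by (auto simp: cdiff_on_def intro!: continuous_at_imp_continuous_on
          intro: differentiable_imp_continuous_within)
  next
    case (Suc k)
    then show ?case using cdiff_on_frechet[OF _ U] by (simp add: cdiff_on_def)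
  qed
qed

section \<open>Permutations and the spaces of covectors\<close>

primrec cyc :: "nat \<Rightarrow> nat \<Rightarrow> nat" where
  "cyc 0 = id"
| "cyc (Suc i) = Transposition.transpose i (Suc i) \<circ> cyc i"

lemma cyc_0 [simp]: "cyc i 0 = i"
  by (induction i) (auto simp: Transposition.transpose_def)

lemma cyc_Suc_arg [simp]: "cyc i (Suc j) = (if j < i then j else Suc j)"
  by (induction i) (auto simp: Transposition.transpose_def)

lemma cyc_permutes: "i \<le> k \<Longrightarrow> cyc i permutes {..<Suc k}"
proof (induction i)
  case 0
  show ?case unfolding cyc.simps by (rule permutes_id)
next
  case (Suc i)
  then show ?case unfolding cyc.simps
    by (intro permutes_compose permutes_swap_id) auto
qed

lemma sign_cyc: "sign (cyc i) = (-1) ^ i"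
proof (induction i)
  case (Suc i)
  have perm: "permutation (cyc i)"
    using cyc_permutes[of i i] permutation_permutes by blast
  show ?case
    unfolding cyc.simps sign_compose[OF permutation_swap_id perm] sign_swap_id Suc.IH by simp
qed simp

definition lift_perm :: "(nat \<Rightarrow> nat) \<Rightarrow> nat \<Rightarrow> nat" where
  "lift_perm \<sigma> = case_nat 0 (\<lambda>j. Suc (\<sigma> j))"

lemma lift_perm_simps [simp]: "lift_perm \<sigma> 0 = 0" "lift_perm \<sigma> (Suc j) = Suc (\<sigma> j)"
  by (simp_all add: lift_perm_def)

lemma lift_perm_permutes:
  assumes "\<sigma> permutes {..<k}"
  shows "lift_perm \<sigma> permutes Suc ` {..<k} \<and> sign (lift_perm \<sigma>) = sign \<sigma>"
  using assms finite_lessThan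
proof (induction rule: permutes_induct)
  case id
  have "lift_perm id = id" by (simp add: fun_eq_iff lift_perm_def split: nat.split)
  then show ?case by (simp only: permutes_id)
next
  case (swap a b p)
  have eq: "lift_perm (Transposition.transpose a b \<circ> p) = Transposition.transpose (Suc a) (Suc b) \<circ> lift_perm p"
    by (auto simp: fun_eq_iff lift_perm_def Transposition.transpose_def split: nat.split)
  have p: "permutation (lift_perm p)" "permutation p"
    using swap permutation_permutes by blast+
  have "sign (Transposition.transpose (Suc a) (Suc b) \<circ> lift_perm p) = sign (Transposition.transpose a b \<circ> p)"
    unfolding sign_compose[OF permutation_swap_id p(1)] sign_compose[OF permutation_swap_id p(2)]
      sign_swap_id using swap by simp
  moreover have "Transposition.transpose (Suc a) (Suc b) \<circ> lift_perm p permutes Suc ` {..<k}"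
    using swap by (intro permutes_compose permutes_swap_id) auto
  ultimately show ?case unfolding eq by blast
qed

lemma bij_betw_lift_perm:
  "bij_betw lift_perm {\<sigma>. \<sigma> permutes {..<k}} {\<sigma>. \<sigma> permutes (Suc ` {..<k})}"
  unfolding bij_betw_def
proof
  show inj: "inj_on lift_perm {\<sigma>. \<sigma> permutes {..<k}}"
    by (rule inj_onI) (metis ext lift_perm_simps(2) old.nat.inject)
  show "lift_perm ` {\<sigma>. \<sigma> permutes {..<k}} = {\<sigma>. \<sigma> permutes (Suc ` {..<k})}"
  proof (rule card_subset_eq)
    show "finite {\<sigma>. \<sigma> permutes (Suc ` {..<k})}" by (intro finite_permutations) auto
    show "lift_perm ` {\<sigma>. \<sigma> permutes {..<k}} \<subseteq> {\<sigma>. \<sigma> permutes (Suc ` {..<k})}"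
      using lift_perm_permutes by blast
    show "card (lift_perm ` {\<sigma>. \<sigma> permutes {..<k}}) = card {\<sigma>. \<sigma> permutes (Suc ` {..<k})}"
      by (simp add: card_image[OF inj] card_permutations[of _ k] card_image)
  qed
qed

lemma sum_permutations_Suc:
  "(\<Sum>\<tau> | \<tau> permutes {..<Suc k}. F \<tau>) =
    (\<Sum>i\<le>k. \<Sum>\<sigma> | \<sigma> permutes {..<k}. F (cyc i \<circ> lift_perm \<sigma>))"
proof -
  let ?S = "Suc ` {..<k}"
  have S: "{..<Suc k} = insert 0 ?S" by (rule lessThan_Suc_eq_insert_0)
  have inner: "(\<Sum>q | q permutes ?S. F (Transposition.transpose 0 i \<circ> q)) =
      (\<Sum>\<sigma> | \<sigma> permutes {..<k}. F (cyc i \<circ> lift_perm \<sigma>))" if i: "i \<in> {..k}" for i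
  proof -
    let ?\<rho> = "Transposition.transpose 0 i \<circ> cyc i"
    have perm: "?\<rho> permutes {..<Suc k}"
      using i by (intro permutes_compose cyc_permutes permutes_swap_id) auto
    have "?\<rho> permutes ?S"
    proof (rule permutes_superset[OF perm])
      fix x assume "x \<in> {..<Suc k} - ?S"
      then have "x = 0" unfolding S by blast
      then show "?\<rho> x = x" by simp
    qed
    from setum_permutations_compose_left[OF this, of "\<lambda>q. F (Transposition.transpose 0 i \<circ> q)"]
    have "(\<Sum>q | q permutes ?S. F (Transposition.transpose 0 i \<circ> q)) =
        (\<Sum>q | q permutes ?S. F (Transposition.transpose 0 i \<circ> (?\<rho> \<circ> q)))" .
    also have "\<dots> = (\<Sum>q | q permutes ?S. F (cyc i \<circ> q))"
      by (intro sum.cong refl arg_cong[where f = F]) (simp add: fun_eq_iff)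
    also have "\<dots> = (\<Sum>\<sigma> | \<sigma> permutes {..<k}. F (cyc i \<circ> lift_perm \<sigma>))"
      by (rule sum.reindex_bij_betw[OF bij_betw_lift_perm, symmetric])
    finally show ?thesis .
  qed
  have "(\<Sum>\<tau> | \<tau> permutes {..<Suc k}. F \<tau>) = (\<Sum>i\<in>{..<Suc k}. \<Sum>q | q permutes ?S. F (Transposition.transpose 0 i \<circ> q))"
    unfolding S by (rule sum_over_permutations_insert) auto
  also have "\<dots> = (\<Sum>i\<le>k. \<Sum>q | q permutes ?S. F (Transposition.transpose 0 i \<circ> q))"
    by (simp only: lessThan_Suc_atMost)
  also have "\<dots> = (\<Sum>i\<le>k. \<Sum>\<sigma> | \<sigma> permutes {..<k}. F (cyc i \<circ> lift_perm \<sigma>))"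
    by (rule sum.cong[OF refl inner])
  finally show ?thesis .
qed

lemma omit_eq_cyc: "omit i v j = v (cyc i (Suc j))"
  by (simp add: omit_def)

lemma alternating_sum_omit:
  fixes T :: "'e \<Rightarrow> (nat \<Rightarrow> 'e) \<Rightarrow> complex"
  shows "(\<Sum>i\<le>k. (-1) ^ i * (\<Sum>\<sigma> | \<sigma> permutes {..<k}. of_int (sign \<sigma>) * T (v i) (\<lambda>j. omit i v (\<sigma> j)))) =
    (\<Sum>\<tau> | \<tau> permutes {..<Suc k}. of_int (sign \<tau>) * T (v (\<tau> 0)) (\<lambda>j. v (\<tau> (Suc j))))"
  unfolding sum_permutations_Suc sum_distrib_left
proof (intro sum.cong refl)
  fix i \<sigma> assume i: "i \<in> {..k}" and \<sigma>: "\<sigma> \<in> {\<sigma>. \<sigma> permutes {..<k}}"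
  have "permutation (cyc i)" "permutation (lift_perm \<sigma>)"
    using cyc_permutes[of i i] lift_perm_permutes[of \<sigma> k] \<sigma> permutation_permutes
    by blast+
  then have "sign (cyc i \<circ> lift_perm \<sigma>) = (-1) ^ i * sign \<sigma>"
    using lift_perm_permutes[of \<sigma> k] \<sigma> by (simp add: sign_compose sign_cyc)
  then show "(-1) ^ i * (of_int (sign \<sigma>) * T (v i) (\<lambda>j. omit i v (\<sigma> j))) =
      of_int (sign (cyc i \<circ> lift_perm \<sigma>)) *
        T (v ((cyc i \<circ> lift_perm \<sigma>) 0)) (\<lambda>j. v ((cyc i \<circ> lift_perm \<sigma>) (Suc j)))"
    by (simp add: omit_eq_cyc del: cyc_Suc_arg)
qed

lemma wedge_Suc:
  "(\<Sum>i\<le>k. (-1) ^ i * (\<beta> (v i) * wedge k \<alpha> (omit i v))) = wedge (Suc k) (case_nat \<beta> \<alpha>) v"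
proof -
  have "(\<Sum>i\<le>k. (-1) ^ i * (\<beta> (v i) * wedge k \<alpha> (omit i v))) =
    (\<Sum>i\<le>k. (-1) ^ i * (\<Sum>\<sigma> | \<sigma> permutes {..<k}. of_int (sign \<sigma>) *
      (\<beta> (v i) * (\<Prod>j<k. \<alpha> j (omit i v (\<sigma> j))))))"
    unfolding wedge_def sum_distrib_left
    by (intro sum.cong refl) (simp only: mult_ac)
  also have "\<dots> = wedge (Suc k) (case_nat \<beta> \<alpha>) v"
    using alternating_sum_omit[where T = "\<lambda>a u. \<beta> a * (\<Prod>j<k. \<alpha> j (u j))"]
    unfolding wedge_def prod.lessThan_Suc_shift by simp
  finally show ?thesis .
qed

lemma wedge_cong:
  "(\<And>i. i < k \<Longrightarrow> \<alpha> i = \<beta> i) \<Longrightarrow> wedge k \<alpha> v = wedge k \<beta> v"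
  unfolding wedge_def by (intro sum.cong refl arg_cong2[where f = "(*)"] prod.cong) auto

lemma wedge_permute:
  assumes \<pi>: "\<pi> permutes {..<k}"
  shows "wedge k (\<lambda>i. \<alpha> (\<pi> i)) v = of_int (sign \<pi>) * wedge k \<alpha> v"
proof -
  have "wedge k (\<lambda>i. \<alpha> (\<pi> i)) v =
      (\<Sum>\<sigma> | \<sigma> permutes {..<k}. of_int (sign (\<sigma> \<circ> \<pi>)) * (\<Prod>i<k. \<alpha> (\<pi> i) (v ((\<sigma> \<circ> \<pi>) i))))"
    unfolding wedge_def by (rule sum_permutations_compose_right[OF \<pi>])
  also have "\<dots> = (\<Sum>\<sigma> | \<sigma> permutes {..<k}. of_int (sign \<pi>) * (of_int (sign \<sigma>) * (\<Prod>i<k. \<alpha> i (v (\<sigma> i)))))"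
  proof (rule sum.cong[OF refl])
    fix \<sigma> assume \<sigma>: "\<sigma> \<in> {\<sigma>. \<sigma> permutes {..<k}}"
    have "permutation \<sigma>" "permutation \<pi>" using \<sigma> \<pi> permutation_permutes by blast+
    then have "sign (\<sigma> \<circ> \<pi>) = sign \<pi> * sign \<sigma>" by (simp add: sign_compose)
    moreover have "(\<Prod>i<k. \<alpha> (\<pi> i) (v ((\<sigma> \<circ> \<pi>) i))) = (\<Prod>i<k. \<alpha> i (v (\<sigma> i)))"
      using prod.permute[OF \<pi>, of "\<lambda>i. \<alpha> i (v (\<sigma> i))"] by (simp add: o_def)
    ultimately show "of_int (sign (\<sigma> \<circ> \<pi>)) * (\<Prod>i<k. \<alpha> (\<pi> i) (v ((\<sigma> \<circ> \<pi>) i))) =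
        of_int (sign \<pi>) * (of_int (sign \<sigma>) * (\<Prod>i<k. \<alpha> i (v (\<sigma> i))))" by simp
  qed
  finally show ?thesis unfolding wedge_def sum_distrib_left .
qed

abbreviation clinear :: "(complex^'n \<Rightarrow> complex) \<Rightarrow> bool" where
  "clinear \<equiv> Vector_Spaces.linear (*s) (*)"

abbreviation conj_linear :: "(complex^'n \<Rightarrow> complex) \<Rightarrow> bool" where
  "conj_linear \<alpha> \<equiv> clinear (\<lambda>v. cnj (\<alpha> v))"

lemma clinear_iff:
  "clinear f \<longleftrightarrow> (\<forall>v w. f (v + w) = f v + f w) \<and> (\<forall>c v. f (c *s v) = c * f v)"
  using vec.vector_space_axioms vector_space_over_itself.vector_space_axioms
  by (auto simp: Vector_Spaces.linear_iff)

abbreviation fun_span :: "('v \<Rightarrow> complex) set \<Rightarrow> ('v \<Rightarrow> complex) set" where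
  "fun_span \<equiv> fun_vs.span"

definition wedges :: "nat \<Rightarrow> nat \<Rightarrow> ((nat \<Rightarrow> complex^'n) \<Rightarrow> complex) set" where
  "wedges p q = {wedge (p + q) \<alpha> | \<alpha>. (\<forall>i<p. clinear (\<alpha> i)) \<and> (\<forall>i\<in>{p..<p+q}. conj_linear (\<alpha> i))}"

lemma covectorsE:
  assumes "\<eta> \<in> covectors p q"
  obtains m and c :: "nat \<Rightarrow> complex" and \<alpha> :: "nat \<Rightarrow> nat \<Rightarrow> complex^'n \<Rightarrow> complex"
  where "\<forall>j<m. \<forall>i<p. clinear (\<alpha> j i)" "\<forall>j<m. \<forall>i\<in>{p..<p+q}. conj_linear (\<alpha> j i)"
    "\<eta> = (\<lambda>v. \<Sum>j<m. c j * wedge (p + q) (\<alpha> j) v)"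
  using assms unfolding covectors_def by (elim CollectE exE conjE) (rule that)

lemma covectors_eq_span: "covectors p q = fun_span (wedges p q)"
proof
  show "covectors p q \<subseteq> fun_span (wedges p q)"
  proof
    fix \<eta> :: "(nat \<Rightarrow> complex^'n) \<Rightarrow> complex" assume "\<eta> \<in> covectors p q"
    then obtain m and c :: "nat \<Rightarrow> complex" and \<alpha> :: "nat \<Rightarrow> nat \<Rightarrow> complex^'n \<Rightarrow> complex" where \<alpha>: "\<forall>j<m. \<forall>i<p. clinear (\<alpha> j i)"
        "\<forall>j<m. \<forall>i\<in>{p..<p+q}. conj_linear (\<alpha> j i)"
        and \<eta>: "\<eta> = (\<lambda>v. \<Sum>j<m. c j * wedge (p + q) (\<alpha> j) v)"
      by (rule covectorsE)
    have "\<eta> = (\<Sum>j<m. (\<lambda>v. c j * wedge (p + q) (\<alpha> j) v))" by (simp add: \<eta> fun_eq_iff sum_apply)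
    also have "\<dots> \<in> fun_span (wedges p q)"
      using \<alpha> by (intro fun_vs.span_sum fun_vs.span_scale fun_vs.span_base) (auto simp: wedges_def)
    finally show "\<eta> \<in> fun_span (wedges p q)" .
  qed
  show "fun_span (wedges p q) \<subseteq> covectors p q"
  proof
    fix \<eta> :: "(nat \<Rightarrow> complex^'n) \<Rightarrow> complex" assume "\<eta> \<in> fun_span (wedges p q)"
    then show "\<eta> \<in> covectors p q"
    proof (induction rule: fun_vs.span_induct_alt)
      case base
      show ?case unfolding covectors_def
        by (intro CollectI exI[of _ 0]) (auto simp: zero_fun_def)
    next
      case (step d x y)
      obtain \<beta> where \<beta>: "\<forall>i<p. clinear (\<beta> i)" "\<forall>i\<in>{p..<p+q}. conj_linear (\<beta> i)"
          "x = wedge (p + q) \<beta>"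
        using step(1) by (auto simp: wedges_def)
      obtain m and c :: "nat \<Rightarrow> complex" and \<alpha> :: "nat \<Rightarrow> nat \<Rightarrow> complex^'n \<Rightarrow> complex" where \<alpha>: "\<forall>j<m. \<forall>i<p. clinear (\<alpha> j i)"
          "\<forall>j<m. \<forall>i\<in>{p..<p+q}. conj_linear (\<alpha> j i)"
          and y: "y = (\<lambda>v. \<Sum>j<m. c j * wedge (p + q) (\<alpha> j) v)"
        using step(2) by (rule covectorsE)
      let ?c = "c(m := d)" and ?\<alpha> = "\<alpha>(m := \<beta>)"
      have "(\<lambda>b. d * x b) + y = (\<lambda>v. \<Sum>j<Suc m. ?c j * wedge (p + q) (?\<alpha> j) v)"
        by (simp add: y \<beta>(3) fun_eq_iff)
      moreover have "\<forall>j<Suc m. \<forall>i<p. clinear (?\<alpha> j i)"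
          "\<forall>j<Suc m. \<forall>i\<in>{p..<p+q}. conj_linear (?\<alpha> j i)"
        using \<alpha> \<beta> by (auto simp: less_Suc_eq)
      ultimately show ?case unfolding covectors_def
        by (intro CollectI exI[of _ "Suc m"] exI[of _ ?c] exI[of _ ?\<alpha>] conjI)
    qed
  qed
qed

lemma covectors_sum:
  "(\<And>u. u \<in> U \<Longrightarrow> f u \<in> covectors p q) \<Longrightarrow> (\<lambda>v. \<Sum>u\<in>U. f u v) \<in> covectors p q"
  using fun_vs.span_sum[of U f "wedges p q"] by (simp add: covectors_eq_span sum_apply[abs_def])

lemma covectors_scale: "f \<in> covectors p q \<Longrightarrow> (\<lambda>v. c * f v) \<in> covectors p q"
  unfolding covectors_eq_span by (rule fun_vs.span_scale)

lemma covectors_add: "f \<in> covectors p q \<Longrightarrow> g \<in> covectors p q \<Longrightarrow> (\<lambda>v. f v + g v) \<in> covectors p q"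
  unfolding covectors_eq_span using fun_vs.span_add[of f _ g] by (simp add: plus_fun_def)

lemma covectors_zero: "(\<lambda>v. 0) \<in> covectors p q"
  unfolding covectors_eq_span using fun_vs.span_zero by (simp add: zero_fun_def)

lemma covectors_induct [consumes 1, case_names zero add]:
  assumes "\<eta> \<in> covectors p q" "P (\<lambda>v. 0)"
    and "\<And>c \<alpha> \<eta>. (\<And>i. i < p \<Longrightarrow> clinear (\<alpha> i)) \<Longrightarrow>
      (\<And>i. p \<le> i \<Longrightarrow> i < p + q \<Longrightarrow> conj_linear (\<alpha> i)) \<Longrightarrow>
      P \<eta> \<Longrightarrow> P (\<lambda>v. c * wedge (p + q) \<alpha> v + \<eta> v)"
  shows "P \<eta>"
  using assms(1) unfolding covectors_eq_span
proof (induction rule: fun_vs.span_induct_alt)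
  case base
  then show ?case using assms(2) by (simp add: zero_fun_def)
next
  case (step c x y)
  then show ?case using assms(3)[of _ y c] by (auto simp: wedges_def plus_fun_def)
qed

lemma wedge_clinear_covectors:
  assumes \<beta>: "clinear \<beta>" and \<eta>: "\<eta> \<in> covectors p q"
  shows "(\<lambda>v. \<Sum>i\<le>p + q. (-1) ^ i * (\<beta> (v i) * \<eta> (omit i v))) \<in> covectors (Suc p) q"
  using \<eta>
proof (induction rule: covectors_induct)
  case zero
  show ?case by (simp add: covectors_zero)
next
  case (add c \<alpha> \<eta>)
  have "wedge (Suc p + q) (case_nat \<beta> \<alpha>) \<in> wedges (Suc p) q"
    unfolding wedges_def using \<beta> add(1,2) by (auto split: nat.split)
  then have "wedge (Suc p + q) (case_nat \<beta> \<alpha>) \<in> covectors (Suc p) q"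
    unfolding covectors_eq_span by (rule fun_vs.span_base)
  from covectors_add[OF covectors_scale[OF this, of c] add(3)] show ?case
    by (simp add: algebra_simps sum.distrib sum_distrib_left flip: wedge_Suc)
qed

lemma wedge_conj_linear_covectors:
  assumes \<beta>: "conj_linear \<beta>" and \<eta>: "\<eta> \<in> covectors p q"
  shows "(\<lambda>v. \<Sum>i\<le>p + q. (-1) ^ i * (\<beta> (v i) * \<eta> (omit i v))) \<in> covectors p (Suc q)"
  using \<eta>
proof (induction rule: covectors_induct)
  case zero
  show ?case by (simp add: covectors_zero)
next
  case (add c \<alpha> \<eta>)
  define \<alpha>' where "\<alpha>' i = (if i < p then \<alpha> i else if i = p then \<beta> else \<alpha> (i - 1))" for i
  have eq: "wedge (Suc (p + q)) (case_nat \<beta> \<alpha>) = (\<lambda>v. of_int (sign (cyc p)) * wedge (p + Suc q) \<alpha>' v)"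
  proof
    fix v
    have "wedge (Suc (p + q)) (case_nat \<beta> \<alpha>) v = wedge (Suc (p + q)) (\<lambda>i. \<alpha>' (cyc p i)) v"
      by (rule wedge_cong) (auto simp: \<alpha>'_def split: nat.split)
    also have "\<dots> = of_int (sign (cyc p)) * wedge (Suc (p + q)) \<alpha>' v"
      by (intro wedge_permute cyc_permutes) simp
    finally show "wedge (Suc (p + q)) (case_nat \<beta> \<alpha>) v = of_int (sign (cyc p)) * wedge (p + Suc q) \<alpha>' v"
      by simp
  qed
  have "wedge (p + Suc q) \<alpha>' \<in> wedges p (Suc q)"
    unfolding wedges_def using \<beta> add(1,2)
    by (intro CollectI exI[of _ \<alpha>'] conjI refl) (auto simp: \<alpha>'_def)
  then have "wedge (p + Suc q) \<alpha>' \<in> covectors p (Suc q)"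
    unfolding covectors_eq_span by (rule fun_vs.span_base)
  then have "wedge (Suc (p + q)) (case_nat \<beta> \<alpha>) \<in> covectors p (Suc q)"
    unfolding eq by (rule covectors_scale)
  from covectors_add[OF covectors_scale[OF this, of c] add(3)] show ?case
    by (simp add: algebra_simps sum.distrib sum_distrib_left flip: wedge_Suc)
qed

definition basic_covector :: "nat \<Rightarrow> nat \<Rightarrow> 'n \<Rightarrow> complex^'n \<Rightarrow> complex" where
  "basic_covector p i j v = (if i < p then v $ j else cnj (v $ j))"

lemma wedges_finite_span:
  "wedges p q \<subseteq> fun_span ((\<lambda>f. wedge (p + q) (\<lambda>i. basic_covector p i (f i))) `
    ({..<p + q} \<rightarrow>\<^sub>E (UNIV :: 'n::finite set)))"
proof
  fix \<eta> :: "(nat \<Rightarrow> complex^'n) \<Rightarrow> complex" assume "\<eta> \<in> wedges p q"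
  then obtain \<alpha> where \<alpha>': "\<forall>i<p. clinear (\<alpha> i)" "\<forall>i\<in>{p..<p+q}. conj_linear (\<alpha> i)"
      and \<eta>: "\<eta> = wedge (p + q) \<alpha>"
    unfolding wedges_def by blast
  have \<alpha>: "clinear (\<alpha> i)" if "i < p" for i using \<alpha>' that by simp
  have \<alpha>_conj: "conj_linear (\<alpha> i)" if "p \<le> i" "i < p + q" for i using \<alpha>' that by simp
  define a where "a i j = \<alpha> i (axis j 1)" for i j
  have expand: "f v = (\<Sum>j\<in>UNIV. f (axis j 1) * v $ j)" if f: "clinear f" for f and v :: "complex^'n"
  proof -
    have "f v = f (\<Sum>j\<in>UNIV. v $ j *s axis j 1)" by (simp add: basis_expansion)
    also have "\<dots> = (\<Sum>j\<in>UNIV. f (v $ j *s axis j 1))"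
      by (rule module_hom.sum[OF f[folded module_hom_iff_linear]])
    finally show ?thesis using f by (simp add: clinear_iff mult.commute)
  qed
  have \<alpha>_eq: "\<alpha> i v = (\<Sum>j\<in>UNIV. a i j * basic_covector p i j v)" if "i < p + q" for i v
  proof (cases "i < p")
    case True
    then show ?thesis using expand[OF \<alpha>] by (simp add: a_def basic_covector_def)
  next
    case False
    have "cnj (\<alpha> i v) = (\<Sum>j\<in>UNIV. cnj (\<alpha> i (axis j 1)) * v $ j)"
      using False that by (intro expand \<alpha>_conj) auto
    then have "\<alpha> i v = cnj (\<Sum>j\<in>UNIV. cnj (\<alpha> i (axis j 1)) * v $ j)" by (metis complex_cnj_cnj)
    then show ?thesis using False by (simp add: a_def basic_covector_def)
  qed
  let ?I = "{..<p + q} \<rightarrow>\<^sub>E (UNIV :: 'n set)"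
  have "\<eta> v = (\<Sum>f\<in>?I. (\<Prod>i<p + q. a i (f i)) * wedge (p + q) (\<lambda>i. basic_covector p i (f i)) v)" for v
  proof -
    have "\<eta> v = (\<Sum>\<sigma> | \<sigma> permutes {..<p + q}. of_int (sign \<sigma>) *
        (\<Prod>i<p + q. \<Sum>j\<in>UNIV. a i j * basic_covector p i j (v (\<sigma> i))))"
      unfolding \<eta> wedge_def using \<alpha>_eq by (intro sum.cong refl arg_cong2[where f = "(*)"] prod.cong) auto
    also have "\<dots> = (\<Sum>\<sigma> | \<sigma> permutes {..<p + q}. of_int (sign \<sigma>) *
        (\<Sum>f\<in>?I. \<Prod>i<p + q. a i (f i) * basic_covector p i (f i) (v (\<sigma> i))))"
      by (subst prod_sum_PiE) auto
    also have "\<dots> = (\<Sum>f\<in>?I. (\<Prod>i<p + q. a i (f i)) * wedge (p + q) (\<lambda>i. basic_covector p i (f i)) v)"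
      unfolding wedge_def sum_distrib_left prod.distrib
      by (subst sum.swap) (simp add: mult_ac)
    finally show ?thesis .
  qed
  then have "\<eta> = (\<Sum>f\<in>?I. (\<lambda>v. (\<Prod>i<p + q. a i (f i)) * wedge (p + q) (\<lambda>i. basic_covector p i (f i)) v))"
    by (simp add: fun_eq_iff sum_apply)
  also have "\<dots> \<in> fun_span ((\<lambda>f. wedge (p + q) (\<lambda>i. basic_covector p i (f i))) ` ?I)"
    by (intro fun_vs.span_sum fun_vs.span_scale fun_vs.span_base) auto
  finally show "\<eta> \<in> fun_span ((\<lambda>f. wedge (p + q) (\<lambda>i. basic_covector p i (f i))) ` ?I)" .
qed

text \<open>
  The coordinates of \<open>\<eta>\<close> are combinations of values of \<open>\<eta>\<close>, so they commute with differentiation of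
  \<open>\<eta>\<close> in a parameter.
\<close>

lemma finite_span_interpolation:
  assumes "finite E"
  shows "\<exists>U g. finite U \<and> (\<forall>u\<in>U. g u \<in> fun_span E) \<and>
    (\<forall>\<eta>\<in>fun_span E. \<forall>v. \<eta> v = (\<Sum>u\<in>U. \<eta> u * g u v))"
  using assms
proof (induction rule: finite_induct)
  case empty
  show ?case by (intro exI[of _ "{}"]) auto
next
  case (insert \<epsilon> E)
  then obtain U g where U: "finite U" and g: "\<And>u. u \<in> U \<Longrightarrow> g u \<in> fun_span E"
    and interp: "\<And>\<eta> v. \<eta> \<in> fun_span E \<Longrightarrow> \<eta> v = (\<Sum>u\<in>U. \<eta> u * g u v)"
    by blast
  define \<delta> where "\<delta> v = \<epsilon> v - (\<Sum>u\<in>U. \<epsilon> u * g u v)" for v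
  have sub: "fun_span E \<subseteq> fun_span (insert \<epsilon> E)" by (intro fun_vs.span_mono) auto
  have sumE: "(\<lambda>v. \<Sum>u\<in>U. \<eta> u * g u v) \<in> fun_span E" for \<eta>
  proof -
    have "(\<Sum>u\<in>U. (\<lambda>v. \<eta> u * g u v)) \<in> fun_span E"
      using g by (intro fun_vs.span_sum fun_vs.span_scale)
    then show ?thesis by (simp add: sum_apply[abs_def])
  qed
  show ?case
  proof (cases "\<exists>u. \<delta> u \<noteq> 0")
    case False
    have "\<epsilon> = (\<lambda>v. \<Sum>u\<in>U. \<epsilon> u * g u v)"
    proof
      fix v
      have "\<delta> v = 0" using False by blast
      then show "\<epsilon> v = (\<Sum>u\<in>U. \<epsilon> u * g u v)"
        unfolding \<delta>_def by (rule eq_iff_diff_eq_0[THEN iffD2])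
    qed
    then have "\<epsilon> \<in> fun_span E" by (rule ssubst) (rule sumE)
    then have eq: "fun_span (insert \<epsilon> E) = fun_span E" by (rule fun_vs.span_redundant)
    show ?thesis unfolding eq
      by (intro exI[of _ U] exI[of _ g] conjI ballI allI interp) (simp_all add: U g)
  next
    case True
    then obtain w where w: "\<delta> w \<noteq> 0" by auto
    have \<delta>: "\<delta> \<in> fun_span (insert \<epsilon> E)"
    proof -
      have "\<epsilon> - (\<lambda>v. \<Sum>u\<in>U. \<epsilon> u * g u v) \<in> fun_span (insert \<epsilon> E)"
        by (rule fun_vs.span_diff[OF fun_vs.span_base subsetD[OF sub sumE]]) simp
      then show ?thesis by (simp add: \<delta>_def[abs_def] fun_diff_def)
    qed
    define g' where "g' u v = (if u \<in> U then g u v - g u w / \<delta> w * \<delta> v else 0) +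
        (if u = w then \<delta> v / \<delta> w else 0)" for u v
    have g'_in: "g' u \<in> fun_span (insert \<epsilon> E)" for u
    proof -
      have a: "(\<lambda>v. g u v - g u w / \<delta> w * \<delta> v) \<in> fun_span (insert \<epsilon> E)" if "u \<in> U"
        using fun_vs.span_diff[OF subsetD[OF sub g[OF that]] fun_vs.span_scale[OF \<delta>], of "g u w / \<delta> w"]
        by (simp add: fun_diff_def)
      have b: "(\<lambda>v. \<delta> v / \<delta> w) \<in> fun_span (insert \<epsilon> E)"
        using fun_vs.span_scale[OF \<delta>, of "1 / \<delta> w"] by simp
      have c: "(\<lambda>v. 0) \<in> fun_span (insert \<epsilon> E)"
        using fun_vs.span_zero by (simp add: zero_fun_def)
      have "(\<lambda>v. if u \<in> U then g u v - g u w / \<delta> w * \<delta> v else 0) \<in> fun_span (insert \<epsilon> E)"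
        using a c by (cases "u \<in> U") auto
      moreover have "(\<lambda>v. if u = w then \<delta> v / \<delta> w else 0) \<in> fun_span (insert \<epsilon> E)"
        using b c by (cases "u = w") auto
      moreover have "g' u = (\<lambda>v. if u \<in> U then g u v - g u w / \<delta> w * \<delta> v else 0) +
          (\<lambda>v. if u = w then \<delta> v / \<delta> w else 0)"
        by (simp add: g'_def fun_eq_iff)
      ultimately show ?thesis by (simp only: fun_vs.span_add)
    qed
    have interp': "\<eta> v = (\<Sum>u\<in>insert w U. \<eta> u * g' u v)" if \<eta>: "\<eta> \<in> fun_span (insert \<epsilon> E)" for \<eta> v
    proof -
      obtain k where "\<eta> - (\<lambda>b. k * \<epsilon> b) \<in> fun_span E"
        using \<eta> unfolding fun_vs.span_breakdown_eq by blast
      then have "\<eta> v - k * \<epsilon> v = (\<Sum>u\<in>U. (\<eta> u - k * \<epsilon> u) * g u v)" for v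
        using interp[of "\<eta> - (\<lambda>b. k * \<epsilon> b)" v] by simp
      then have k: "\<eta> v - (\<Sum>u\<in>U. \<eta> u * g u v) = k * \<delta> v" for v
        by (simp add: \<delta>_def algebra_simps sum_subtractf sum_distrib_left)
      have "(\<Sum>u\<in>insert w U. \<eta> u * g' u v) =
          (\<Sum>u\<in>insert w U. if u \<in> U then \<eta> u * (g u v - g u w / \<delta> w * \<delta> v) else 0) +
          (\<Sum>u\<in>insert w U. if u = w then \<eta> u * (\<delta> v / \<delta> w) else 0)"
        unfolding sum.distrib[symmetric] by (intro sum.cong) (auto simp: g'_def algebra_simps)
      also have "(\<Sum>u\<in>insert w U. if u = w then \<eta> u * (\<delta> v / \<delta> w) else 0) = \<eta> w * (\<delta> v / \<delta> w)"
        using U by simp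
      also have "(\<Sum>u\<in>insert w U. if u \<in> U then \<eta> u * (g u v - g u w / \<delta> w * \<delta> v) else 0) =
          (\<Sum>u\<in>U. \<eta> u * (g u v - g u w / \<delta> w * \<delta> v))"
        using U by (subst sum.inter_filter[symmetric]) (auto intro!: sum.cong)
      also have "\<dots> = (\<Sum>u\<in>U. \<eta> u * g u v) - (\<Sum>u\<in>U. \<eta> u * g u w) * (\<delta> v / \<delta> w)"
      proof -
        have "\<eta> u * (g u v - g u w / \<delta> w * \<delta> v) = \<eta> u * g u v - \<eta> u * g u w * (\<delta> v / \<delta> w)" for u
          by (simp add: algebra_simps)
        then show ?thesis by (simp only: sum_subtractf sum_distrib_right)
      qed
      also have "\<dots> + \<eta> w * (\<delta> v / \<delta> w) =
          (\<Sum>u\<in>U. \<eta> u * g u v) + (\<eta> w - (\<Sum>u\<in>U. \<eta> u * g u w)) * (\<delta> v / \<delta> w)"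
        by (simp add: left_diff_distrib del: times_divide_eq_right)
      also have "\<dots> = (\<Sum>u\<in>U. \<eta> u * g u v) + k * \<delta> v" using w unfolding k by simp
      also have "\<dots> = \<eta> v" unfolding k[symmetric] by simp
      finally show ?thesis by simp
    qed
    show ?thesis
      by (intro exI[of _ "insert w U"] exI[of _ g'] conjI ballI allI interp' g'_in) (use U in simp)
  qed
qed

lemma covectors_interpolation:
  obtains U and g :: "(nat \<Rightarrow> complex^'n::finite) \<Rightarrow> (nat \<Rightarrow> complex^'n) \<Rightarrow> complex"
  where "finite U" "\<And>u. u \<in> U \<Longrightarrow> g u \<in> covectors p q"
    "\<And>\<eta> v. \<eta> \<in> covectors p q \<Longrightarrow> \<eta> v = (\<Sum>u\<in>U. \<eta> u * g u v)"
proof -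
  define E where "E = (\<lambda>f. wedge (p + q) (\<lambda>i. basic_covector p i (f i))) `
    ({..<p + q} \<rightarrow>\<^sub>E (UNIV :: 'n set))"
  have "finite E" unfolding E_def by (intro finite_imageI finite_PiE) auto
  from finite_span_interpolation[OF this] obtain U g where 1: "finite U"
    "\<forall>u\<in>U. g u \<in> fun_span E" "\<forall>\<eta>\<in>fun_span E. \<forall>v. \<eta> v = (\<Sum>u\<in>U. \<eta> u * g u v)"
    by (elim exE conjE)
  have "wedge (p + q) (\<lambda>i. basic_covector p i (f i)) \<in> wedges p q" for f :: "nat \<Rightarrow> 'n"
    unfolding wedges_def by (auto simp: basic_covector_def clinear_iff)
  then have "E \<subseteq> wedges p q" by (auto simp: E_def)
  then have "fun_span E \<subseteq> covectors p q" unfolding covectors_eq_span by (rule fun_vs.span_mono)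
  moreover have "covectors p q \<subseteq> fun_span E"
    unfolding covectors_eq_span E_def
    by (rule fun_vs.span_minimal[OF wedges_finite_span]) (rule fun_vs.subspace_span)
  ultimately have eq: "covectors p q = fun_span E" by simp
  show thesis
    by (rule that[OF 1(1)]) (unfold eq, rule 1(2)[rule_format], assumption, rule 1(3)[rule_format], assumption)
qed

section \<open>Wirtinger derivatives and pullbacks\<close>

definition wirtinger :: "complex \<Rightarrow> complex^'n \<Rightarrow> (complex^'n \<Rightarrow> complex) \<Rightarrow> complex^'n \<Rightarrow> complex" where
  "wirtinger s v f x =
     (frechet_derivative f (at x) v + s * frechet_derivative f (at x) (\<i> *s v)) / 2"

lemma wirt_eq_wirtinger: "wirt = wirtinger (- \<i>)" "wirt_bar = wirtinger \<i>"
  by (simp_all add: fun_eq_iff wirt_def wirt_bar_def wirtinger_def)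

lemma wirtinger_eqI:
  "(f has_derivative D) (at x) \<Longrightarrow> wirtinger s v f x = (D v + s * D (\<i> *s v)) / 2"
  by (simp add: wirtinger_def frechet_derivative_eqI)

lemma wirtinger_cong_open:
  assumes "open U" "x \<in> U" "\<And>y. y \<in> U \<Longrightarrow> f y = g y"
  shows "wirtinger s v f x = wirtinger s v g x"
  by (simp only: wirtinger_def frechet_derivative_cong_open[OF assms])

lemma wirtinger_const [simp]: "wirtinger s v (\<lambda>y. c) x = 0"
  by (simp add: wirtinger_def)

lemma wirtinger_add:
  assumes "f differentiable (at x)" "g differentiable (at x)"
  shows "wirtinger s v (\<lambda>y. f y + g y) x = wirtinger s v f x + wirtinger s v g x"
  unfolding wirtinger_eqI[OF has_derivative_add[OF assms[THEN has_frechet_derivative]]]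
  by (simp add: wirtinger_def field_simps)

lemma wirtinger_mult:
  assumes "f differentiable (at x)" "g differentiable (at x)"
  shows "wirtinger s v (\<lambda>y. f y * g y) x = wirtinger s v f x * g x + f x * wirtinger s v g x"
  unfolding wirtinger_eqI[OF has_derivative_mult[OF assms[THEN has_frechet_derivative]]]
  by (simp add: wirtinger_def field_simps)

lemma wirtinger_cmult:
  assumes "f differentiable (at x)"
  shows "wirtinger s v (\<lambda>y. c * f y) x = c * wirtinger s v f x"
  using wirtinger_mult[of "\<lambda>y. c" x f s v] assms by simp

lemma wirtinger_cmult_right:
  assumes "f differentiable (at x)"
  shows "wirtinger s v (\<lambda>y. f y * c) x = wirtinger s v f x * c"
  using wirtinger_cmult[OF assms, of s v c] by (simp add: mult.commute)

lemma wirtinger_sum: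
  assumes "\<And>i. i \<in> I \<Longrightarrow> f i differentiable (at x)"
  shows "wirtinger s v (\<lambda>y. \<Sum>i\<in>I. f i y) x = (\<Sum>i\<in>I. wirtinger s v (f i) x)"
  using assms
proof (induction I rule: infinite_finite_induct)
  case (insert i I)
  have "(\<lambda>y. \<Sum>i\<in>I. f i y) differentiable (at x)"
    using insert by (intro differentiable_sum) auto
  then show ?case using insert by (simp add: wirtinger_add)
qed simp_all

lemma wirtinger_prod:
  assumes "\<And>i. i \<in> I \<Longrightarrow> f i differentiable (at x)"
  shows "wirtinger s v (\<lambda>y. \<Prod>i\<in>I. f i y) x = (\<Sum>i\<in>I. wirtinger s v (f i) x * (\<Prod>j\<in>I - {i}. f j x))"
proof -
  have "((\<lambda>y. \<Prod>i\<in>I. f i y) has_derivative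
      (\<lambda>v. \<Sum>i\<in>I. frechet_derivative (f i) (at x) v * (\<Prod>j\<in>I - {i}. f j x))) (at x)"
    using assms by (intro has_derivative_prod has_frechet_derivative)
  from wirtinger_eqI[OF this, of s v] show ?thesis
    unfolding wirtinger_def
    by (simp only: sum_distrib_left sum.distrib[symmetric] sum_divide_distrib times_divide_eq_left
        distrib_right mult.assoc)
qed

lemma frechet_derivative_scale:
  fixes f :: "complex^'n \<Rightarrow> complex"
  assumes "f differentiable (at x)"
  shows "frechet_derivative f (at x) (c *s v) =
    of_real (Re c) * frechet_derivative f (at x) v + of_real (Im c) * frechet_derivative f (at x) (\<i> *s v)"
proof -
  have lin: "linear (frechet_derivative f (at x))"
    using has_frechet_derivative[OF assms] by (rule has_derivative_linear)
  have eq: "c *s v = Re c *\<^sub>R v + Im c *\<^sub>R (\<i> *s v)"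
    by (simp add: vec_eq_iff scaleR_conv_of_real[where 'a = complex] complex_eq_iff)
  show ?thesis
    by (subst eq) (simp only: linear_add[OF lin] linear_scale[OF lin] scaleR_conv_of_real[where 'a = complex])
qed

lemma frechet_derivative_add_arg:
  assumes "f differentiable (at x)"
  shows "frechet_derivative f (at x) (v + w) = frechet_derivative f (at x) v + frechet_derivative f (at x) w"
  using has_derivative_linear[OF has_frechet_derivative[OF assms]] by (rule linear_add)

lemma wirtinger_scale:
  assumes "f differentiable (at x)"
  shows "wirtinger (- \<i>) (c *s v) f x = c * wirtinger (- \<i>) v f x"
    and "wirtinger \<i> (c *s v) f x = cnj c * wirtinger \<i> v f x"
proof -
  have "\<i> *s (c *s v) = (\<i> * c) *s v" by simp
  note D = frechet_derivative_scale[OF assms, of c v]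
    frechet_derivative_scale[OF assms, of "\<i> * c" v, folded this]
  show "wirtinger (- \<i>) (c *s v) f x = c * wirtinger (- \<i>) v f x"
    unfolding wirtinger_def D by (simp add: complex_eq_iff algebra_simps)
  show "wirtinger \<i> (c *s v) f x = cnj c * wirtinger \<i> v f x"
    unfolding wirtinger_def D by (simp add: complex_eq_iff algebra_simps)
qed

lemma wirtinger_add_arg:
  assumes "f differentiable (at x)"
  shows "wirtinger s (v + w) f x = wirtinger s v f x + wirtinger s w f x"
  unfolding wirtinger_def vec.scale_right_distrib frechet_derivative_add_arg[OF assms]
  by (simp add: field_simps)

lemma clinear_wirtinger:
  assumes "f differentiable (at x)"
  shows "clinear (\<lambda>v. wirtinger (- \<i>) v f x)" "conj_linear (\<lambda>v. wirtinger \<i> v f x)"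
  using assms by (simp_all add: clinear_iff wirtinger_scale wirtinger_add_arg)

lemma smooth_on_wirtinger:
  assumes "open U" "smooth_on f U"
  shows "smooth_on (wirtinger s v f) U"
proof -
  have "wirtinger s v f = (\<lambda>x. (1/2) * (frechet_derivative f (at x) v) +
      (s/2) * frechet_derivative f (at x) (\<i> *s v))"
    by (simp add: fun_eq_iff wirtinger_def field_simps)
  then show ?thesis
    by (elim ssubst) (intro smooth_on_add smooth_on_cmult smooth_onD(2) assms)
qed

lemma wirtinger_commute:
  assumes U: "open U" "x \<in> U" and f: "smooth_on f U"
  shows "wirtinger s v (wirtinger t w f) x = wirtinger t w (wirtinger s v f) x"
proof -
  let ?D = "\<lambda>a b. frechet_derivative (\<lambda>y. frechet_derivative f (at y) b) (at x) a"
  have D: "(wirtinger t w f has_derivative (\<lambda>a. (?D a w + t * ?D a (\<i> *s w)) / 2)) (at x)" for t w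
  proof -
    have "((\<lambda>y. frechet_derivative f (at y) b) has_derivative (\<lambda>a. ?D a b)) (at x)" for b
      using smooth_onD(1)[OF smooth_onD(2)[OF f] U(2)] by (rule has_frechet_derivative)
    then show ?thesis
      unfolding wirtinger_def[abs_def] divide_inverse
      by (intro has_derivative_mult_left has_derivative_add has_derivative_mult_right)
  qed
  have sym: "?D a b = ?D b a" for a b
    by (rule smooth_on_symmetric[OF U f])
  show ?thesis
    unfolding wirtinger_eqI[OF D] sym[of w v] sym[of "\<i> *s w" v] sym[of w "\<i> *s v"]
      sym[of "\<i> *s w" "\<i> *s v"]
    by (simp add: add_divide_distrib distrib_left mult_ac)
qed

lemma wirtinger_compose:
  assumes f: "f differentiable (at (\<phi> x))" and \<phi>: "(\<phi> has_derivative \<phi>') (at x)"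
    and lin: "\<And>c v. \<phi>' (c *s v) = c *s \<phi>' v"
  shows "wirtinger s v (\<lambda>y. f (\<phi> y)) x = wirtinger s (\<phi>' v) f (\<phi> x)"
  unfolding wirtinger_eqI[OF has_derivative_compose[OF \<phi> has_frechet_derivative[OF f]]]
  by (simp add: wirtinger_def lin)

lemma alternating_sum_eq_0:
  fixes F :: "(nat \<Rightarrow> nat) \<Rightarrow> complex"
  assumes ab: "a < n" "b < n" "a \<noteq> b"
    and F: "\<And>\<tau>. \<tau> permutes {..<n} \<Longrightarrow> F (\<tau> \<circ> Transposition.transpose a b) = F \<tau>"
  shows "(\<Sum>\<tau> | \<tau> permutes {..<n}. of_int (sign \<tau>) * F \<tau>) = 0"
proof -
  let ?t = "Transposition.transpose a b"
  have t: "?t permutes {..<n}" using ab by (intro permutes_swap_id) auto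
  have "(\<Sum>\<tau> | \<tau> permutes {..<n}. of_int (sign \<tau>) * F \<tau>) =
      (\<Sum>\<tau> | \<tau> permutes {..<n}. of_int (sign (\<tau> \<circ> ?t)) * F (\<tau> \<circ> ?t))"
    by (rule sum_permutations_compose_right[OF t])
  also have "\<dots> = (\<Sum>\<tau> | \<tau> permutes {..<n}. - (of_int (sign \<tau>) * F \<tau>))"
  proof (rule sum.cong[OF refl])
    fix \<tau> assume \<tau>: "\<tau> \<in> {\<tau>. \<tau> permutes {..<n}}"
    have perm: "permutation \<tau>" using \<tau> permutation_permutes by blast
    have "sign (\<tau> \<circ> ?t) = - sign \<tau>"
      unfolding sign_compose[OF perm permutation_swap_id] sign_swap_id using ab by simp
    moreover have "F (\<tau> \<circ> ?t) = F \<tau>" using F \<tau> by blast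
    ultimately show "of_int (sign (\<tau> \<circ> ?t)) * F (\<tau> \<circ> ?t) = - (of_int (sign \<tau>) * F \<tau>)"
      by simp
  qed
  finally show ?thesis by (simp add: sum_negf)
qed

text \<open>
  For \<open>h' l y\<close> the differential of a function \<open>h\<^sub>l\<close> at \<open>y\<close> this says that \<open>dh\<^sub>0 \<and> \<dots> \<and> dh\<^sub>k\<^sub>-\<^sub>1\<close> is closed:
  the terms of the product rule cancel in pairs because the second derivatives are symmetric.
\<close>

lemma wedge_derivative_closed:
  fixes h' :: "nat \<Rightarrow> complex^'n \<Rightarrow> complex^'n \<Rightarrow> complex"
  assumes diff: "\<And>l w. l < k \<Longrightarrow> (\<lambda>y. h' l y w) differentiable (at x)"
    and sym: "\<And>l v w. l < k \<Longrightarrow> wirtinger s v (\<lambda>y. h' l y w) x = wirtinger s w (\<lambda>y. h' l y v) x"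
  shows "(\<Sum>i\<le>k. (-1) ^ i * wirtinger s (v i) (\<lambda>y. wedge k (\<lambda>l. h' l y) (omit i v)) x) = 0"
proof -
  define T where "T m a u = wirtinger s a (\<lambda>y. h' m y (u m)) x * (\<Prod>l\<in>{..<k} - {m}. h' l x (u l))"
    for m a and u :: "nat \<Rightarrow> complex^'n"
  have W: "wirtinger s (v i) (\<lambda>y. wedge k (\<lambda>l. h' l y) (omit i v)) x =
      (\<Sum>m<k. \<Sum>\<sigma> | \<sigma> permutes {..<k}. of_int (sign \<sigma>) * T m (v i) (\<lambda>j. omit i v (\<sigma> j)))" for i
  proof -
    have d: "(\<lambda>y. \<Prod>l<k. h' l y (omit i v (\<sigma> l))) differentiable (at x)" for \<sigma>
      unfolding differentiable_def
      using has_derivative_prod[OF has_frechet_derivative[OF diff], of "{..<k}"] by fastforce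
    have prod: "wirtinger s (v i) (\<lambda>y. \<Prod>l<k. h' l y (omit i v (\<sigma> l))) x =
        (\<Sum>m<k. T m (v i) (\<lambda>j. omit i v (\<sigma> j)))" for \<sigma>
      unfolding T_def by (rule wirtinger_prod) (simp add: diff)
    have "wirtinger s (v i) (\<lambda>y. wedge k (\<lambda>l. h' l y) (omit i v)) x =
      (\<Sum>\<sigma> | \<sigma> permutes {..<k}. wirtinger s (v i) (\<lambda>y. of_int (sign \<sigma>) * (\<Prod>l<k. h' l y (omit i v (\<sigma> l)))) x)"
      unfolding wedge_def by (rule wirtinger_sum) (intro differentiable_mult differentiable_const d)
    also have "\<dots> = (\<Sum>\<sigma> | \<sigma> permutes {..<k}. of_int (sign \<sigma>) * (\<Sum>m<k. T m (v i) (\<lambda>j. omit i v (\<sigma> j))))"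
      unfolding wirtinger_cmult[OF d] prod ..
    also have "\<dots> = (\<Sum>m<k. \<Sum>\<sigma> | \<sigma> permutes {..<k}. of_int (sign \<sigma>) * T m (v i) (\<lambda>j. omit i v (\<sigma> j)))"
      unfolding sum_distrib_left by (rule sum.swap)
    finally show ?thesis .
  qed
  have "(\<Sum>i\<le>k. (-1) ^ i * wirtinger s (v i) (\<lambda>y. wedge k (\<lambda>l. h' l y) (omit i v)) x) =
      (\<Sum>m<k. \<Sum>i\<le>k. (-1) ^ i * (\<Sum>\<sigma> | \<sigma> permutes {..<k}. of_int (sign \<sigma>) * T m (v i) (\<lambda>j. omit i v (\<sigma> j))))"
    unfolding W sum_distrib_left by (rule sum.swap)
  also have "\<dots> = (\<Sum>m<k. \<Sum>\<tau> | \<tau> permutes {..<Suc k}. of_int (sign \<tau>) * T m (v (\<tau> 0)) (\<lambda>j. v (\<tau> (Suc j))))"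
    unfolding alternating_sum_omit ..
  also have "\<dots> = 0"
  proof (rule sum.neutral, rule ballI)
    fix m assume m: "m \<in> {..<k}"
    show "(\<Sum>\<tau> | \<tau> permutes {..<Suc k}. of_int (sign \<tau>) * T m (v (\<tau> 0)) (\<lambda>j. v (\<tau> (Suc j)))) = 0"
    proof (rule alternating_sum_eq_0[of 0 _ "Suc m"])
      fix \<tau> :: "nat \<Rightarrow> nat"
      let ?t = "Transposition.transpose 0 (Suc m)"
      have "(\<Prod>l\<in>{..<k} - {m}. h' l x (v ((\<tau> \<circ> ?t) (Suc l)))) = (\<Prod>l\<in>{..<k} - {m}. h' l x (v (\<tau> (Suc l))))"
        by (intro prod.cong) (auto simp: Transposition.transpose_def)
      then show "T m (v ((\<tau> \<circ> ?t) 0)) (\<lambda>j. v ((\<tau> \<circ> ?t) (Suc j))) = T m (v (\<tau> 0)) (\<lambda>j. v (\<tau> (Suc j)))"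
        using m sym by (simp add: T_def)
    qed (use m in auto)
  qed
  finally show ?thesis .
qed

lemma cdiff_on_wirtinger_bar:
  assumes "cdiff_on h U" "x \<in> U"
  shows "wirtinger \<i> v h x = 0"
  using assms by (simp add: cdiff_on_def wirtinger_def)

lemma cdiff_on_wirtinger:
  assumes "cdiff_on h U" "x \<in> U"
  shows "wirtinger (- \<i>) v h x = frechet_derivative h (at x) v"
  using assms by (simp add: cdiff_on_def wirtinger_def)

lemma wirtinger_cnj:
  assumes "f differentiable (at x)"
  shows "wirtinger s v (\<lambda>y. cnj (f y)) x = cnj (wirtinger (cnj s) v f x)"
  unfolding wirtinger_eqI[OF bounded_linear.has_derivative[OF bounded_linear_cnj has_frechet_derivative[OF assms]]]
  by (simp add: wirtinger_def)

lemma cdiff_on_wirtinger_symmetric: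
  fixes h :: "complex^'n \<Rightarrow> complex"
  assumes s: "s \<in> {\<i>, - \<i>}" and h: "cdiff_on h U" and U: "open U" "x \<in> U"
  shows "wirtinger s v (\<lambda>y. frechet_derivative h (at y) w) x =
    wirtinger s w (\<lambda>y. frechet_derivative h (at y) v) x"
proof -
  note dh = cdiff_on_frechet[OF h U(1)]
  show ?thesis
    using s cdiff_on_wirtinger_bar[OF dh U(2)] cdiff_on_wirtinger[OF dh U(2)]
      smooth_on_symmetric[OF U cdiff_on_smooth[OF h U(1)]] by auto
qed

lemma holo_onD:
  assumes "holo_on \<phi> U" "x \<in> U"
  shows "(\<phi> has_derivative frechet_derivative \<phi> (at x)) (at x)"
    and "frechet_derivative \<phi> (at x) (c *s v) = c *s frechet_derivative \<phi> (at x) v"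
proof -
  obtain D where D: "(\<phi> has_derivative D) (at x)" "Vector_Spaces.linear (*s) (*s) D"
    using assms unfolding holo_on_def by blast
  then show "(\<phi> has_derivative frechet_derivative \<phi> (at x)) (at x)"
    and "frechet_derivative \<phi> (at x) (c *s v) = c *s frechet_derivative \<phi> (at x) v"
    using frechet_derivative_eqI[OF D(1)] by (auto simp: vec.linear_scale)
qed

lemma clinear_bounded_linear:
  assumes "clinear (\<alpha> :: complex^'n \<Rightarrow> complex)"
  shows "bounded_linear \<alpha>"
  unfolding linear_conv_bounded_linear[symmetric]
  using assms by (intro linearI) (auto simp: clinear_iff scaleR_eq_vector_scale scaleR_conv_of_real[where 'a = complex])

lemma holo_on_clinear_cdiff:
  fixes \<phi> :: "complex^'n \<Rightarrow> complex^'m"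
  assumes \<phi>: "holo_on \<phi> U" and \<alpha>: "clinear \<alpha>"
  shows "cdiff_on (\<lambda>y. \<alpha> (\<phi> y)) U"
    and "y \<in> U \<Longrightarrow> frechet_derivative (\<lambda>y. \<alpha> (\<phi> y)) (at y) v = \<alpha> (frechet_derivative \<phi> (at y) v)"
proof -
  have D: "((\<lambda>y. \<alpha> (\<phi> y)) has_derivative (\<lambda>v. \<alpha> (frechet_derivative \<phi> (at y) v))) (at y)" if "y \<in> U" for y
    using holo_onD(1)[OF \<phi> that] by (rule bounded_linear.has_derivative[OF clinear_bounded_linear[OF \<alpha>]])
  show "y \<in> U \<Longrightarrow> frechet_derivative (\<lambda>y. \<alpha> (\<phi> y)) (at y) v = \<alpha> (frechet_derivative \<phi> (at y) v)"
    using frechet_derivative_eqI[OF D] by simp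
  show "cdiff_on (\<lambda>y. \<alpha> (\<phi> y)) U"
    using D frechet_derivative_eqI[OF D] holo_onD(2)[OF \<phi>] \<alpha>
    by (auto simp: cdiff_on_def differentiable_def clinear_iff)
qed

lemma holo_on_clinear_derivative:
  fixes \<phi> :: "complex^'n \<Rightarrow> complex^'m"
  assumes \<phi>: "holo_on \<phi> U" and U: "open U" "x \<in> U" and s: "s \<in> {\<i>, - \<i>}" and \<alpha>: "clinear \<alpha>"
  shows "(\<lambda>y. \<alpha> (frechet_derivative \<phi> (at y) w)) differentiable (at x)"
    and "wirtinger s v (\<lambda>y. \<alpha> (frechet_derivative \<phi> (at y) w)) x =
      wirtinger s w (\<lambda>y. \<alpha> (frechet_derivative \<phi> (at y) v)) x"
proof -
  note h = holo_on_clinear_cdiff[OF \<phi> \<alpha>]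
  note dh = cdiff_on_frechet[OF h(1) U(1)]
  show "(\<lambda>y. \<alpha> (frechet_derivative \<phi> (at y) w)) differentiable (at x)"
    using dh[of w] differentiable_cong_open[OF U h(2)] U(2) by (auto simp: cdiff_on_def)
  show "wirtinger s v (\<lambda>y. \<alpha> (frechet_derivative \<phi> (at y) w)) x =
      wirtinger s w (\<lambda>y. \<alpha> (frechet_derivative \<phi> (at y) v)) x"
  proof -
    have eq: "wirtinger s a (\<lambda>y. frechet_derivative (\<lambda>y. \<alpha> (\<phi> y)) (at y) b) x =
        wirtinger s a (\<lambda>y. \<alpha> (frechet_derivative \<phi> (at y) b)) x" for a b
      by (rule wirtinger_cong_open[OF U h(2)])
    show ?thesis using cdiff_on_wirtinger_symmetric[OF s h(1) U, of v w] unfolding eq .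
  qed
qed

lemma holo_on_conj_linear_derivative:
  fixes \<phi> :: "complex^'n \<Rightarrow> complex^'m"
  assumes \<phi>: "holo_on \<phi> U" and U: "open U" "x \<in> U" and s: "s \<in> {\<i>, - \<i>}" and \<alpha>: "conj_linear \<alpha>"
  shows "(\<lambda>y. \<alpha> (frechet_derivative \<phi> (at y) w)) differentiable (at x)"
    and "wirtinger s v (\<lambda>y. \<alpha> (frechet_derivative \<phi> (at y) w)) x =
      wirtinger s w (\<lambda>y. \<alpha> (frechet_derivative \<phi> (at y) v)) x"
proof -
  have s': "cnj s \<in> {\<i>, - \<i>}" using s by auto
  note h = holo_on_clinear_derivative[OF \<phi> U s' \<alpha>]
  have "(\<lambda>y. cnj (cnj (\<alpha> (frechet_derivative \<phi> (at y) w)))) differentiable (at x)"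
    unfolding differentiable_def
    using bounded_linear.has_derivative[OF bounded_linear_cnj has_frechet_derivative[OF h(1)]] by blast
  then show "(\<lambda>y. \<alpha> (frechet_derivative \<phi> (at y) w)) differentiable (at x)" by simp
  show "wirtinger s v (\<lambda>y. \<alpha> (frechet_derivative \<phi> (at y) w)) x =
      wirtinger s w (\<lambda>y. \<alpha> (frechet_derivative \<phi> (at y) v)) x"
    using wirtinger_cnj[OF h(1), of s v w] wirtinger_cnj[OF h(1), of s w v] h(2)[of v w] by simp
qed

lemma covectors_pullback_closed:
  fixes \<phi> :: "complex^'n \<Rightarrow> complex^'m"
  assumes \<phi>: "holo_on \<phi> U" and U: "open U" "x \<in> U" and s: "s \<in> {\<i>, - \<i>}"
    and \<eta>: "\<eta> \<in> covectors p q"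
  shows "(\<lambda>y. \<eta> (\<lambda>j. frechet_derivative \<phi> (at y) (u j))) differentiable (at x)"
    and "(\<Sum>i\<le>p + q. (-1) ^ i * wirtinger s (v i) (\<lambda>y. \<eta> (\<lambda>j. frechet_derivative \<phi> (at y) (omit i v j))) x) = 0"
proof -
  let ?P = "\<lambda>\<eta>. (\<forall>u. (\<lambda>y. \<eta> (\<lambda>j. frechet_derivative \<phi> (at y) (u j))) differentiable (at x)) \<and>
    (\<Sum>i\<le>p + q. (-1) ^ i * wirtinger s (v i) (\<lambda>y. \<eta> (\<lambda>j. frechet_derivative \<phi> (at y) (omit i v j))) x) = 0"
  have "?P \<eta>"
    using \<eta>
  proof (induction rule: covectors_induct)
    case zero
    then show ?case by simp
  next
    case (add c \<alpha> \<eta>)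
    define h' where "h' l y w = \<alpha> l (frechet_derivative \<phi> (at y) w)" for l y w
    have h': "(\<lambda>y. h' l y w) differentiable (at x) \<and>
        wirtinger s v (\<lambda>y. h' l y w) x = wirtinger s w (\<lambda>y. h' l y v) x" if "l < p + q" for l v w
      unfolding h'_def
      using that add(1,2) holo_on_clinear_derivative[OF \<phi> U s] holo_on_conj_linear_derivative[OF \<phi> U s]
      by (cases "l < p") (auto simp del: vec.linear_scale)
    have W: "wedge (p + q) \<alpha> (\<lambda>j. frechet_derivative \<phi> (at y) (u j)) = wedge (p + q) (\<lambda>l. h' l y) u" for y u
      by (simp add: wedge_def h'_def)
    have d: "(\<lambda>y. wedge (p + q) (\<lambda>l. h' l y) u) differentiable (at x)" for u
    proof -
      have "(\<lambda>y. \<Prod>i<p + q. h' i y (u (\<sigma> i))) differentiable (at x)" for \<sigma>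
        unfolding differentiable_def
        using has_derivative_prod[OF has_frechet_derivative, of "{..<p + q}" "\<lambda>i y. h' i y (u (\<sigma> i))"] h'
        by fastforce
      then show ?thesis
        unfolding wedge_def
        by (intro differentiable_sum differentiable_mult differentiable_const ballI
            finite_permutations finite_lessThan)
    qed
    note d' = add(3)[THEN conjunct1, rule_format]
    have closed: "(\<Sum>i\<le>p + q. (-1) ^ i * wirtinger s (v i) (\<lambda>y. wedge (p + q) (\<lambda>l. h' l y) (omit i v)) x) = 0"
      using h' by (intro wedge_derivative_closed) auto
    have cd: "(\<lambda>y. c * wedge (p + q) (\<lambda>l. h' l y) u) differentiable (at x)" for u
      using d by (intro differentiable_mult differentiable_const)
    show ?case unfolding W
    proof (intro conjI allI)
      show "(\<lambda>y. c * wedge (p + q) (\<lambda>l. h' l y) u + \<eta> (\<lambda>j. frechet_derivative \<phi> (at y) (u j)))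
          differentiable (at x)" for u
        using cd d' by (intro differentiable_add)
      have "(\<Sum>i\<le>p + q. (-1) ^ i * wirtinger s (v i) (\<lambda>y. c * wedge (p + q) (\<lambda>l. h' l y) (omit i v) +
            \<eta> (\<lambda>j. frechet_derivative \<phi> (at y) (omit i v j))) x) =
          c * (\<Sum>i\<le>p + q. (-1) ^ i * wirtinger s (v i) (\<lambda>y. wedge (p + q) (\<lambda>l. h' l y) (omit i v)) x) +
          (\<Sum>i\<le>p + q. (-1) ^ i * wirtinger s (v i) (\<lambda>y. \<eta> (\<lambda>j. frechet_derivative \<phi> (at y) (omit i v j))) x)"
        unfolding wirtinger_add[OF cd d'] wirtinger_cmult[OF d] sum_distrib_left sum.distrib[symmetric]
        by (intro sum.cong refl) (simp add: algebra_simps)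
      also have "\<dots> = 0" using closed add(3) by simp
      finally show "(\<Sum>i\<le>p + q. (-1) ^ i * wirtinger s (v i) (\<lambda>y. c * wedge (p + q) (\<lambda>l. h' l y) (omit i v) +
            \<eta> (\<lambda>j. frechet_derivative \<phi> (at y) (omit i v j))) x) = 0" .
    qed
  qed
  then show "(\<lambda>y. \<eta> (\<lambda>j. frechet_derivative \<phi> (at y) (u j))) differentiable (at x)"
    and "(\<Sum>i\<le>p + q. (-1) ^ i * wirtinger s (v i) (\<lambda>y. \<eta> (\<lambda>j. frechet_derivative \<phi> (at y) (omit i v j))) x) = 0"
    by blast+
qed

section \<open>Bidegrees and anticommutation\<close>

lemma complex_manifold_charts:
  assumes "complex_manifold X A" "c \<in> A"
  shows "openin X (fst c)" "open (chart_image c)"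
    "homeomorphic_map (subtopology X (fst c)) (top_of_set (chart_image c)) (snd c)"
    "d \<in> A \<Longrightarrow> holo_on (transition c d) (transition_dom c d)"
  using assms by (auto simp: complex_manifold_def)

lemma transition_dom_props:
  assumes X: "complex_manifold X A" and c: "c \<in> A" and d: "d \<in> A"
  shows "open (transition_dom c d)" "transition_dom c d \<subseteq> chart_image c"
    "x \<in> transition_dom c d \<Longrightarrow> transition c d x \<in> chart_image d"
proof -
  note C = complex_manifold_charts[OF X c] and D = complex_manifold_charts[OF X d]
  have "openin (subtopology X (fst c)) (fst c \<inter> fst d)"
    using D(1) by (auto simp: openin_subtopology)
  then have "openin (top_of_set (chart_image c)) (transition_dom c d)"
    using homeomorphic_imp_open_map[OF C(3)] unfolding open_map_def transition_dom_def by blast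
  then show "open (transition_dom c d)" using C(2) openin_open_eq by blast
  show "transition_dom c d \<subseteq> chart_image c" by (auto simp: transition_dom_def chart_image_def)
  show "transition c d x \<in> chart_image d" if x: "x \<in> transition_dom c d"
  proof -
    obtain a where a: "a \<in> fst c" "a \<in> fst d" "x = snd c a" using x by (auto simp: transition_dom_def)
    have "inj_on (snd c) (topspace (subtopology X (fst c)))"
      using homeomorphic_imp_injective_map[OF C(3)] .
    then have "inj_on (snd c) (fst c)" using openin_subset[OF C(1)] by (simp add: Int_absorb1)
    then have "transition c d x = snd d a" using a by (simp add: transition_def)
    then show ?thesis using a by (simp add: chart_image_def)
  qed
qed

definition gdel :: "complex \<Rightarrow> ('a, 'n::finite) chart set \<Rightarrow> nat \<Rightarrow> ('a, 'n) form \<Rightarrow> ('a, 'n) form" where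
  "gdel s A k \<omega> = (\<lambda>c x v.
     if c \<in> A \<and> x \<in> chart_image c
     then \<Sum>i\<le>k. (-1) ^ i * wirtinger s (v i) (\<lambda>y. \<omega> c y (omit i v)) x else 0)"

lemma del_eq_gdel: "del A p q = gdel (- \<i>) A (nat (p + q))"
  and delbar_eq_gdel: "delbar A p q = gdel \<i> A (nat (p + q))"
  unfolding del_def delbar_def gdel_def wirt_eq_wirtinger by ((rule ext)+, rule refl)+

definition smooth_form :: "('a, 'n::finite) chart set \<Rightarrow> ('a, 'n) form \<Rightarrow> bool" where
  "smooth_form A \<omega> \<longleftrightarrow> (\<forall>c\<in>A. \<forall>v. smooth_on (\<lambda>x. \<omega> c x v) (chart_image c))"

lemma forms_smooth: "\<omega> \<in> forms A p q \<Longrightarrow> smooth_form A \<omega>"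
  by (auto simp: forms_def smooth_form_def smooth_on_const split: if_splits)

lemma forms_zero: "(\<lambda>c x v. 0) \<in> forms A p q"
  by (simp add: forms_def smooth_on_const covectors_zero)

context
  fixes X :: "'a topology" and A :: "('a, 'n::finite) chart set"
  assumes X: "complex_manifold X A"
begin

lemma chart_open: "c \<in> A \<Longrightarrow> open (chart_image c)"
  using complex_manifold_charts[OF X] by blast

lemma smooth_formD:
  assumes "smooth_form A \<omega>" "c \<in> A"
  shows "smooth_on (\<lambda>x. \<omega> c x v) (chart_image c)"
    and "x \<in> chart_image c \<Longrightarrow> (\<lambda>x. \<omega> c x v) differentiable (at x)"
proof -
  show sm: "smooth_on (\<lambda>x. \<omega> c x v) (chart_image c)"
    using assms by (simp add: smooth_form_def)
  show "x \<in> chart_image c \<Longrightarrow> (\<lambda>x. \<omega> c x v) differentiable (at x)"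
    by (rule smooth_onD(1)[OF sm])
qed

lemma gdel_smooth:
  assumes "smooth_form A \<omega>"
  shows "smooth_form A (gdel s A k \<omega>)"
  unfolding smooth_form_def
proof (intro ballI allI)
  fix c v assume c: "c \<in> A"
  show "smooth_on (\<lambda>x. gdel s A k \<omega> c x v) (chart_image c)"
  proof (rule smooth_on_cong[OF chart_open[OF c]])
    show "smooth_on (\<lambda>x. \<Sum>i\<le>k. (-1) ^ i * wirtinger s (v i) (\<lambda>y. \<omega> c y (omit i v)) x) (chart_image c)"
      by (intro smooth_on_sum smooth_on_cmult smooth_on_wirtinger chart_open c smooth_formD[OF assms])
  qed (simp add: gdel_def c)
qed

lemma gdel_add:
  assumes "smooth_form A \<omega>" "smooth_form A \<eta>"
  shows "gdel s A k (\<lambda>c x v. \<omega> c x v + \<eta> c x v) = (\<lambda>c x v. gdel s A k \<omega> c x v + gdel s A k \<eta> c x v)"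
  using smooth_formD(2)[OF assms(1)] smooth_formD(2)[OF assms(2)]
  by (auto simp: gdel_def fun_eq_iff wirtinger_add distrib_left sum.distrib)

lemma gdel_scale:
  assumes "smooth_form A \<omega>"
  shows "gdel s A k (\<lambda>c x v. a * \<omega> c x v) = (\<lambda>c x v. a * gdel s A k \<omega> c x v)"
  using smooth_formD(2)[OF assms]
  by (auto simp: gdel_def fun_eq_iff wirtinger_cmult sum_distrib_left mult_ac)

lemma gdel_zero: "gdel s A k (\<lambda>c x v. 0) = (\<lambda>c x v. 0)"
  by (simp add: gdel_def fun_eq_iff)

lemma gdel_covectors:
  assumes s: "s \<in> {\<i>, - \<i>}" and \<omega>: "smooth_form A \<omega>" and c: "c \<in> A"
    and cov: "\<And>y. y \<in> chart_image c \<Longrightarrow> \<omega> c y \<in> covectors p q"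
    and x: "x \<in> chart_image c"
  shows "gdel s A (p + q) \<omega> c x \<in> (if s = \<i> then covectors p (Suc q) else covectors (Suc p) q)"
proof -
  obtain U and g :: "(nat \<Rightarrow> complex^'n) \<Rightarrow> (nat \<Rightarrow> complex^'n) \<Rightarrow> complex"
    where U: "finite U" and g: "\<And>u. u \<in> U \<Longrightarrow> g u \<in> covectors p q"
    and interp: "\<And>\<eta> v. \<eta> \<in> covectors p q \<Longrightarrow> \<eta> v = (\<Sum>u\<in>U. \<eta> u * g u v)"
    by (rule covectors_interpolation[where p = p and q = q]) (rule that, assumption+)
  note d = smooth_formD(2)[OF \<omega> c x]
  have "gdel s A (p + q) \<omega> c x v =
      (\<Sum>u\<in>U. \<Sum>i\<le>p + q. (-1) ^ i * (wirtinger s (v i) (\<lambda>y. \<omega> c y u) x * g u (omit i v)))" for v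
  proof -
    have "wirtinger s (v i) (\<lambda>y. \<omega> c y (omit i v)) x =
        (\<Sum>u\<in>U. wirtinger s (v i) (\<lambda>y. \<omega> c y u) x * g u (omit i v))" for i
    proof -
      have "wirtinger s (v i) (\<lambda>y. \<omega> c y (omit i v)) x =
          wirtinger s (v i) (\<lambda>y. \<Sum>u\<in>U. \<omega> c y u * g u (omit i v)) x"
        by (rule wirtinger_cong_open[OF chart_open[OF c] x]) (rule interp[OF cov])
      also have "\<dots> = (\<Sum>u\<in>U. wirtinger s (v i) (\<lambda>y. \<omega> c y u * g u (omit i v)) x)"
        by (intro wirtinger_sum differentiable_mult differentiable_const d)
      finally show ?thesis unfolding wirtinger_cmult_right[OF d] .
    qed
    then show ?thesis
      using c x by (simp add: gdel_def sum_distrib_left sum.swap[of _ U])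
  qed
  then have eq: "gdel s A (p + q) \<omega> c x =
      (\<lambda>v. \<Sum>u\<in>U. \<Sum>i\<le>p + q. (-1) ^ i * (wirtinger s (v i) (\<lambda>y. \<omega> c y u) x * g u (omit i v)))"
    by (rule ext)
  show ?thesis
  proof (cases "s = \<i>")
    case True
    have "(\<lambda>v. \<Sum>i\<le>p + q. (-1) ^ i * (wirtinger s (v i) (\<lambda>y. \<omega> c y u) x * g u (omit i v)))
        \<in> covectors p (Suc q)" if "u \<in> U" for u
      unfolding True by (rule wedge_conj_linear_covectors[OF clinear_wirtinger(2)[OF d] g[OF that]])
    then show ?thesis
      unfolding eq if_P[OF True] by (rule covectors_sum)
  next
    case False
    then have s: "s = - \<i>" using s by simp
    have "(\<lambda>v. \<Sum>i\<le>p + q. (-1) ^ i * (wirtinger s (v i) (\<lambda>y. \<omega> c y u) x * g u (omit i v)))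
        \<in> covectors (Suc p) q" if "u \<in> U" for u
      unfolding s by (rule wedge_clinear_covectors[OF clinear_wirtinger(1)[OF d] g[OF that]])
    then show ?thesis
      unfolding eq if_not_P[OF False] by (rule covectors_sum)
  qed
qed

lemma gdel_pullback:
  assumes s: "s \<in> {\<i>, - \<i>}" and \<omega>: "smooth_form A \<omega>" and c: "c \<in> A" and d: "d \<in> A"
    and cov: "\<And>y. y \<in> chart_image d \<Longrightarrow> \<omega> d y \<in> covectors p q"
    and pull: "\<And>y v. y \<in> transition_dom c d \<Longrightarrow>
      \<omega> c y v = \<omega> d (transition c d y) (\<lambda>i. frechet_derivative (transition c d) (at y) (v i))"
    and x: "x \<in> transition_dom c d"
  shows "gdel s A (p + q) \<omega> c x v =
    gdel s A (p + q) \<omega> d (transition c d x) (\<lambda>i. frechet_derivative (transition c d) (at x) (v i))"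
proof -
  let ?T = "transition_dom c d"
  define \<phi> where "\<phi> = transition c d"
  define \<phi>' where "\<phi>' y = frechet_derivative \<phi> (at y)" for y
  define w where "w i = \<phi>' x (v i)" for i
  note T = transition_dom_props[OF X c d]
  have holo: "holo_on \<phi> ?T" unfolding \<phi>_def using complex_manifold_charts(4)[OF X c d] .
  obtain U and g :: "(nat \<Rightarrow> complex^'n) \<Rightarrow> (nat \<Rightarrow> complex^'n) \<Rightarrow> complex"
    where U: "finite U" and g: "\<And>u. u \<in> U \<Longrightarrow> g u \<in> covectors p q"
    and interp: "\<And>\<eta> v. \<eta> \<in> covectors p q \<Longrightarrow> \<eta> v = (\<Sum>u\<in>U. \<eta> u * g u v)"
    by (rule covectors_interpolation[where p = p and q = q]) (rule that, assumption+)
  have \<phi>x: "\<phi> x \<in> chart_image d" using T(3)[OF x] by (simp add: \<phi>_def)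
  have xc: "x \<in> chart_image c" using T(2) x by auto
  note D = smooth_formD(2)[OF \<omega> d \<phi>x]
  note \<phi>_deriv = holo_onD(1)[OF holo x] and \<phi>_lin = holo_onD(2)[OF holo x]
  have D\<phi>: "(\<lambda>y. \<omega> d (\<phi> y) u) differentiable (at x)" for u
    unfolding differentiable_def
    using has_derivative_compose[OF \<phi>_deriv has_frechet_derivative[OF D]] by blast
  have G: "(\<lambda>y. g u (\<lambda>j. \<phi>' y (z j))) differentiable (at x)"
    and G0: "(\<Sum>i\<le>p + q. (-1) ^ i * wirtinger s (v i) (\<lambda>y. g u (\<lambda>j. \<phi>' y (omit i v j))) x) = 0"
    if "u \<in> U" for u z
    using covectors_pullback_closed[OF holo T(1) x s g[OF that]] by (simp_all add: \<phi>'_def)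
  have W: "wirtinger s (v i) (\<lambda>y. \<omega> c y (omit i v)) x =
      (\<Sum>u\<in>U. wirtinger s (w i) (\<lambda>y. \<omega> d y u) (\<phi> x) * g u (omit i w) +
        \<omega> d (\<phi> x) u * wirtinger s (v i) (\<lambda>y. g u (\<lambda>j. \<phi>' y (omit i v j))) x)" for i
  proof -
    have "wirtinger s (v i) (\<lambda>y. \<omega> c y (omit i v)) x =
        wirtinger s (v i) (\<lambda>y. \<Sum>u\<in>U. \<omega> d (\<phi> y) u * g u (\<lambda>j. \<phi>' y (omit i v j))) x"
    proof (rule wirtinger_cong_open[OF T(1) x])
      fix y assume y: "y \<in> ?T"
      show "\<omega> c y (omit i v) = (\<Sum>u\<in>U. \<omega> d (\<phi> y) u * g u (\<lambda>j. \<phi>' y (omit i v j)))"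
        unfolding pull[OF y] \<phi>'_def \<phi>_def by (rule interp[OF cov[OF T(3)[OF y]]])
    qed
    also have "\<dots> = (\<Sum>u\<in>U. wirtinger s (v i) (\<lambda>y. \<omega> d (\<phi> y) u * g u (\<lambda>j. \<phi>' y (omit i v j))) x)"
      using D\<phi> G by (intro wirtinger_sum differentiable_mult)
    also have "\<dots> = (\<Sum>u\<in>U. wirtinger s (w i) (\<lambda>y. \<omega> d y u) (\<phi> x) * g u (omit i w) +
        \<omega> d (\<phi> x) u * wirtinger s (v i) (\<lambda>y. g u (\<lambda>j. \<phi>' y (omit i v j))) x)"
    proof (rule sum.cong[OF refl])
      fix u assume u: "u \<in> U"
      have "(\<lambda>j. \<phi>' x (omit i v j)) = omit i w" by (simp add: omit_def w_def fun_eq_iff)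
      moreover have "wirtinger s (v i) (\<lambda>y. \<omega> d (\<phi> y) u) x = wirtinger s (w i) (\<lambda>y. \<omega> d y u) (\<phi> x)"
        unfolding w_def \<phi>'_def by (rule wirtinger_compose[OF D \<phi>_deriv \<phi>_lin])
      ultimately show "wirtinger s (v i) (\<lambda>y. \<omega> d (\<phi> y) u * g u (\<lambda>j. \<phi>' y (omit i v j))) x =
          wirtinger s (w i) (\<lambda>y. \<omega> d y u) (\<phi> x) * g u (omit i w) +
          \<omega> d (\<phi> x) u * wirtinger s (v i) (\<lambda>y. g u (\<lambda>j. \<phi>' y (omit i v j))) x"
        unfolding wirtinger_mult[OF D\<phi> G[OF u]] by simp
    qed
    finally show ?thesis .
  qed
  have W': "wirtinger s (w i) (\<lambda>y. \<omega> d y (omit i w)) (\<phi> x) =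
      (\<Sum>u\<in>U. wirtinger s (w i) (\<lambda>y. \<omega> d y u) (\<phi> x) * g u (omit i w))" for i
  proof -
    have "wirtinger s (w i) (\<lambda>y. \<omega> d y (omit i w)) (\<phi> x) =
        wirtinger s (w i) (\<lambda>y. \<Sum>u\<in>U. \<omega> d y u * g u (omit i w)) (\<phi> x)"
      by (rule wirtinger_cong_open[OF chart_open[OF d] \<phi>x]) (rule interp[OF cov])
    also have "\<dots> = (\<Sum>u\<in>U. wirtinger s (w i) (\<lambda>y. \<omega> d y u * g u (omit i w)) (\<phi> x))"
      by (intro wirtinger_sum differentiable_mult differentiable_const D)
    finally show ?thesis unfolding wirtinger_cmult_right[OF D] .
  qed
  have "gdel s A (p + q) \<omega> c x v = (\<Sum>i\<le>p + q. (-1) ^ i * wirtinger s (v i) (\<lambda>y. \<omega> c y (omit i v)) x)"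
    using c xc by (simp add: gdel_def)
  also have "\<dots> = (\<Sum>i\<le>p + q. (-1) ^ i * wirtinger s (w i) (\<lambda>y. \<omega> d y (omit i w)) (\<phi> x)) +
      (\<Sum>i\<le>p + q. \<Sum>u\<in>U. (-1) ^ i * (\<omega> d (\<phi> x) u * wirtinger s (v i) (\<lambda>y. g u (\<lambda>j. \<phi>' y (omit i v j))) x))"
    unfolding W W' by (simp only: sum.distrib distrib_left sum_distrib_left)
  also have "(\<Sum>i\<le>p + q. \<Sum>u\<in>U. (-1) ^ i * (\<omega> d (\<phi> x) u * wirtinger s (v i) (\<lambda>y. g u (\<lambda>j. \<phi>' y (omit i v j))) x)) =
      (\<Sum>u\<in>U. \<omega> d (\<phi> x) u * (\<Sum>i\<le>p + q. (-1) ^ i * wirtinger s (v i) (\<lambda>y. g u (\<lambda>j. \<phi>' y (omit i v j))) x))"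
    by (subst sum.swap) (simp only: sum_distrib_left mult.left_commute)
  also have "\<dots> = 0" by (rule sum.neutral) (simp add: G0)
  also have "(\<Sum>i\<le>p + q. (-1) ^ i * wirtinger s (w i) (\<lambda>y. \<omega> d y (omit i w)) (\<phi> x)) + 0 =
      gdel s A (p + q) \<omega> d (\<phi> x) w"
    using d \<phi>x by (simp add: gdel_def)
  finally show ?thesis by (simp add: \<phi>_def \<phi>'_def w_def[abs_def])
qed

lemma gdel_forms:
  assumes s: "s \<in> {\<i>, - \<i>}" and \<omega>: "\<omega> \<in> forms A p q"
  shows "gdel s A (nat (p + q)) \<omega> \<in> (if s = \<i> then forms A p (q + 1) else forms A (p + 1) q)"
proof (cases "0 \<le> p \<and> 0 \<le> q")
  case False
  then have "\<omega> = (\<lambda>c x v. 0)" using \<omega> by (auto simp: forms_def)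
  then show ?thesis by (simp add: gdel_zero forms_zero)
next
  case True
  have sm: "smooth_form A \<omega>" using \<omega> by (rule forms_smooth)
  have k: "nat (p + q) = nat p + nat q" using True by (simp add: nat_add_distrib)
  have cov: "\<And>c y. c \<in> A \<Longrightarrow> y \<in> chart_image c \<Longrightarrow> \<omega> c y \<in> covectors (nat p) (nat q)"
    and pull: "\<And>c d x v. c \<in> A \<Longrightarrow> d \<in> A \<Longrightarrow> x \<in> transition_dom c d \<Longrightarrow>
      \<omega> c x v = \<omega> d (transition c d x) (\<lambda>i. frechet_derivative (transition c d) (at x) (v i))"
    using \<omega> True by (simp_all add: forms_def)
  have 1: "\<forall>c x. \<not> (c \<in> A \<and> x \<in> chart_image c) \<longrightarrow> gdel s A (nat (p + q)) \<omega> c x = (\<lambda>v. 0)"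
    by (auto simp: gdel_def)
  have 2: "\<forall>c\<in>A. \<forall>v. smooth_on (\<lambda>x. gdel s A (nat (p + q)) \<omega> c x v) (chart_image c)"
    using gdel_smooth[OF sm] by (simp add: smooth_form_def)
  have 3: "\<forall>c\<in>A. \<forall>x\<in>chart_image c. gdel s A (nat (p + q)) \<omega> c x \<in>
      (if s = \<i> then covectors (nat p) (Suc (nat q)) else covectors (Suc (nat p)) (nat q))"
    unfolding k using gdel_covectors[OF s sm _ cov] by blast
  have 4: "\<forall>c\<in>A. \<forall>d\<in>A. \<forall>x\<in>transition_dom c d. \<forall>v. gdel s A (nat (p + q)) \<omega> c x v =
      gdel s A (nat (p + q)) \<omega> d (transition c d x) (\<lambda>i. frechet_derivative (transition c d) (at x) (v i))"
    unfolding k using gdel_pullback[OF s sm _ _ cov pull] by blast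
  show ?thesis
  proof (cases "s = \<i>")
    case s: True
    have "nat (q + 1) = Suc (nat q)" using True by arith
    then show ?thesis using True s 1 2 3 4 by (simp add: forms_def)
  next
    case s: False
    have "nat (p + 1) = Suc (nat p)" using True by arith
    then show ?thesis using True s 1 2 3 4 by (simp add: forms_def)
  qed
qed

end

lemma omit_omit: "i \<le> j \<Longrightarrow> omit j (omit i v) = omit i (omit (Suc j) v)"
  by (auto simp: omit_def fun_eq_iff)

lemma double_omit_sum:
  fixes F G :: "'e \<Rightarrow> 'e \<Rightarrow> (nat \<Rightarrow> 'e) \<Rightarrow> complex"
  assumes FG: "\<And>a b u. F a b u = G b a u"
  shows "(\<Sum>i\<le>Suc k. \<Sum>j\<le>k. (-1) ^ i * ((-1) ^ j * (F (v i) (omit i v j) (omit j (omit i v)) +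
    G (v i) (omit i v j) (omit j (omit i v))))) = 0"
proof -
  define H where "H i j = (-1) ^ i * ((-1) ^ j * (F (v i) (omit i v j) (omit j (omit i v)) +
    G (v i) (omit i v j) (omit j (omit i v))))" for i j
  have cancel: "H (Suc j) i = - H i j" if "i \<le> j" for i j
    using that unfolding H_def omit_omit[OF that] FG by (simp add: omit_def algebra_simps)
  have "(\<Sum>i\<le>Suc k. \<Sum>j\<le>k. H i j) = (\<Sum>(i, j)\<in>{..Suc k} \<times> {..k}. H i j)"
    by (simp add: sum.cartesian_product)
  also have "{..Suc k} \<times> {..k} = {(i, j). i \<le> j \<and> j \<le> k} \<union> {(i, j). j < i \<and> i \<le> Suc k}"
    by auto
  also have "(\<Sum>(i, j)\<in>\<dots>. H i j) = (\<Sum>(i, j)\<in>{(i, j). i \<le> j \<and> j \<le> k}. H i j) +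
      (\<Sum>(i, j)\<in>{(i, j). j < i \<and> i \<le> Suc k}. H i j)"
    by (rule sum.union_disjoint)
      (auto intro: finite_subset[of _ "{..Suc k} \<times> {..Suc k}"])
  also have "(\<Sum>(i, j)\<in>{(i, j). j < i \<and> i \<le> Suc k}. H i j) =
      (\<Sum>(i, j)\<in>{(i, j). i \<le> j \<and> j \<le> k}. - H i j)"
    by (rule sum.reindex_bij_witness[of _ "\<lambda>(i, j). (Suc j, i)" "\<lambda>(i, j). (j, i - 1)"])
      (auto simp: cancel[symmetric])
  also have "(\<Sum>(i, j)\<in>{(i, j). i \<le> j \<and> j \<le> k}. H i j) + \<dots> = 0"
    by (simp add: sum_negf case_prod_unfold)
  finally show ?thesis by (simp add: H_def)
qed

lemma gdel_anticommute:
  assumes X: "complex_manifold X A" and \<omega>: "smooth_form A \<omega>"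
  shows "gdel s A (Suc k) (gdel t A k \<omega>) c x v = - gdel t A (Suc k) (gdel s A k \<omega>) c x v"
proof (cases "c \<in> A \<and> x \<in> chart_image c")
  case False
  then show ?thesis by (auto simp: gdel_def)
next
  case True
  note sm = smooth_formD(1)[OF X \<omega> conjunct1[OF True]]
  note op = chart_open[OF X conjunct1[OF True]]
  define W where "W s t a b u = wirtinger s a (wirtinger t b (\<lambda>z. \<omega> c z u)) x" for s t a b u
  have expand: "gdel s A (Suc k) (gdel t A k \<omega>) c x v =
      (\<Sum>i\<le>Suc k. \<Sum>j\<le>k. (-1) ^ i * ((-1) ^ j * W s t (v i) (omit i v j) (omit j (omit i v))))" for s t
  proof -
    have "wirtinger s (v i) (\<lambda>y. gdel t A k \<omega> c y (omit i v)) x =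
        (\<Sum>j\<le>k. (-1) ^ j * W s t (v i) (omit i v j) (omit j (omit i v)))" for i
    proof -
      have d: "(wirtinger t b (\<lambda>z. \<omega> c z u)) differentiable (at x)" for b u
        using smooth_onD(1)[OF smooth_on_wirtinger[OF op sm]] True by blast
      have "wirtinger s (v i) (\<lambda>y. gdel t A k \<omega> c y (omit i v)) x = wirtinger s (v i)
          (\<lambda>y. \<Sum>j\<le>k. (-1) ^ j * wirtinger t (omit i v j) (\<lambda>z. \<omega> c z (omit j (omit i v))) y) x"
        by (rule wirtinger_cong_open[OF op conjunct2[OF True]]) (simp add: gdel_def True)
      also have "\<dots> = (\<Sum>j\<le>k. wirtinger s (v i)
          (\<lambda>y. (-1) ^ j * wirtinger t (omit i v j) (\<lambda>z. \<omega> c z (omit j (omit i v))) y) x)"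
        by (intro wirtinger_sum differentiable_mult differentiable_const d)
      finally show ?thesis unfolding wirtinger_cmult[OF d] W_def .
    qed
    then show ?thesis using True by (simp only: gdel_def[of s] simp_thms if_True sum_distrib_left)
  qed
  have "W s t a b u = W t s b a u" for a b u
    unfolding W_def by (rule wirtinger_commute[OF op _ sm]) (use True in simp)
  from double_omit_sum[of "W s t" "W t s", OF this, where k = k and v = v]
  have "gdel s A (Suc k) (gdel t A k \<omega>) c x v + gdel t A (Suc k) (gdel s A k \<omega>) c x v = 0"
    unfolding expand sum.distrib[symmetric] distrib_left .
  then show ?thesis by (simp add: eq_neg_iff_add_eq_0)
qed

section \<open>The two quotients\<close>

abbreviation scale_form :: "complex \<Rightarrow> ('a, 'n::finite) form \<Rightarrow> ('a, 'n) form" where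
  "scale_form a \<omega> \<equiv> \<lambda>c x v. a * \<omega> c x v"

lemma form_space_simps [simp]:
  "carrier (form_space A p q) = forms A p q" "zero (form_space A p q) = 0"
  "add (form_space A p q) = (+)" "smult (form_space A p q) = scale_form"
  by (simp_all add: form_space_def fun_eq_iff)

lemma zero_form: "(\<lambda>c x v. 0) = (0 :: ('a, 'n::finite) form)"
  by (simp add: fun_eq_iff)

lemma set_add_memI: "x \<in> V \<Longrightarrow> y \<in> W \<Longrightarrow> x \<oplus>\<^bsub>M\<^esub> y \<in> V <+>\<^bsub>M\<^esub> W"
  by (auto simp: set_add_def')

definition linear_on_forms ::
  "('a, 'n::finite) chart set \<Rightarrow> int \<Rightarrow> int \<Rightarrow> (('a, 'n) form \<Rightarrow> ('a, 'n) form) \<Rightarrow> bool" where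
  "linear_on_forms A p q T \<longleftrightarrow>
     (\<forall>\<omega>\<in>forms A p q. \<forall>\<eta>\<in>forms A p q. T (\<omega> + \<eta>) = T \<omega> + T \<eta>) \<and>
     (\<forall>a. \<forall>\<omega>\<in>forms A p q. T (scale_form a \<omega>) = scale_form a (T \<omega>))"

context
  fixes X :: "'a topology" and A :: "('a, 'n::finite) chart set"
  assumes X: "complex_manifold X A"
begin

lemma forms_add:
  assumes "\<omega> \<in> forms A p q" "\<eta> \<in> forms A p q"
  shows "\<omega> + \<eta> \<in> forms A p q"
proof (cases "0 \<le> p \<and> 0 \<le> q")
  case True
  have "smooth_on (\<lambda>x. \<omega> c x v + \<eta> c x v) (chart_image c)" if "c \<in> A" for c v
    using smooth_formD(1)[OF X] forms_smooth assms that by (intro smooth_on_add chart_open[OF X]) blast+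
  moreover have "\<omega> c x + \<eta> c x \<in> covectors (nat p) (nat q)" if "c \<in> A" "x \<in> chart_image c" for c x
    using covectors_add[of "\<omega> c x" "nat p" "nat q" "\<eta> c x"] assms True that
    by (simp add: forms_def plus_fun_def)
  ultimately show ?thesis using assms True
    by (simp add: forms_def zero_fun_def plus_fun_def del: split_paired_All)
next
  case False
  then show ?thesis using assms by (auto simp: forms_def fun_eq_iff)
qed

lemma forms_scale:
  assumes "\<omega> \<in> forms A p q"
  shows "scale_form a \<omega> \<in> forms A p q"
proof (cases "0 \<le> p \<and> 0 \<le> q")
  case True
  have "smooth_on (\<lambda>x. a * \<omega> c x v) (chart_image c)" if "c \<in> A" for c v
    using smooth_formD(1)[OF X] forms_smooth assms that by (intro smooth_on_cmult chart_open[OF X]) blast+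
  moreover have "(\<lambda>v. a * \<omega> c x v) \<in> covectors (nat p) (nat q)" if "c \<in> A" "x \<in> chart_image c" for c x
    using covectors_scale[of "\<omega> c x" "nat p" "nat q" a] assms True that by (simp add: forms_def)
  ultimately show ?thesis using assms True
    by (simp add: forms_def del: split_paired_All)
next
  case False
  then show ?thesis using assms by (auto simp: forms_def fun_eq_iff)
qed

lemma forms_0: "0 \<in> forms A p q"
  using forms_zero by (simp only: zero_form)

lemma forms_uminus:
  assumes "\<omega> \<in> forms A p q"
  shows "- \<omega> \<in> forms A p q"
proof -
  have "- \<omega> = scale_form (-1) \<omega>" by (simp add: fun_eq_iff)
  then show ?thesis using forms_scale[OF assms, of "-1"] by simp
qed

lemma cvec_form_space: "cvec (form_space A p q)"
proof (rule cvecI)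
  show "abelian_group (form_space A p q)"
  proof (rule abelian_groupI)
    show "\<exists>\<eta>\<in>carrier (form_space A p q). \<eta> \<oplus>\<^bsub>form_space A p q\<^esub> \<omega> = \<zero>\<^bsub>form_space A p q\<^esub>"
      if "\<omega> \<in> carrier (form_space A p q)" for \<omega>
      using that forms_uminus by (intro bexI[of _ "- \<omega>"]) auto
  qed (simp_all add: forms_add forms_0 add_ac)
next
  fix a b and \<omega> \<eta> :: "('a, 'n) form"
  show "(a + b) \<odot>\<^bsub>form_space A p q\<^esub> \<omega> =
      a \<odot>\<^bsub>form_space A p q\<^esub> \<omega> \<oplus>\<^bsub>form_space A p q\<^esub> b \<odot>\<^bsub>form_space A p q\<^esub> \<omega>"
    unfolding form_space_simps by (intro ext) (simp add: distrib_right)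
  show "a \<odot>\<^bsub>form_space A p q\<^esub> (\<omega> \<oplus>\<^bsub>form_space A p q\<^esub> \<eta>) =
      a \<odot>\<^bsub>form_space A p q\<^esub> \<omega> \<oplus>\<^bsub>form_space A p q\<^esub> a \<odot>\<^bsub>form_space A p q\<^esub> \<eta>"
    unfolding form_space_simps by (intro ext) (simp add: distrib_left)
  show "(a * b) \<odot>\<^bsub>form_space A p q\<^esub> \<omega> = a \<odot>\<^bsub>form_space A p q\<^esub> (b \<odot>\<^bsub>form_space A p q\<^esub> \<omega>)"
    unfolding form_space_simps by (intro ext) (simp add: mult.assoc)
qed (simp_all add: forms_scale)

lemma del_forms: "\<omega> \<in> forms A p q \<Longrightarrow> del A p q \<omega> \<in> forms A (p + 1) q"
  using gdel_forms[OF X, of "- \<i>" \<omega> p q] by (simp add: del_eq_gdel)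

lemma delbar_forms: "\<omega> \<in> forms A p q \<Longrightarrow> delbar A p q \<omega> \<in> forms A p (q + 1)"
  using gdel_forms[OF X, of \<i> \<omega> p q] by (simp add: delbar_eq_gdel)

lemma linear_gdel: "linear_on_forms A p q (gdel s A k)"
  using gdel_add[OF X forms_smooth forms_smooth] gdel_scale[OF X forms_smooth]
  by (auto simp: linear_on_forms_def plus_fun_def)

lemma linear_del: "linear_on_forms A p q (del A p q)"
  and linear_delbar: "linear_on_forms A p q (delbar A p q)"
  unfolding del_eq_gdel delbar_eq_gdel by (rule linear_gdel)+

lemma linear_del_delbar: "linear_on_forms A p q (\<lambda>\<theta>. del A p (q + 1) (delbar A p q \<theta>))"
  using linear_del[of p "q + 1"] linear_delbar[of p q] delbar_forms
  by (simp add: linear_on_forms_def)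

lemma linear_on_forms_0: 
  assumes "linear_on_forms A p q T"
  shows "T 0 = 0"
proof -
  have "T (scale_form 0 0) = scale_form 0 (T 0)"
    using assms forms_0 unfolding linear_on_forms_def by blast
  moreover have 0: "scale_form 0 \<omega> = 0" for \<omega> :: "('a, 'n) form" by (simp add: fun_eq_iff)
  ultimately show ?thesis by (simp only: 0)
qed

lemma linear_on_forms_uminus:
  assumes "linear_on_forms A p q T" "\<omega> \<in> forms A p q"
  shows "T (- \<omega>) = - T \<omega>"
proof -
  have "T (scale_form (-1) \<omega>) = scale_form (-1) (T \<omega>)"
    using assms unfolding linear_on_forms_def by blast
  then show ?thesis by (simp add: fun_Compl_def)
qed

lemma csub_kernel:
  assumes T: "linear_on_forms A p q T"
  shows "csub {\<theta> \<in> forms A p q. T \<theta> = (\<lambda>c x v. 0)} (form_space A p q)"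
proof (rule csubI[OF cvec_form_space])
  show "\<zero>\<^bsub>form_space A p q\<^esub> \<in> {\<theta> \<in> forms A p q. T \<theta> = (\<lambda>c x v. 0)}"
    using linear_on_forms_0[OF T] forms_0 by (simp add: zero_form)
  show "\<omega> \<oplus>\<^bsub>form_space A p q\<^esub> \<eta> \<in> {\<theta> \<in> forms A p q. T \<theta> = (\<lambda>c x v. 0)}"
    if "\<omega> \<in> {\<theta> \<in> forms A p q. T \<theta> = (\<lambda>c x v. 0)}" "\<eta> \<in> {\<theta> \<in> forms A p q. T \<theta> = (\<lambda>c x v. 0)}" for \<omega> \<eta>
    using that T by (simp add: zero_form linear_on_forms_def forms_add)
  show "a \<odot>\<^bsub>form_space A p q\<^esub> \<omega> \<in> {\<theta> \<in> forms A p q. T \<theta> = (\<lambda>c x v. 0)}"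
    if "\<omega> \<in> {\<theta> \<in> forms A p q. T \<theta> = (\<lambda>c x v. 0)}" for a \<omega>
  proof -
    have \<omega>: "\<omega> \<in> forms A p q" "T \<omega> = (\<lambda>c x v. 0)" using that by auto
    then have "T (scale_form a \<omega>) = scale_form a (T \<omega>)" using T unfolding linear_on_forms_def by blast
    then show ?thesis using \<omega> by (simp add: forms_scale)
  qed
qed auto

lemma csub_image:
  assumes T: "linear_on_forms A p' q' T" and im: "\<And>\<omega>. \<omega> \<in> forms A p' q' \<Longrightarrow> T \<omega> \<in> forms A p q"
  shows "csub (T ` forms A p' q') (form_space A p q)"
proof (rule csubI[OF cvec_form_space])
  show "\<zero>\<^bsub>form_space A p q\<^esub> \<in> T ` forms A p' q'"
    using linear_on_forms_0[OF T] forms_0 by force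
  show "\<omega> \<oplus>\<^bsub>form_space A p q\<^esub> \<eta> \<in> T ` forms A p' q'"
    if im: "\<omega> \<in> T ` forms A p' q'" "\<eta> \<in> T ` forms A p' q'" for \<omega> \<eta>
  proof -
    obtain \<omega>' \<eta>' where "\<omega>' \<in> forms A p' q'" "\<eta>' \<in> forms A p' q'" "\<omega> = T \<omega>'" "\<eta> = T \<eta>'"
      using im by auto
    then have "\<omega> + \<eta> = T (\<omega>' + \<eta>')" "\<omega>' + \<eta>' \<in> forms A p' q'"
      using T by (simp_all add: linear_on_forms_def forms_add)
    then show ?thesis by simp
  qed
  show "a \<odot>\<^bsub>form_space A p q\<^esub> \<omega> \<in> T ` forms A p' q'" if im: "\<omega> \<in> T ` forms A p' q'" for a \<omega>
  proof -
    obtain \<omega>' where "\<omega>' \<in> forms A p' q'" "\<omega> = T \<omega>'" using im by auto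
    then have "scale_form a \<omega> = T (scale_form a \<omega>')" "scale_form a \<omega>' \<in> forms A p' q'"
      using T by (simp_all add: linear_on_forms_def forms_scale)
    then show ?thesis by simp
  qed
qed (use im in auto)

lemma csub_im_del: "csub (im_del A p q) (form_space A p q)"
  unfolding im_del_def by (rule csub_image[OF linear_del]) (use del_forms[of _ "p - 1" q] in simp)

lemma csub_im_delbar: "csub (im_delbar A p q) (form_space A p q)"
  unfolding im_delbar_def by (rule csub_image[OF linear_delbar]) (use delbar_forms[of _ p "q - 1"] in simp)

lemma im_sum_iff:
  "\<theta> \<in> im_sum A p q \<longleftrightarrow> (\<exists>a\<in>forms A (p - 1) q. \<exists>b\<in>forms A p (q - 1).
     \<theta> = del A (p - 1) q a + delbar A p (q - 1) b)"
  by (auto simp: im_sum_def im_del_def im_delbar_def set_add_def')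

lemma csub_set_add:
  fixes M :: "'v cvs"
  assumes M: "cvec M" and V: "csub V M" and W: "csub W M"
  shows "csub (V <+>\<^bsub>M\<^esub> W) M"
proof -
  interpret module complex_ring M by fact
  note V' = csubD[OF V M] and W' = csubD[OF W M]
  show ?thesis
  proof (rule csubI[OF M])
    show "V <+>\<^bsub>M\<^esub> W \<subseteq> carrier M" using V'(1) W'(1) by (auto simp: set_add_def')
    show "\<zero>\<^bsub>M\<^esub> \<in> V <+>\<^bsub>M\<^esub> W"
      using V'(2) W'(2) by (auto simp: set_add_def' intro!: bexI[of _ "\<zero>\<^bsub>M\<^esub>"])
    show "x \<oplus>\<^bsub>M\<^esub> y \<in> V <+>\<^bsub>M\<^esub> W" if xy: "x \<in> V <+>\<^bsub>M\<^esub> W" "y \<in> V <+>\<^bsub>M\<^esub> W" for x y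
    proof -
      obtain a b where ab: "a \<in> V" "b \<in> W" "x = a \<oplus>\<^bsub>M\<^esub> b" using xy by (auto simp: set_add_def')
      obtain c d where cd: "c \<in> V" "d \<in> W" "y = c \<oplus>\<^bsub>M\<^esub> d" using xy by (auto simp: set_add_def')
      have "a \<in> carrier M" "b \<in> carrier M" "c \<in> carrier M" "d \<in> carrier M"
        using ab cd V'(1) W'(1) by auto
      then have "x \<oplus>\<^bsub>M\<^esub> y = (a \<oplus>\<^bsub>M\<^esub> c) \<oplus>\<^bsub>M\<^esub> (b \<oplus>\<^bsub>M\<^esub> d)" by (simp add: ab cd M.a_ac)
      then show ?thesis using V'(3)[OF ab(1) cd(1)] W'(3)[OF ab(2) cd(2)] by (auto simp: set_add_def')
    qed
    show "k \<odot>\<^bsub>M\<^esub> x \<in> V <+>\<^bsub>M\<^esub> W" if x: "x \<in> V <+>\<^bsub>M\<^esub> W" for k x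
    proof -
      obtain a b where ab: "a \<in> V" "b \<in> W" "x = a \<oplus>\<^bsub>M\<^esub> b" using x by (auto simp: set_add_def')
      have "a \<in> carrier M" "b \<in> carrier M" using ab V'(1) W'(1) by auto
      then have "k \<odot>\<^bsub>M\<^esub> x = k \<odot>\<^bsub>M\<^esub> a \<oplus>\<^bsub>M\<^esub> k \<odot>\<^bsub>M\<^esub> b" by (simp add: ab smult_r_distr)
      then show ?thesis using V'(4)[OF ab(1), of k] W'(4)[OF ab(2), of k] by (auto simp: set_add_def')
    qed
  qed
qed

lemma csub_im_sum: "csub (im_sum A p q) (form_space A p q)"
  unfolding im_sum_def by (intro csub_set_add cvec_form_space csub_im_del csub_im_delbar)

lemma forms_negative: "\<omega> \<in> forms A p q \<Longrightarrow> \<not> (0 \<le> p \<and> 0 \<le> q) \<Longrightarrow> \<omega> = 0"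
  by (auto simp: forms_def zero_form)

lemma gdel_anticommute_forms:
  assumes \<omega>: "\<omega> \<in> forms A p q"
  shows "gdel s A (nat (p + q + 1)) (gdel t A (nat (p + q)) \<omega>) =
    - gdel t A (nat (p + q + 1)) (gdel s A (nat (p + q)) \<omega>)"
proof (cases "0 \<le> p \<and> 0 \<le> q")
  case True
  then have "nat (p + q + 1) = Suc (nat (p + q))" by arith
  then show ?thesis
    by (intro ext) (simp only: uminus_apply gdel_anticommute[OF X forms_smooth[OF \<omega>], where s = s and t = t])
next
  case False
  then have "\<omega> = 0" using forms_negative \<omega> by blast
  then show ?thesis using linear_on_forms_0[OF linear_gdel] by simp
qed

lemma del_del: "\<omega> \<in> forms A p q \<Longrightarrow> del A (p + 1) q (del A p q \<omega>) = 0"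
  using gdel_anticommute_forms[of \<omega> p q "- \<i>" "- \<i>"] unfolding del_eq_gdel
  by (simp add: fun_eq_iff add_ac)

lemma delbar_delbar: "\<omega> \<in> forms A p q \<Longrightarrow> delbar A p (q + 1) (delbar A p q \<omega>) = 0"
  using gdel_anticommute_forms[of \<omega> p q \<i> \<i>] unfolding delbar_eq_gdel
  by (simp add: fun_eq_iff add_ac)

lemma delbar_del: "\<omega> \<in> forms A p q \<Longrightarrow>
    delbar A (p + 1) q (del A p q \<omega>) = - del A p (q + 1) (delbar A p q \<omega>)"
  using gdel_anticommute_forms[of \<omega> p q \<i> "- \<i>"] unfolding delbar_eq_gdel del_eq_gdel
  by (simp add: add_ac)

lemma del_im_sum:
  assumes "\<theta> \<in> im_sum A p q"
  shows "\<exists>b\<in>forms A p (q - 1). del A p q \<theta> = del A p q (delbar A p (q - 1) b)"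
    and "\<exists>a\<in>forms A (p - 1) q. delbar A p q \<theta> = delbar A p q (del A (p - 1) q a)"
proof -
  obtain a b where ab: "a \<in> forms A (p - 1) q" "b \<in> forms A p (q - 1)"
    and \<theta>: "\<theta> = del A (p - 1) q a + delbar A p (q - 1) b"
    using assms unfolding im_sum_iff by blast
  have c: "del A (p - 1) q a \<in> forms A p q" "delbar A p (q - 1) b \<in> forms A p q"
    using del_forms[OF ab(1)] delbar_forms[OF ab(2)] by simp_all
  show "\<exists>b\<in>forms A p (q - 1). del A p q \<theta> = del A p q (delbar A p (q - 1) b)"
    using ab c linear_del[of p q] del_del[OF ab(1)]
    by (intro bexI[of _ b]) (simp_all add: \<theta> linear_on_forms_def)
  show "\<exists>a\<in>forms A (p - 1) q. delbar A p q \<theta> = delbar A p q (del A (p - 1) q a)"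
    using ab c linear_delbar[of p q] delbar_delbar[OF ab(2)]
    by (intro bexI[of _ a]) (simp_all add: \<theta> linear_on_forms_def)
qed

lemma im_sum_forms: "im_sum A p q \<subseteq> forms A p q"
  using csubD(1)[OF csub_im_sum cvec_form_space] by simp

lemma im_sum_del_delbar:
  assumes "\<theta> \<in> im_sum A p q"
  shows "del A p (q + 1) (delbar A p q \<theta>) = 0"
proof -
  obtain a where a: "a \<in> forms A (p - 1) q" "delbar A p q \<theta> = delbar A p q (del A (p - 1) q a)"
    using del_im_sum(2)[OF assms] by blast
  have b: "delbar A (p - 1) q a \<in> forms A (p - 1) (q + 1)" using delbar_forms[OF a(1)] .
  have "delbar A p q \<theta> = - del A (p - 1) (q + 1) (delbar A (p - 1) q a)"
    using delbar_del[OF a(1)] a(2) by simp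
  then show ?thesis
    using del_del[OF b] del_forms[OF b] linear_on_forms_uminus[OF linear_del[of p "q + 1"]] by simp
qed

lemma im_del_im_sum: "im_del A p q \<subseteq> im_sum A p q"
proof
  fix \<theta> assume \<theta>: "\<theta> \<in> im_del A p q"
  have "0 \<in> im_delbar A p q" using csubD(2)[OF csub_im_delbar cvec_form_space] by simp
  from set_add_memI[OF \<theta> this, of "form_space A p q"] show "\<theta> \<in> im_sum A p q"
    by (simp add: im_sum_def)
qed

lemma im_delbar_im_sum: "im_delbar A p q \<subseteq> im_sum A p q"
proof
  fix \<theta> assume \<theta>: "\<theta> \<in> im_delbar A p q"
  have "0 \<in> im_del A p q" using csubD(2)[OF csub_im_del cvec_form_space] by simp
  from set_add_memI[OF this \<theta>, of "form_space A p q"] show "\<theta> \<in> im_sum A p q"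
    by (simp add: im_sum_def)
qed

abbreviation ker_del_delbar where
  "ker_del_delbar p q \<equiv> {\<theta> \<in> forms A p q. del A p (q + 1) (delbar A p q \<theta>) = (\<lambda>c x v. 0)}"

abbreviation ker_del where
  "ker_del p q \<equiv> {\<theta> \<in> forms A p q. del A p q \<theta> = (\<lambda>c x v. 0)}"

abbreviation ker_delbar where
  "ker_delbar p q \<equiv> {\<theta> \<in> forms A p q. delbar A p q \<theta> = (\<lambda>c x v. 0)}"

lemma del_del_delbar:
  assumes "\<theta> \<in> forms A p q" "del A p q \<theta> = 0"
  shows "del A p (q + 1) (delbar A p q \<theta>) = 0"
  using delbar_del[OF assms(1)] linear_on_forms_0[OF linear_delbar[of "p + 1" q]] assms(2) by simp

lemma G_del_presents:
  "\<exists>r. presents (form_space A p q) {\<theta> \<in> ker_del_delbar p q. del A p q \<theta> \<in> im_delbar A (p + 1) q}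
    (ker_del p q <+>\<^bsub>form_space A p q\<^esub> im_sum A p q) r (G_del A p q)"
proof -
  let ?N = "form_space A (p + 1) q"
  have sub: "im_sum A p q \<subseteq> ker_del_delbar p q" "ker_del p q \<subseteq> ker_del_delbar p q"
      "im_del A p q \<subseteq> ker_del p q"
  proof -
    show "im_sum A p q \<subseteq> ker_del_delbar p q"
      using im_sum_forms im_sum_del_delbar by (auto simp: zero_form)
    show "ker_del p q \<subseteq> ker_del_delbar p q"
      using del_del_delbar by (auto simp: zero_form)
    show "im_del A p q \<subseteq> ker_del p q"
      using del_forms[of _ "p - 1" q] del_del[of _ "p - 1" q] by (auto simp: zero_form im_del_def)
  qed
  have closed: "del A p q \<theta> \<in> carrier ?N" if "\<theta> \<in> ker_del_delbar p q" for \<theta>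
    using del_forms that by simp
  have add: "del A p q (\<theta> \<oplus>\<^bsub>form_space A p q\<^esub> \<eta>) = del A p q \<theta> \<oplus>\<^bsub>?N\<^esub> del A p q \<eta>"
    if "\<theta> \<in> ker_del_delbar p q" "\<eta> \<in> ker_del_delbar p q" for \<theta> \<eta>
    using that linear_del[of p q] by (simp add: linear_on_forms_def)
  have smult: "del A p q (a \<odot>\<^bsub>form_space A p q\<^esub> \<theta>) = a \<odot>\<^bsub>?N\<^esub> del A p q \<theta>"
    if "\<theta> \<in> ker_del_delbar p q" for a \<theta>
    using that linear_del[of p q] by (simp add: linear_on_forms_def)
  have im: "del A p q \<theta> \<in> im_delbar A (p + 1) q" if \<theta>: "\<theta> \<in> im_sum A p q" for \<theta>
  proof -
    obtain b where b: "b \<in> forms A p (q - 1)" "del A p q \<theta> = del A p q (delbar A p (q - 1) b)"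
      using del_im_sum(1)[OF \<theta>] by blast
    have "del A p q \<theta> = delbar A (p + 1) (q - 1) (- del A p (q - 1) b)"
      using delbar_del[OF b(1)] linear_on_forms_uminus[OF linear_delbar del_forms[OF b(1)]] b(2) by simp
    then show ?thesis unfolding im_delbar_def using forms_uminus[OF del_forms[OF b(1)]] by (rule image_eqI)
  qed
  have ker: "del A p q \<theta> \<in> im_delbar A (p + 1) q" if "\<theta> \<in> ker_del p q" for \<theta>
    using that csubD(2)[OF csub_im_delbar cvec_form_space] by (simp add: zero_form)
  show ?thesis
    unfolding G_del_def calG_del_def del_map_def pi_A_def H_A_def H_del_def H_delbar_def quot_space_simps(1)
    by (rule exI, rule kernel_quotient_presents[where f = "del A p q" and N = ?N and
        K = "ker_del_delbar p q" and V = "im_delbar A (p + 1) q" and F = "form_space A p q" and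
        L = "ker_del p q" and J = "im_del A p q" and I = "im_sum A p q", OF cvec_form_space csub_kernel[OF linear_del_delbar]
        csub_im_sum csub_kernel[OF linear_del] csub_im_del sub im_del_im_sum cvec_form_space csub_im_delbar
        closed add smult im ker])
qed

lemma G_delbar_presents:
  "\<exists>r. presents (form_space A p q) {\<theta> \<in> ker_del_delbar p q. delbar A p q \<theta> \<in> im_del A p (q + 1)}
    (ker_delbar p q <+>\<^bsub>form_space A p q\<^esub> im_sum A p q) r (G_delbar A p q)"
proof -
  let ?N = "form_space A p (q + 1)"
  have sub: "im_sum A p q \<subseteq> ker_del_delbar p q" "ker_delbar p q \<subseteq> ker_del_delbar p q"
      "im_delbar A p q \<subseteq> ker_delbar p q"
  proof -
    show "im_sum A p q \<subseteq> ker_del_delbar p q"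
      using im_sum_forms im_sum_del_delbar by (auto simp: zero_form)
    show "ker_delbar p q \<subseteq> ker_del_delbar p q"
      using linear_on_forms_0[OF linear_del[of p "q + 1"]] by (auto simp: zero_form)
    show "im_delbar A p q \<subseteq> ker_delbar p q"
      using delbar_forms[of _ p "q - 1"] delbar_delbar[of _ p "q - 1"] by (auto simp: zero_form im_delbar_def)
  qed
  have closed: "delbar A p q \<theta> \<in> carrier ?N" if "\<theta> \<in> ker_del_delbar p q" for \<theta>
    using delbar_forms that by simp
  have add: "delbar A p q (\<theta> \<oplus>\<^bsub>form_space A p q\<^esub> \<eta>) = delbar A p q \<theta> \<oplus>\<^bsub>?N\<^esub> delbar A p q \<eta>"
    if "\<theta> \<in> ker_del_delbar p q" "\<eta> \<in> ker_del_delbar p q" for \<theta> \<eta>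
    using that linear_delbar[of p q] by (simp add: linear_on_forms_def)
  have smult: "delbar A p q (a \<odot>\<^bsub>form_space A p q\<^esub> \<theta>) = a \<odot>\<^bsub>?N\<^esub> delbar A p q \<theta>"
    if "\<theta> \<in> ker_del_delbar p q" for a \<theta>
    using that linear_delbar[of p q] by (simp add: linear_on_forms_def)
  have im: "delbar A p q \<theta> \<in> im_del A p (q + 1)" if \<theta>: "\<theta> \<in> im_sum A p q" for \<theta>
  proof -
    obtain a where a: "a \<in> forms A (p - 1) q" "delbar A p q \<theta> = delbar A p q (del A (p - 1) q a)"
      using del_im_sum(2)[OF \<theta>] by blast
    have "delbar A p q \<theta> = del A (p - 1) (q + 1) (- delbar A (p - 1) q a)"
      using delbar_del[OF a(1)] linear_on_forms_uminus[OF linear_del delbar_forms[OF a(1)]] a(2) by simp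
    then show ?thesis unfolding im_del_def using forms_uminus[OF delbar_forms[OF a(1)]] by (rule image_eqI)
  qed
  have ker: "delbar A p q \<theta> \<in> im_del A p (q + 1)" if "\<theta> \<in> ker_delbar p q" for \<theta>
    using that csubD(2)[OF csub_im_del cvec_form_space] by (simp add: zero_form)
  show ?thesis
    unfolding G_delbar_def calG_delbar_def delbar_map_def pi_A_def H_A_def H_del_def H_delbar_def quot_space_simps(1)
    by (rule exI, rule kernel_quotient_presents[where f = "delbar A p q" and N = ?N and
        K = "ker_del_delbar p q" and V = "im_del A p (q + 1)" and F = "form_space A p q" and
        L = "ker_delbar p q" and J = "im_delbar A p q" and I = "im_sum A p q", OF cvec_form_space csub_kernel[OF linear_del_delbar]
        csub_im_sum csub_kernel[OF linear_delbar] csub_im_delbar sub im_delbar_im_sum cvec_form_space csub_im_del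
        closed add smult im ker])
qed

lemma set_add_im_sum_iff:
  "\<theta> \<in> L <+>\<^bsub>form_space A p q\<^esub> im_sum A p q \<longleftrightarrow> (\<exists>l\<in>L. \<exists>i\<in>im_sum A p q. \<theta> = l + i)"
  by (auto simp: set_add_def')

lemma ker_sum_iff:
  assumes \<theta>: "\<theta> \<in> forms A p q" and \<eta>: "\<eta> \<in> forms A (p + 1) (q - 1)"
    and eq: "del A p q \<theta> = delbar A (p + 1) (q - 1) \<eta>"
  shows "\<theta> \<in> ker_del p q <+>\<^bsub>form_space A p q\<^esub> im_sum A p q \<longleftrightarrow>
    \<eta> \<in> ker_delbar (p + 1) (q - 1) <+>\<^bsub>form_space A (p + 1) (q - 1)\<^esub> im_sum A (p + 1) (q - 1)"
proof
  assume "\<theta> \<in> ker_del p q <+>\<^bsub>form_space A p q\<^esub> im_sum A p q"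
  then obtain l i where l: "l \<in> forms A p q" "del A p q l = 0" and i: "i \<in> im_sum A p q" "\<theta> = l + i"
    unfolding set_add_im_sum_iff by (auto simp: zero_form)
  obtain b where b: "b \<in> forms A p (q - 1)" "del A p q i = del A p q (delbar A p (q - 1) b)"
    using del_im_sum(1)[OF i(1)] by blast
  have db: "del A p (q - 1) b \<in> forms A (p + 1) (q - 1)" using del_forms[OF b(1)] .
  have "delbar A (p + 1) (q - 1) (\<eta> + del A p (q - 1) b) = del A p q \<theta> - del A p q (delbar A p (q - 1) b)"
    using linear_delbar[of "p + 1" "q - 1"] \<eta> db delbar_del[OF b(1)] by (simp add: linear_on_forms_def eq)
  also have "del A p q \<theta> = del A p q l + del A p q i"
    using linear_del[of p q] l(1) i im_sum_forms unfolding linear_on_forms_def i(2) by blast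
  finally have "delbar A (p + 1) (q - 1) (\<eta> + del A p (q - 1) b) = 0"
    unfolding l(2) b(2) by (simp only: add_0 diff_self)
  then have "\<eta> + del A p (q - 1) b \<in> ker_delbar (p + 1) (q - 1)"
    unfolding zero_form using forms_add[OF \<eta> db] by blast
  moreover have "- del A p (q - 1) b \<in> im_sum A (p + 1) (q - 1)"
  proof -
    have "- del A p (q - 1) b = del A (p + 1 - 1) (q - 1) (- b) + delbar A (p + 1) (q - 1 - 1) 0"
      using linear_on_forms_uminus[OF linear_del b(1)] linear_on_forms_0[OF linear_delbar] by simp
    then show ?thesis unfolding im_sum_iff using forms_uminus[OF b(1)] forms_0 by force
  qed
  ultimately show "\<eta> \<in> ker_delbar (p + 1) (q - 1) <+>\<^bsub>form_space A (p + 1) (q - 1)\<^esub> im_sum A (p + 1) (q - 1)"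
    unfolding set_add_im_sum_iff by (intro bexI) (auto simp: algebra_simps)
next
  assume "\<eta> \<in> ker_delbar (p + 1) (q - 1) <+>\<^bsub>form_space A (p + 1) (q - 1)\<^esub> im_sum A (p + 1) (q - 1)"
  then obtain l i where l: "l \<in> forms A (p + 1) (q - 1)" "delbar A (p + 1) (q - 1) l = 0"
      and i: "i \<in> im_sum A (p + 1) (q - 1)" "\<eta> = l + i"
    unfolding set_add_im_sum_iff by (auto simp: zero_form)
  obtain b where b: "b \<in> forms A p (q - 1)"
      "delbar A (p + 1) (q - 1) i = delbar A (p + 1) (q - 1) (del A p (q - 1) b)"
    using del_im_sum(2)[OF i(1)] by auto
  have db: "delbar A p (q - 1) b \<in> forms A p q" using delbar_forms[OF b(1)] by simp
  have "del A p q (\<theta> + delbar A p (q - 1) b) =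
      delbar A (p + 1) (q - 1) \<eta> - delbar A (p + 1) (q - 1) (del A p (q - 1) b)"
    using linear_del[of p q] \<theta> db delbar_del[OF b(1)] by (simp add: linear_on_forms_def eq)
  also have "delbar A (p + 1) (q - 1) \<eta> = delbar A (p + 1) (q - 1) l + delbar A (p + 1) (q - 1) i"
    using linear_delbar[of "p + 1" "q - 1"] l(1) i im_sum_forms unfolding linear_on_forms_def i(2) by blast
  finally have "del A p q (\<theta> + delbar A p (q - 1) b) = 0"
    unfolding l(2) b(2) by (simp only: add_0 diff_self)
  then have "\<theta> + delbar A p (q - 1) b \<in> ker_del p q"
    unfolding zero_form using forms_add[OF \<theta> db] by blast
  moreover have "- delbar A p (q - 1) b \<in> im_sum A p q"
  proof -
    have "- delbar A p (q - 1) b = del A (p - 1) q 0 + delbar A p (q - 1) (- b)"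
      using linear_on_forms_uminus[OF linear_delbar b(1)] linear_on_forms_0[OF linear_del] by simp
    then show ?thesis unfolding im_sum_iff using forms_uminus[OF b(1)] forms_0 by force
  qed
  ultimately show "\<theta> \<in> ker_del p q <+>\<^bsub>form_space A p q\<^esub> im_sum A p q"
    unfolding set_add_im_sum_iff by (intro bexI) (auto simp: algebra_simps)
qed

lemma g_del_eq_g_delbar: "g_del A p q = g_delbar A (p + 1) (q - 1)"
proof -
  obtain r where r: "presents (form_space A p q)
      {\<theta> \<in> ker_del_delbar p q. del A p q \<theta> \<in> im_delbar A (p + 1) q}
      (ker_del p q <+>\<^bsub>form_space A p q\<^esub> im_sum A p q) r (G_del A p q)"
    using G_del_presents by blast
  let ?p = "p + 1" and ?q = "q - 1"
  obtain r' where r': "presents (form_space A ?p ?q)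
      {\<theta> \<in> ker_del_delbar ?p ?q. delbar A ?p ?q \<theta> \<in> im_del A ?p (?q + 1)}
      (ker_delbar ?p ?q <+>\<^bsub>form_space A ?p ?q\<^esub> im_sum A ?p ?q) r' (G_delbar A ?p ?q)"
    using G_delbar_presents by blast
  let ?Y = "{\<theta> \<in> ker_del_delbar p q. del A p q \<theta> \<in> im_delbar A (p + 1) q}"
  let ?Y' = "{\<theta> \<in> ker_del_delbar ?p ?q. delbar A ?p ?q \<theta> \<in> im_del A ?p (?q + 1)}"
  have Y: "\<theta> \<in> ?Y \<longleftrightarrow> \<theta> \<in> forms A p q \<and> (\<exists>\<eta>\<in>forms A ?p ?q. del A p q \<theta> = delbar A ?p ?q \<eta>)" for \<theta>
  proof -
    have "del A p (q + 1) (delbar A p q \<theta>) = 0"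
      if "\<theta> \<in> forms A p q" "\<eta> \<in> forms A ?p ?q" "del A p q \<theta> = delbar A ?p ?q \<eta>" for \<eta>
      using delbar_del[OF that(1)] delbar_delbar[OF that(2)] that(3) by simp
    then show ?thesis by (auto simp: zero_form im_delbar_def)
  qed
  have Y': "\<eta> \<in> ?Y' \<longleftrightarrow> \<eta> \<in> forms A ?p ?q \<and> (\<exists>\<theta>\<in>forms A p q. del A p q \<theta> = delbar A ?p ?q \<eta>)" for \<eta>
  proof -
    have "del A ?p q (delbar A ?p ?q \<eta>) = 0"
      if "\<theta> \<in> forms A p q" "del A p q \<theta> = delbar A ?p ?q \<eta>" for \<theta>
      using del_del[OF that(1)] that(2) by simp
    moreover have "delbar A ?p ?q \<eta> \<in> im_del A ?p (?q + 1) \<longleftrightarrow>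
        (\<exists>\<theta>\<in>forms A p q. del A p q \<theta> = delbar A ?p ?q \<eta>)"
      by (simp add: im_del_def image_iff) metis
    ultimately show ?thesis by (auto simp: zero_form)
  qed
  define R where "R = {(\<theta>, \<eta>). \<theta> \<in> forms A p q \<and> \<eta> \<in> forms A ?p ?q \<and> del A p q \<theta> = delbar A ?p ?q \<eta>}"
  show ?thesis
    unfolding g_del_def g_delbar_def
  proof (rule cdim_eq_of_presentations[OF r r', of R])
    show "R \<subseteq> ?Y \<times> ?Y'" unfolding R_def using Y Y' by blast
    show "?Y \<subseteq> fst ` R" unfolding R_def using Y by force
    show "?Y' \<subseteq> snd ` R" unfolding R_def using Y' by force
    show "(\<theta> \<oplus>\<^bsub>form_space A p q\<^esub> \<theta>', \<eta> \<oplus>\<^bsub>form_space A ?p ?q\<^esub> \<eta>') \<in> R"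
      if "(\<theta>, \<eta>) \<in> R" "(\<theta>', \<eta>') \<in> R" for \<theta> \<eta> \<theta>' \<eta>'
      using that linear_del[of p q] linear_delbar[of ?p ?q]
      by (simp add: R_def forms_add linear_on_forms_def)
    show "(a \<odot>\<^bsub>form_space A p q\<^esub> \<theta>, a \<odot>\<^bsub>form_space A ?p ?q\<^esub> \<eta>) \<in> R" if "(\<theta>, \<eta>) \<in> R" for a \<theta> \<eta>
      using that linear_del[of p q] linear_delbar[of ?p ?q]
      by (simp add: R_def forms_scale linear_on_forms_def)
    show "\<theta> \<in> ker_del p q <+>\<^bsub>form_space A p q\<^esub> im_sum A p q \<longleftrightarrow>
      \<eta> \<in> ker_delbar ?p ?q <+>\<^bsub>form_space A ?p ?q\<^esub> im_sum A ?p ?q" if "(\<theta>, \<eta>) \<in> R" for \<theta> \<eta>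
      using that by (intro ker_sum_iff) (auto simp: R_def)
  qed
qed

end

theorem proposition5p1:
  fixes X :: "'a topology" and A :: "('a, 'n::finite) chart set" and p q :: int
  assumes "complex_manifold X A" and "compact_space X"
  shows "g_del A p q = g_delbar A (p + 1) (q - 1)"
  using assms(1) by (rule g_del_eq_g_delbar)

end
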